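(* Suppose $P$ is a submonoid of a group. Then the map $v_p\mapsto t_p$ extends to a canonical surjective $*$-homomorphism $\lambda^{\#}\colon\mathrm C^*_s(P)\to\mathcal T_u(P)$, which is an isomorphism if and only if $P$ satisfies independence.
   Context: Let $P$ be a submonoid of a group $G$ with identity $e$. A word is a finite sequence $\alpha=(p_1,p_2,\ldots,p_{2k-1},p_{2k})$ of even length $2k\ge 0$ with entries in $P$; $\mathcal W$ is the set of all words (including the empty word). Put $\dot\alpha:=p_1^{-1}p_2\cdots p_{2k-1}^{-1}p_{2k}\in G$ (equal to $e$ for the empty word); $\alpha$ is neutral if $\dot\alpha=e$. Put $K(\alpha):=P\cap p_{2k}^{-1}p_{2k-1}P\cap p_{2k}^{-1}p_{2k-1}p_{2k-2}^{-1}p_{2k-3}P\cap\cdots\cap p_{2k}^{-1}p_{2k-1}\cdots p_2^{-1}p_1P\subseteq P$ (equal to $P$ for the empty word), and $\mathfrak J:=\{K(\alpha):\alpha\in\mathcal W\}$, the collection of constructible right ideals. For a family $\{w_p\}_{p\in P}$ in a unital $\mathrm C^*$-algebra, $\dot w_\alpha:=w_{p_1}^*w_{p_2}\cdots w_{p_{2k-1}}^*w_{p_{2k}}$ ($=1$ for the empty word). $\mathrm C^*_s(P)$ (Li's semigroup $\mathrm C^*$-algebra) is the universal $\mathrm C^*$-algebra generated by a family of isometries $\{v_p:p\in P\}$ and projections $\{e_S:S\in\mathfrak J\cup\{\emptyset\}\}$ such that (i) $v_pv_q=v_{pq}$ for $p,q\in P$; (ii) $e_\emptyset=0$; (iii)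 $\dot v_\alpha=e_S$ whenever $S\in\mathfrak J$ and $\alpha\in\mathcal W$ satisfy $\dot\alpha=e$ and $K(\alpha)=S$. $\mathcal T_u(P)$ is the universal $\mathrm C^*$-algebra with generators $\{t_p:p\in P\}$ subject to: (T1) $t_e=1$; (T2) $\dot t_\alpha=0$ if $\alpha$ is neutral and $K(\alpha)=\emptyset$; (T3) $\dot t_\alpha=\dot t_\beta$ if $\alpha,\beta$ are neutral and $K(\alpha)=K(\beta)$; (T4) $\prod_{\beta\in F}(\dot t_\alpha-\dot t_\beta)=0$ if $\alpha$ is a neutral word and $F$ is a finite set of neutral words with $K(\alpha)=\bigcup_{\beta\in F}K(\beta)$. $P$ satisfies independence if a finite union $\bigcup_{\beta\in F}K(\beta)$ of constructible right ideals is itself a constructible right ideal $K(\alpha)$ only when $K(\alpha)\in\{K(\beta):\beta\in F\}$. *)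

theory Defs
  imports Complex_Main "HOL-Algebra.Coset" "HOL-Algebra.Module" "HOL-Library.Poly_Mapping"
begin

section \<open>Unital star-algebras and \<open>C\<^sup>*\<close>-algebras\<close>

record 'a star_algebra = "(complex, 'a) module" +
  adj :: "'a \<Rightarrow> 'a" (\<open>star\<index> _\<close> [81] 80)

record 'a cstar_algebra = "'a star_algebra" +
  cnorm :: "'a \<Rightarrow> real" (\<open>\<parallel>_\<parallel>\<index>\<close>)

locale unital_star_algebra = ring A for A (structure) +
  assumes smult_closed: "x \<in> carrier A \<Longrightarrow> c \<odot> x \<in> carrier A"
    and smult_l_distr: "x \<in> carrier A \<Longrightarrow> (c + d) \<odot> x = c \<odot> x \<oplus> d \<odot> x"
    and smult_r_distr: "x \<in> carrier A \<Longrightarrow> y \<in> carrier A \<Longrightarrow> c \<odot> (x \<oplus> y) = c \<odot> x \<oplus> c \<odot> y"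
    and smult_assoc: "x \<in> carrier A \<Longrightarrow> (c * d) \<odot> x = c \<odot> (d \<odot> x)"
    and smult_one: "x \<in> carrier A \<Longrightarrow> 1 \<odot> x = x"
    and smult_mult_l: "x \<in> carrier A \<Longrightarrow> y \<in> carrier A \<Longrightarrow> (c \<odot> x) \<otimes> y = c \<odot> (x \<otimes> y)"
    and smult_mult_r: "x \<in> carrier A \<Longrightarrow> y \<in> carrier A \<Longrightarrow> x \<otimes> (c \<odot> y) = c \<odot> (x \<otimes> y)"
    and star_closed: "x \<in> carrier A \<Longrightarrow> star x \<in> carrier A"
    and star_star: "x \<in> carrier A \<Longrightarrow> star (star x) = x"
    and star_add: "x \<in> carrier A \<Longrightarrow> y \<in> carrier A \<Longrightarrow> star (x \<oplus> y) = star x \<oplus> star y"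
    and star_mult: "x \<in> carrier A \<Longrightarrow> y \<in> carrier A \<Longrightarrow> star (x \<otimes> y) = star y \<otimes> star x"
    and star_smult: "x \<in> carrier A \<Longrightarrow> star (c \<odot> x) = cnj c \<odot> star x"

definition cstar_seminorm :: "('a, 'm) star_algebra_scheme \<Rightarrow> ('a \<Rightarrow> real) \<Rightarrow> bool" where
  "cstar_seminorm A N \<longleftrightarrow>
     (\<forall>x\<in>carrier A. 0 \<le> N x) \<and>
     (\<forall>x\<in>carrier A. \<forall>y\<in>carrier A. N (x \<oplus>\<^bsub>A\<^esub> y) \<le> N x + N y) \<and>
     (\<forall>c. \<forall>x\<in>carrier A. N (c \<odot>\<^bsub>A\<^esub> x) = cmod c * N x) \<and>
     (\<forall>x\<in>carrier A. \<forall>y\<in>carrier A. N (x \<otimes>\<^bsub>A\<^esub> y) \<le> N x * N y) \<and>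
     (\<forall>x\<in>carrier A. N (star\<^bsub>A\<^esub> x \<otimes>\<^bsub>A\<^esub> x) = (N x)\<^sup>2)"

text \<open>The zero algebra counts as a unital \<open>C\<^sup>*\<close>-algebra.\<close>

locale unital_cstar_algebra = unital_star_algebra A for A (structure) +
  assumes norm_seminorm: "cstar_seminorm A (cnorm A)"
    and norm_definite: "x \<in> carrier A \<Longrightarrow> \<parallel>x\<parallel> = 0 \<Longrightarrow> x = \<zero>"
    and norm_complete: "(\<And>n. s n \<in> carrier A) \<Longrightarrow>
      (\<And>e. e > 0 \<Longrightarrow> \<exists>M. \<forall>m\<ge>M. \<forall>n\<ge>M. \<parallel>s m \<ominus> s n\<parallel> < e) \<Longrightarrow>
      \<exists>x\<in>carrier A. (\<lambda>n. \<parallel>s n \<ominus> x\<parallel>) \<longlonglongrightarrow> 0"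

definition star_hom ::
  "('a, 'm) star_algebra_scheme \<Rightarrow> ('b, 'n) star_algebra_scheme \<Rightarrow> ('a \<Rightarrow> 'b) set" where
  "star_hom A B = {h \<in> ring_hom A B. \<forall>x\<in>carrier A.
     (\<forall>c. h (c \<odot>\<^bsub>A\<^esub> x) = c \<odot>\<^bsub>B\<^esub> h x) \<and> h (star\<^bsub>A\<^esub> x) = star\<^bsub>B\<^esub> (h x)}"

definition star_iso ::
  "('a, 'm) star_algebra_scheme \<Rightarrow> ('b, 'n) star_algebra_scheme \<Rightarrow> ('a \<Rightarrow> 'b) set" where
  "star_iso A B = {h \<in> star_hom A B. bij_betw h (carrier A) (carrier B)}"


section \<open>The free unital star-algebra\<close>

text \<open>The complex monoid algebra of the free monoid on the letters \<open>x\<close> and \<open>x\<^sup>*\<close>;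
  the wrapper around lists carries the monoid structure that the convolution
  product of \<^theory>\<open>HOL-Library.Poly_Mapping\<close> needs.\<close>

datatype 'x letter = Gen 'x | Gen_adj 'x

datatype 'x monomial = Monomial (letters: "'x letter list")

instantiation monomial :: (type) monoid_add
begin

definition zero_monomial :: "'a monomial" where "0 = Monomial []"

definition plus_monomial :: "'a monomial \<Rightarrow> 'a monomial \<Rightarrow> 'a monomial" where
  "u + w = Monomial (letters u @ letters w)"

instance
  by standard (auto simp: zero_monomial_def plus_monomial_def)

end

type_synonym 'x star_poly = "'x monomial \<Rightarrow>\<^sub>0 complex"

fun letter_base :: "'x letter \<Rightarrow> 'x" where
  "letter_base (Gen x) = x"
| "letter_base (Gen_adj x) = x"

fun letter_adj :: "'x letter \<Rightarrow> 'x letter" where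
  "letter_adj (Gen x) = Gen_adj x"
| "letter_adj (Gen_adj x) = Gen x"

definition monomial_adj :: "'x monomial \<Rightarrow> 'x monomial" where
  "monomial_adj w = Monomial (rev (map letter_adj (letters w)))"

definition star_poly_adj :: "'x star_poly \<Rightarrow> 'x star_poly" where
  "star_poly_adj f = Poly_Mapping.map_key monomial_adj (Poly_Mapping.map cnj f)"

definition poly_gen :: "'x \<Rightarrow> 'x star_poly" where
  "poly_gen x = Poly_Mapping.single (Monomial [Gen x]) 1"

definition free_star_algebra :: "'x set \<Rightarrow> 'x star_poly star_algebra" where
  "free_star_algebra X =
     \<lparr>carrier = {f. \<forall>w\<in>Poly_Mapping.keys f. letter_base ` set (letters w) \<subseteq> X},
      mult = (*), one = 1, zero = 0, add = (+),
      smult = (\<lambda>c f. Poly_Mapping.single 0 c * f), adj = star_poly_adj\<rparr>"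


section \<open>Universal \<open>C\<^sup>*\<close>-algebras\<close>

text \<open>Hausdorff completion with respect to a seminorm: Cauchy sequences modulo null sequences.\<close>

definition cauchy_seqs :: "('a, 'm) star_algebra_scheme \<Rightarrow> ('a \<Rightarrow> real) \<Rightarrow> (nat \<Rightarrow> 'a) set" where
  "cauchy_seqs A N = {s. (\<forall>n. s n \<in> carrier A) \<and>
     (\<forall>e>0. \<exists>M. \<forall>m\<ge>M. \<forall>n\<ge>M. N (s m \<ominus>\<^bsub>A\<^esub> s n) < e)}"

definition null_rel ::
  "('a, 'm) star_algebra_scheme \<Rightarrow> ('a \<Rightarrow> real) \<Rightarrow> ((nat \<Rightarrow> 'a) \<times> (nat \<Rightarrow> 'a)) set" where
  "null_rel A N = {(s, t). s \<in> cauchy_seqs A N \<and> t \<in> cauchy_seqs A N \<and>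
     (\<lambda>n. N (s n \<ominus>\<^bsub>A\<^esub> t n)) \<longlonglongrightarrow> 0}"

definition completion ::
  "('a, 'm) star_algebra_scheme \<Rightarrow> ('a \<Rightarrow> real) \<Rightarrow> (nat \<Rightarrow> 'a) set cstar_algebra" where
  "completion A N =
     \<lparr>carrier = cauchy_seqs A N // null_rel A N,
      mult = (\<lambda>a b. \<Union>s\<in>a. \<Union>t\<in>b. null_rel A N `` {\<lambda>n. s n \<otimes>\<^bsub>A\<^esub> t n}),
      one = null_rel A N `` {\<lambda>n. \<one>\<^bsub>A\<^esub>},
      zero = null_rel A N `` {\<lambda>n. \<zero>\<^bsub>A\<^esub>},
      add = (\<lambda>a b. \<Union>s\<in>a. \<Union>t\<in>b. null_rel A N `` {\<lambda>n. s n \<oplus>\<^bsub>A\<^esub> t n}),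
      smult = (\<lambda>c a. \<Union>s\<in>a. null_rel A N `` {\<lambda>n. c \<odot>\<^bsub>A\<^esub> s n}),
      adj = (\<lambda>a. \<Union>s\<in>a. null_rel A N `` {\<lambda>n. star\<^bsub>A\<^esub> (s n)}),
      cnorm = (\<lambda>a. THE r. \<forall>s\<in>a. (\<lambda>n. N (s n)) \<longlonglongrightarrow> r)\<rparr>"

definition completion_incl ::
  "('a, 'm) star_algebra_scheme \<Rightarrow> ('a \<Rightarrow> real) \<Rightarrow> 'a \<Rightarrow> (nat \<Rightarrow> 'a) set" where
  "completion_incl A N x = null_rel A N `` {\<lambda>n. x}"

text \<open>The universal \<open>C\<^sup>*\<close>-algebra with generators \<open>X\<close> subject to the vanishing of the
  \<open>*\<close>-polynomials in \<open>R\<close> is the completion of the free unital star-algebra in the largest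
  \<open>C\<^sup>*\<close>-seminorm that vanishes on \<open>R\<close>.  The supremum is meaningful only if these seminorms are
  bounded at every generator; this is proved below for the two presentations of interest,
  together with the existence half of the universal property for arbitrary unital
  \<open>C\<^sup>*\<close>-algebras.\<close>

definition admissible_seminorms :: "'x set \<Rightarrow> 'x star_poly set \<Rightarrow> ('x star_poly \<Rightarrow> real) set" where
  "admissible_seminorms X R =
     {N. cstar_seminorm (free_star_algebra X) N \<and> (\<forall>r\<in>R. N r = 0)}"

definition universal_seminorm :: "'x set \<Rightarrow> 'x star_poly set \<Rightarrow> 'x star_poly \<Rightarrow> real" where
  "universal_seminorm X R f = (SUP N\<in>admissible_seminorms X R. N f)"

definition universal_cstar ::
  "'x set \<Rightarrow> 'x star_poly set \<Rightarrow> (nat \<Rightarrow> 'x star_poly) set cstar_algebra" where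
  "universal_cstar X R = completion (free_star_algebra X) (universal_seminorm X R)"

definition universal_gen ::
  "'x set \<Rightarrow> 'x star_poly set \<Rightarrow> 'x \<Rightarrow> (nat \<Rightarrow> 'x star_poly) set" where
  "universal_gen X R x =
     completion_incl (free_star_algebra X) (universal_seminorm X R) (poly_gen x)"


section \<open>Words and constructible right ideals\<close>

definition words :: "'g set \<Rightarrow> 'g list set" where
  "words P = {\<alpha>. set \<alpha> \<subseteq> P \<and> even (length \<alpha>)}"

text \<open>The equations for singleton lists only serve lists of odd length, which are not words.\<close>

fun word_eval :: "('g, 'm) monoid_scheme \<Rightarrow> 'g list \<Rightarrow> 'g" where
  "word_eval G [] = \<one>\<^bsub>G\<^esub>"
| "word_eval G [p] = undefined"
| "word_eval G (p # q # \<alpha>) = inv\<^bsub>G\<^esub> p \<otimes>\<^bsub>G\<^esub> q \<otimes>\<^bsub>G\<^esub> word_eval G \<alpha>"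

fun word_op :: "('a, 'm) star_algebra_scheme \<Rightarrow> ('g \<Rightarrow> 'a) \<Rightarrow> 'g list \<Rightarrow> 'a" where
  "word_op A w [] = \<one>\<^bsub>A\<^esub>"
| "word_op A w [p] = undefined"
| "word_op A w (p # q # \<alpha>) = star\<^bsub>A\<^esub> (w p) \<otimes>\<^bsub>A\<^esub> w q \<otimes>\<^bsub>A\<^esub> word_op A w \<alpha>"

definition neutral_words :: "('g, 'm) monoid_scheme \<Rightarrow> 'g set \<Rightarrow> 'g list set" where
  "neutral_words G P = {\<alpha> \<in> words P. word_eval G \<alpha> = \<one>\<^bsub>G\<^esub>}"

text \<open>Reversing the final segment \<open>p\<^sub>2\<^sub>j\<^sub>+\<^sub>1, \<dots>, p\<^sub>2\<^sub>k\<close> of a word gives the factor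
  \<open>p\<^sub>2\<^sub>k\<^sup>-\<^sup>1 p\<^sub>2\<^sub>k\<^sub>-\<^sub>1 \<cdots> p\<^sub>2\<^sub>j\<^sub>+\<^sub>2\<^sup>-\<^sup>1 p\<^sub>2\<^sub>j\<^sub>+\<^sub>1\<close>; the index \<open>j = k\<close> contributes \<open>P\<close> itself.\<close>

definition constr_ideal :: "('g, 'm) monoid_scheme \<Rightarrow> 'g set \<Rightarrow> 'g list \<Rightarrow> 'g set" where
  "constr_ideal G P \<alpha> =
     (\<Inter>j\<in>{0..length \<alpha> div 2}. word_eval G (rev (drop (2 * j) \<alpha>)) <#\<^bsub>G\<^esub> P)"

definition constr_ideals :: "('g, 'm) monoid_scheme \<Rightarrow> 'g set \<Rightarrow> 'g set set" where
  "constr_ideals G P = constr_ideal G P ` words P"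

text \<open>The families \<open>F\<close> are nonempty: otherwise every \<open>P\<close> with \<open>\<emptyset>\<close> among its constructible
  ideals would fail independence, for instance a free monoid on two generators.\<close>

definition independence :: "('g, 'm) monoid_scheme \<Rightarrow> 'g set \<Rightarrow> bool" where
  "independence G P \<longleftrightarrow> (\<forall>\<alpha>\<in>words P. \<forall>F. finite F \<and> F \<noteq> {} \<and> F \<subseteq> words P \<and>
     constr_ideal G P \<alpha> = (\<Union>\<beta>\<in>F. constr_ideal G P \<beta>) \<longrightarrow>
     constr_ideal G P \<alpha> \<in> constr_ideal G P ` F)"


section \<open>The two semigroup \<open>C\<^sup>*\<close>-algebras\<close>

text \<open>Relators are the elements that are required to vanish; they are stated in an arbitrary
  star-algebra \<open>A\<close>.\<close>

definition li_relators ::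
  "('g, 'm) monoid_scheme \<Rightarrow> 'g set \<Rightarrow> ('a, 'n) star_algebra_scheme \<Rightarrow>
    ('g \<Rightarrow> 'a) \<Rightarrow> ('g set \<Rightarrow> 'a) \<Rightarrow> 'a set" where
  "li_relators G P A v e =
     {star\<^bsub>A\<^esub> (v p) \<otimes>\<^bsub>A\<^esub> v p \<ominus>\<^bsub>A\<^esub> \<one>\<^bsub>A\<^esub> | p. p \<in> P} \<union>
     {star\<^bsub>A\<^esub> (e S) \<ominus>\<^bsub>A\<^esub> e S | S. S \<in> constr_ideals G P \<union> {{}}} \<union>
     {e S \<otimes>\<^bsub>A\<^esub> e S \<ominus>\<^bsub>A\<^esub> e S | S. S \<in> constr_ideals G P \<union> {{}}} \<union>
     {v p \<otimes>\<^bsub>A\<^esub> v q \<ominus>\<^bsub>A\<^esub> v (p \<otimes>\<^bsub>G\<^esub> q) | p q. p \<in> P \<and> q \<in> P} \<union>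
     {e {}} \<union>
     {word_op A v \<alpha> \<ominus>\<^bsub>A\<^esub> e S | \<alpha> S.
        S \<in> constr_ideals G P \<and> \<alpha> \<in> neutral_words G P \<and> constr_ideal G P \<alpha> = S}"

text \<open>In the last line the product over \<open>F = set \<beta>s\<close> is imposed for every enumeration of \<open>F\<close>;
  the other relators make the factors commute.  \<open>F\<close> is nonempty, since the empty product
  would give \<open>\<one> = \<zero>\<close> whenever \<open>\<emptyset>\<close> is constructible.\<close>

definition toeplitz_relators ::
  "('g, 'm) monoid_scheme \<Rightarrow> 'g set \<Rightarrow> ('a, 'n) star_algebra_scheme \<Rightarrow> ('g \<Rightarrow> 'a) \<Rightarrow> 'a set" where
  "toeplitz_relators G P A t =
     {t \<one>\<^bsub>G\<^esub> \<ominus>\<^bsub>A\<^esub> \<one>\<^bsub>A\<^esub>} \<union>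
     {word_op A t \<alpha> | \<alpha>. \<alpha> \<in> neutral_words G P \<and> constr_ideal G P \<alpha> = {}} \<union>
     {word_op A t \<alpha> \<ominus>\<^bsub>A\<^esub> word_op A t \<beta> | \<alpha> \<beta>. \<alpha> \<in> neutral_words G P \<and>
        \<beta> \<in> neutral_words G P \<and> constr_ideal G P \<alpha> = constr_ideal G P \<beta>} \<union>
     {foldr (\<otimes>\<^bsub>A\<^esub>) (map (\<lambda>\<beta>. word_op A t \<alpha> \<ominus>\<^bsub>A\<^esub> word_op A t \<beta>) \<beta>s) \<one>\<^bsub>A\<^esub> | \<alpha> \<beta>s.
        \<alpha> \<in> neutral_words G P \<and> \<beta>s \<noteq> [] \<and> distinct \<beta>s \<and> set \<beta>s \<subseteq> neutral_words G P \<and>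
        constr_ideal G P \<alpha> = (\<Union>\<beta>\<in>set \<beta>s. constr_ideal G P \<beta>)}"

datatype 'g li_gen = Isom 'g | Proj "'g set"

definition li_gens :: "('g, 'm) monoid_scheme \<Rightarrow> 'g set \<Rightarrow> 'g li_gen set" where
  "li_gens G P = Isom ` P \<union> Proj ` (constr_ideals G P \<union> {{}})"

definition li_rels :: "('g, 'm) monoid_scheme \<Rightarrow> 'g set \<Rightarrow> 'g li_gen star_poly set" where
  "li_rels G P = li_relators G P (free_star_algebra (li_gens G P))
     (\<lambda>p. poly_gen (Isom p)) (\<lambda>S. poly_gen (Proj S))"

definition li_algebra ::
  "('g, 'm) monoid_scheme \<Rightarrow> 'g set \<Rightarrow> (nat \<Rightarrow> 'g li_gen star_poly) set cstar_algebra" where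
  "li_algebra G P = universal_cstar (li_gens G P) (li_rels G P)"

definition li_isom ::
  "('g, 'm) monoid_scheme \<Rightarrow> 'g set \<Rightarrow> 'g \<Rightarrow> (nat \<Rightarrow> 'g li_gen star_poly) set" where
  "li_isom G P p = universal_gen (li_gens G P) (li_rels G P) (Isom p)"

definition li_proj ::
  "('g, 'm) monoid_scheme \<Rightarrow> 'g set \<Rightarrow> 'g set \<Rightarrow> (nat \<Rightarrow> 'g li_gen star_poly) set" where
  "li_proj G P S = universal_gen (li_gens G P) (li_rels G P) (Proj S)"

definition toeplitz_rels :: "('g, 'm) monoid_scheme \<Rightarrow> 'g set \<Rightarrow> 'g star_poly set" where
  "toeplitz_rels G P = toeplitz_relators G P (free_star_algebra P) poly_gen"

definition toeplitz_algebra ::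
  "('g, 'm) monoid_scheme \<Rightarrow> 'g set \<Rightarrow> (nat \<Rightarrow> 'g star_poly) set cstar_algebra" where
  "toeplitz_algebra G P = universal_cstar P (toeplitz_rels G P)"

definition toeplitz_gen ::
  "('g, 'm) monoid_scheme \<Rightarrow> 'g set \<Rightarrow> 'g \<Rightarrow> (nat \<Rightarrow> 'g star_poly) set" where
  "toeplitz_gen G P p = universal_gen P (toeplitz_rels G P) p"


section \<open>Completions are \<open>C\<^sup>*\<close>-algebras\<close>

lemma null_sandwich:
  fixes f g :: "nat \<Rightarrow> real"
  assumes "g \<longlonglongrightarrow> 0" "\<And>n. 0 \<le> f n" "\<And>n. f n \<le> g n"
  shows "f \<longlonglongrightarrow> 0"
  by (rule tendsto_sandwich[of "\<lambda>_. 0" f sequentially g]) (use assms in simp_all)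

locale seminormed_star_algebra = unital_star_algebra A for A (structure) +
  fixes N :: "'a \<Rightarrow> real"
  assumes seminorm: "cstar_seminorm A N"
begin

lemma N_nonneg: "x \<in> carrier A \<Longrightarrow> 0 \<le> N x"
  and N_add: "x \<in> carrier A \<Longrightarrow> y \<in> carrier A \<Longrightarrow> N (x \<oplus> y) \<le> N x + N y"
  and N_smult: "x \<in> carrier A \<Longrightarrow> N (c \<odot> x) = cmod c * N x"
  and N_mult: "x \<in> carrier A \<Longrightarrow> y \<in> carrier A \<Longrightarrow> N (x \<otimes> y) \<le> N x * N y"
  and N_cstar: "x \<in> carrier A \<Longrightarrow> N (star x \<otimes> x) = (N x)\<^sup>2"
  using seminorm by (auto simp: cstar_seminorm_def)

lemma smult_zero_l: "x \<in> carrier A \<Longrightarrow> 0 \<odot> x = \<zero>"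
proof -
  assume x: "x \<in> carrier A"
  have "0 \<odot> x \<oplus> 0 \<odot> x = 0 \<odot> x \<oplus> \<zero>"
    using smult_l_distr[of x 0 0] x smult_closed by simp
  thus ?thesis using x smult_closed add.r_cancel_one[of "0 \<odot> x" "0 \<odot> x"] by simp
qed

lemma smult_minus_one: "x \<in> carrier A \<Longrightarrow> (-1) \<odot> x = \<ominus> x"
proof -
  assume x: "x \<in> carrier A"
  have "(-1) \<odot> x \<oplus> x = \<zero>"
    using smult_l_distr[of x "-1" 1] x smult_one[of x] smult_zero_l[of x] by simp
  thus ?thesis using x smult_closed by (metis minus_equality)
qed

lemma N_zero: "N \<zero> = 0"
  using N_smult[of \<zero> 0] smult_zero_l[of \<zero>] by simp

lemma N_minus: "x \<in> carrier A \<Longrightarrow> N (\<ominus> x) = N x"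
  using N_smult[of x "-1"] smult_minus_one[of x] by simp

lemma minus_minus_swap: "x \<in> carrier A \<Longrightarrow> y \<in> carrier A \<Longrightarrow> \<ominus> (x \<ominus> y) = y \<ominus> x"
  by (simp add: a_minus_def minus_add a_comm)

lemma N_sym: "x \<in> carrier A \<Longrightarrow> y \<in> carrier A \<Longrightarrow> N (x \<ominus> y) = N (y \<ominus> x)"
  using N_minus[of "x \<ominus> y"] minus_minus_swap[of x y] by simp

lemma diff_add_diff:
  "x \<in> carrier A \<Longrightarrow> y \<in> carrier A \<Longrightarrow> z \<in> carrier A \<Longrightarrow> x \<ominus> z = (x \<ominus> y) \<oplus> (y \<ominus> z)"
  unfolding a_minus_def by algebra

lemma N_tri: "x \<in> carrier A \<Longrightarrow> y \<in> carrier A \<Longrightarrow> z \<in> carrier A \<Longrightarrow>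
    N (x \<ominus> z) \<le> N (x \<ominus> y) + N (y \<ominus> z)"
  using N_add[of "x \<ominus> y" "y \<ominus> z"] diff_add_diff[of x y z] by simp

lemma N_diff_self: "x \<in> carrier A \<Longrightarrow> N (x \<ominus> x) = 0"
  using N_zero by (simp add: r_neg a_minus_def)

lemma N_abs_diff: "x \<in> carrier A \<Longrightarrow> y \<in> carrier A \<Longrightarrow> \<bar>N x - N y\<bar> \<le> N (x \<ominus> y)"
proof -
  assume xy: "x \<in> carrier A" "y \<in> carrier A"
  have "x = (x \<ominus> y) \<oplus> y" "y = (y \<ominus> x) \<oplus> x"
    using xy unfolding a_minus_def by algebra+
  hence "N x \<le> N (x \<ominus> y) + N y" "N y \<le> N (y \<ominus> x) + N x"
    using xy N_add[of "x \<ominus> y" y] N_add[of "y \<ominus> x" x] by auto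
  thus ?thesis using N_sym xy by fastforce
qed

lemma N_star: "x \<in> carrier A \<Longrightarrow> N (star x) = N x"
proof -
  have le: "N x \<le> N (star x)" if x: "x \<in> carrier A" for x
  proof (cases "N x = 0")
    case True
    thus ?thesis using x star_closed N_nonneg by simp
  next
    case False
    hence pos: "N x > 0" using x N_nonneg[of x] by simp
    have "N x * N x \<le> N (star x) * N x"
      using N_cstar[of x] N_mult[of "star x" x] x star_closed by (simp add: power2_eq_square)
    thus ?thesis using pos by simp
  qed
  assume x: "x \<in> carrier A"
  show ?thesis using le[of x] le[of "star x"] x star_closed star_star by simp
qed

lemma star_minus: "x \<in> carrier A \<Longrightarrow> star (\<ominus> x) = \<ominus> (star x)"
  using star_smult[of x "-1"] smult_minus_one star_closed by simp

lemma add_diff_add: "\<lbrakk>x \<in> carrier A; y \<in> carrier A; x' \<in> carrier A; y' \<in> carrier A\<rbrakk> \<Longrightarrow>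
    (x \<oplus> y) \<ominus> (x' \<oplus> y') = (x \<ominus> x') \<oplus> (y \<ominus> y')"
  unfolding a_minus_def by algebra

lemma mult_diff_mult: "\<lbrakk>x \<in> carrier A; y \<in> carrier A; x' \<in> carrier A; y' \<in> carrier A\<rbrakk> \<Longrightarrow>
    (x \<otimes> y) \<ominus> (x' \<otimes> y') = ((x \<ominus> x') \<otimes> y) \<oplus> (x' \<otimes> (y \<ominus> y'))"
  unfolding a_minus_def by algebra

lemma smult_diff: "\<lbrakk>x \<in> carrier A; y \<in> carrier A\<rbrakk> \<Longrightarrow> c \<odot> x \<ominus> c \<odot> y = c \<odot> (x \<ominus> y)"
  using smult_r_distr[of x "\<ominus> y" c] smult_minus_one[of y] smult_minus_one[of "c \<odot> y"]
    smult_assoc[of y c "-1"] smult_assoc[of y "-1" c] smult_closed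
  by (simp add: a_minus_def)

lemma star_diff: "\<lbrakk>x \<in> carrier A; y \<in> carrier A\<rbrakk> \<Longrightarrow> star x \<ominus> star y = star (x \<ominus> y)"
  using star_add[of x "\<ominus> y"] star_minus[of y] by (simp add: a_minus_def)

abbreviation "CS \<equiv> cauchy_seqs A N"
abbreviation "NR \<equiv> null_rel A N"
abbreviation "cls s \<equiv> NR `` {s}"
abbreviation "AC \<equiv> completion A N"

lemma CS_carrier: "s \<in> CS \<Longrightarrow> s n \<in> carrier A"
  by (auto simp: cauchy_seqs_def)

lemma CS_cauchy: "s \<in> CS \<Longrightarrow> e > 0 \<Longrightarrow> \<exists>M. \<forall>m\<ge>M. \<forall>n\<ge>M. N (s m \<ominus> s n) < e"
  by (auto simp: cauchy_seqs_def)

lemma CS_lipI: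
  assumes "s \<in> CS" "\<And>n. t n \<in> carrier A" "\<And>m n. N (t m \<ominus> t n) \<le> C * N (s m \<ominus> s n)"
  shows "t \<in> CS"
  unfolding cauchy_seqs_def
proof (intro CollectI conjI allI impI assms(2))
  fix e :: real assume e: "e > 0"
  define D where "D = \<bar>C\<bar> + 1"
  have D: "D > 0" "C \<le> D" by (auto simp: D_def)
  obtain M where M: "\<forall>m\<ge>M. \<forall>n\<ge>M. N (s m \<ominus> s n) < e / D"
    using CS_cauchy[OF assms(1), of "e / D"] e D by auto
  have "N (t m \<ominus> t n) < e" if "m \<ge> M" "n \<ge> M" for m n
  proof -
    have "N (t m \<ominus> t n) \<le> D * N (s m \<ominus> s n)"
      using assms(3)[of m n] D(2) N_nonneg[of "s m \<ominus> s n"] CS_carrier[OF assms(1)]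
      by (meson minus_closed mult_right_mono order_trans)
    also have "\<dots> < D * (e / D)" using M that D by (simp del: times_divide_eq_right)
    finally show ?thesis using D by simp
  qed
  thus "\<exists>M. \<forall>m\<ge>M. \<forall>n\<ge>M. N (t m \<ominus> t n) < e" by blast
qed

lemma CS_lip2I:
  assumes "s \<in> CS" "s' \<in> CS" "\<And>n. t n \<in> carrier A" "C \<ge> 0"
    "\<And>m n. N (t m \<ominus> t n) \<le> C * (N (s m \<ominus> s n) + N (s' m \<ominus> s' n))"
  shows "t \<in> CS"
  unfolding cauchy_seqs_def
proof (intro CollectI conjI allI impI assms(3))
  fix e :: real assume e: "e > 0"
  define D where "D = C + 1"
  have D: "D > 0" "C \<le> D" using assms(4) by (auto simp: D_def)
  obtain M where M: "\<forall>m\<ge>M. \<forall>n\<ge>M. N (s m \<ominus> s n) < e / (2 * D)"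
    using CS_cauchy[OF assms(1), of "e / (2 * D)"] e D by auto
  obtain M' where M': "\<forall>m\<ge>M'. \<forall>n\<ge>M'. N (s' m \<ominus> s' n) < e / (2 * D)"
    using CS_cauchy[OF assms(2), of "e / (2 * D)"] e D by auto
  have "N (t m \<ominus> t n) < e" if "m \<ge> max M M'" "n \<ge> max M M'" for m n
  proof -
    have nn: "0 \<le> N (s m \<ominus> s n) + N (s' m \<ominus> s' n)"
      using N_nonneg CS_carrier assms(1,2) by (simp add: add_nonneg_nonneg)
    have "N (t m \<ominus> t n) \<le> D * (N (s m \<ominus> s n) + N (s' m \<ominus> s' n))"
      using assms(5)[of m n] D(2) nn by (meson mult_right_mono order_trans)
    also have "\<dots> < D * (e / (2 * D) + e / (2 * D))"
      using M M' that D by (intro mult_strict_left_mono add_strict_mono) auto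
    finally show ?thesis using D by (simp add: field_simps)
  qed
  thus "\<exists>M. \<forall>m\<ge>M. \<forall>n\<ge>M. N (t m \<ominus> t n) < e" by blast
qed

lemma CS_norm_conv: "s \<in> CS \<Longrightarrow> convergent (\<lambda>n. N (s n))"
proof -
  assume s: "s \<in> CS"
  have "Cauchy (\<lambda>n. N (s n))"
  proof (rule metric_CauchyI)
    fix e :: real assume "e > 0"
    then obtain M where M: "\<forall>m\<ge>M. \<forall>n\<ge>M. N (s m \<ominus> s n) < e" using CS_cauchy[OF s] by blast
    show "\<exists>M. \<forall>m\<ge>M. \<forall>n\<ge>M. dist (N (s m)) (N (s n)) < e"
      using M N_abs_diff[OF CS_carrier[OF s] CS_carrier[OF s]]
      by (metis dist_real_def order_le_less_trans)
  qed
  thus ?thesis by (simp add: Cauchy_convergent_iff)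
qed

lemma CS_bounded: "s \<in> CS \<Longrightarrow> \<exists>C\<ge>0. \<forall>n. N (s n) \<le> C"
proof -
  assume s: "s \<in> CS"
  have "Bseq (\<lambda>n. N (s n))"
    using CS_norm_conv[OF s] by (simp add: convergent_imp_Bseq)
  then obtain K where "K > 0" "\<forall>n. norm (N (s n)) \<le> K" by (auto simp: Bseq_def)
  thus ?thesis by (intro exI[of _ K]) (auto intro: order_trans[OF abs_ge_self])
qed

lemma CS_const: "x \<in> carrier A \<Longrightarrow> (\<lambda>n. x) \<in> CS"
  by (auto simp: cauchy_seqs_def N_diff_self)

lemma CS_add: "s \<in> CS \<Longrightarrow> t \<in> CS \<Longrightarrow> (\<lambda>n. s n \<oplus> t n) \<in> CS"
proof (rule CS_lip2I[of s t _ 1])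
  fix m n assume st: "s \<in> CS" "t \<in> CS"
  note c = CS_carrier[OF st(1)] CS_carrier[OF st(2)]
  show "N (s m \<oplus> t m \<ominus> (s n \<oplus> t n)) \<le> 1 * (N (s m \<ominus> s n) + N (t m \<ominus> t n))"
    using c by (simp add: add_diff_add N_add)
qed (auto simp: CS_carrier)

lemma N_mult_diff_le:
  assumes "x \<in> carrier A" "y \<in> carrier A" "x' \<in> carrier A" "y' \<in> carrier A"
    "N y \<le> C" "N x' \<le> C"
  shows "N (x \<otimes> y \<ominus> x' \<otimes> y') \<le> C * (N (x \<ominus> x') + N (y \<ominus> y'))"
proof -
  have "N (x \<otimes> y \<ominus> x' \<otimes> y') \<le> N ((x \<ominus> x') \<otimes> y) + N (x' \<otimes> (y \<ominus> y'))"
    using assms by (simp add: mult_diff_mult N_add)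
  also have "\<dots> \<le> N (x \<ominus> x') * N y + N x' * N (y \<ominus> y')"
    using assms by (intro add_mono N_mult) auto
  also have "\<dots> \<le> N (x \<ominus> x') * C + C * N (y \<ominus> y')"
    using assms by (intro add_mono mult_left_mono mult_right_mono N_nonneg) auto
  finally show ?thesis by (simp add: algebra_simps)
qed

lemma CS_mult: "s \<in> CS \<Longrightarrow> t \<in> CS \<Longrightarrow> (\<lambda>n. s n \<otimes> t n) \<in> CS"
proof -
  assume st: "s \<in> CS" "t \<in> CS"
  note c = CS_carrier[OF st(1)] CS_carrier[OF st(2)]
  obtain C D where C: "C \<ge> 0" "\<forall>n. N (s n) \<le> C" and D: "\<forall>n. N (t n) \<le> D"
    using CS_bounded st by metis
  have b: "N (s n) \<le> max C D" "N (t n) \<le> max C D" for n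
    using C D by (auto simp: le_max_iff_disj)
  show ?thesis
    by (rule CS_lip2I[OF st, of _ "max C D"]) (use C b c in \<open>auto intro!: N_mult_diff_le\<close>)
qed

lemma CS_smult: "s \<in> CS \<Longrightarrow> (\<lambda>n. c \<odot> s n) \<in> CS"
  by (rule CS_lipI[of s _ "cmod c"]) (auto simp: CS_carrier smult_closed smult_diff N_smult)

lemma CS_star: "s \<in> CS \<Longrightarrow> (\<lambda>n. star (s n)) \<in> CS"
  by (rule CS_lipI[of s _ 1]) (auto simp: CS_carrier star_closed star_diff N_star)

lemma NR_equiv: "equiv CS NR"
proof (rule equivI)
  show "NR \<subseteq> CS \<times> CS" by (auto simp: null_rel_def)
  show "refl_on CS NR" by (auto simp: refl_on_def null_rel_def N_diff_self CS_carrier)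
  show "sym NR"
  proof (rule symI)
    fix s t assume "(s, t) \<in> NR"
    hence c: "s \<in> CS" "t \<in> CS" and l: "(\<lambda>n. N (s n \<ominus> t n)) \<longlonglongrightarrow> 0"
      by (auto simp: null_rel_def)
    have "(\<lambda>n. N (t n \<ominus> s n)) = (\<lambda>n. N (s n \<ominus> t n))"
      by (intro ext N_sym CS_carrier c)
    thus "(t, s) \<in> NR" using c l by (simp add: null_rel_def)
  qed
  show "trans NR"
  proof (rule transI)
    fix s t u assume st: "(s, t) \<in> NR" and tu: "(t, u) \<in> NR"
    hence c: "s \<in> CS" "t \<in> CS" "u \<in> CS" by (auto simp: null_rel_def)
    have "(\<lambda>n. N (s n \<ominus> t n) + N (t n \<ominus> u n)) \<longlonglongrightarrow> 0"
      by (rule tendsto_add_zero) (use st tu in \<open>auto simp: null_rel_def\<close>)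
    hence "(\<lambda>n. N (s n \<ominus> u n)) \<longlonglongrightarrow> 0"
      by (rule null_sandwich) (use c in \<open>simp_all add: CS_carrier N_nonneg N_tri\<close>)
    thus "(s, u) \<in> NR" using c by (auto simp: null_rel_def)
  qed
qed

lemma NR_lip2:
  assumes "(s, s') \<in> NR" "(t, t') \<in> NR" "f \<in> CS" "g \<in> CS"
    "\<And>n. N (f n \<ominus> g n) \<le> C * (N (s n \<ominus> s' n) + N (t n \<ominus> t' n))"
  shows "(f, g) \<in> NR"
proof -
  have "(\<lambda>n. N (s n \<ominus> s' n) + N (t n \<ominus> t' n)) \<longlonglongrightarrow> 0"
    by (rule tendsto_add_zero) (use assms(1,2) in \<open>auto simp: null_rel_def\<close>)
  hence "(\<lambda>n. C * (N (s n \<ominus> s' n) + N (t n \<ominus> t' n))) \<longlonglongrightarrow> 0"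
    by (rule tendsto_mult_right_zero)
  hence "(\<lambda>n. N (f n \<ominus> g n)) \<longlonglongrightarrow> 0"
    by (rule null_sandwich) (use assms in \<open>simp_all add: CS_carrier N_nonneg\<close>)
  thus ?thesis using assms by (simp add: null_rel_def)
qed

lemma NR_add: "(s, s') \<in> NR \<Longrightarrow> (t, t') \<in> NR \<Longrightarrow> (\<lambda>n. s n \<oplus> t n, \<lambda>n. s' n \<oplus> t' n) \<in> NR"
proof -
  assume st: "(s, s') \<in> NR" "(t, t') \<in> NR"
  hence c: "s \<in> CS" "s' \<in> CS" "t \<in> CS" "t' \<in> CS" by (auto simp: null_rel_def)
  show ?thesis
    by (rule NR_lip2[OF st, of _ _ 1]) (use c in \<open>auto simp: CS_add CS_carrier add_diff_add N_add\<close>)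
qed

lemma NR_mult: "(s, s') \<in> NR \<Longrightarrow> (t, t') \<in> NR \<Longrightarrow> (\<lambda>n. s n \<otimes> t n, \<lambda>n. s' n \<otimes> t' n) \<in> NR"
proof -
  assume st: "(s, s') \<in> NR" "(t, t') \<in> NR"
  hence c: "s \<in> CS" "s' \<in> CS" "t \<in> CS" "t' \<in> CS" by (auto simp: null_rel_def)
  obtain C D where C: "\<forall>n. N (s' n) \<le> C" and D: "\<forall>n. N (t n) \<le> D"
    using CS_bounded c by metis
  have b: "N (s' n) \<le> max C D" "N (t n) \<le> max C D" for n
    using C D by (auto simp: le_max_iff_disj)
  show ?thesis
    by (rule NR_lip2[OF st, of _ _ "max C D"])
      (use c b in \<open>auto simp: CS_mult CS_carrier intro!: N_mult_diff_le\<close>)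
qed

lemma NR_lip:
  assumes "(s, s') \<in> NR" "f \<in> CS" "g \<in> CS" "\<And>n. N (f n \<ominus> g n) = C * N (s n \<ominus> s' n)"
  shows "(f, g) \<in> NR"
proof -
  have "(\<lambda>n. C * N (s n \<ominus> s' n)) \<longlonglongrightarrow> C * 0"
    using assms(1) by (intro tendsto_intros) (auto simp: null_rel_def)
  thus ?thesis using assms by (simp add: null_rel_def)
qed

lemma NR_smult: "(s, s') \<in> NR \<Longrightarrow> (\<lambda>n. c \<odot> s n, \<lambda>n. c \<odot> s' n) \<in> NR"
proof -
  assume st: "(s, s') \<in> NR"
  hence c: "s \<in> CS" "s' \<in> CS" by (auto simp: null_rel_def)
  show ?thesis
    by (rule NR_lip[OF st, of _ _ "cmod c"]) (use c in \<open>simp_all add: CS_smult CS_carrier smult_diff N_smult\<close>)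
qed

lemma NR_star: "(s, s') \<in> NR \<Longrightarrow> (\<lambda>n. star (s n), \<lambda>n. star (s' n)) \<in> NR"
proof -
  assume st: "(s, s') \<in> NR"
  hence c: "s \<in> CS" "s' \<in> CS" by (auto simp: null_rel_def)
  show ?thesis
    by (rule NR_lip[OF st, of _ _ 1]) (use c in \<open>simp_all add: CS_star CS_carrier star_diff N_star\<close>)
qed

lemma cls_eq_iff: "s \<in> CS \<Longrightarrow> t \<in> CS \<Longrightarrow> cls s = cls t \<longleftrightarrow> (s, t) \<in> NR"
  by (rule eq_equiv_class_iff[OF NR_equiv])

lemma carrier_AC: "carrier AC = CS // NR"
  by (simp add: completion_def)

lemma cls_carrier: "s \<in> CS \<Longrightarrow> cls s \<in> carrier AC"
  by (simp add: carrier_AC quotientI)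

lemma AC_cases: assumes "a \<in> carrier AC" obtains s where "s \<in> CS" "a = cls s"
  using assms by (auto simp: carrier_AC elim: quotientE)

lemma UN_cls2:
  assumes "s \<in> CS" "t \<in> CS"
    "\<And>s s' t t'. (s, s') \<in> NR \<Longrightarrow> (t, t') \<in> NR \<Longrightarrow> (f s t, f s' t') \<in> NR"
  shows "(\<Union>s\<in>cls s. \<Union>t\<in>cls t. cls (f s t)) = cls (f s t)"
proof (rule UN_equiv_class2[OF NR_equiv NR_equiv _ assms(1,2)])
  show "congruent2 NR NR (\<lambda>s t. cls (f s t))"
    unfolding congruent2_def using equiv_class_eq[OF NR_equiv assms(3)] by fast
qed

lemma UN_cls:
  assumes "s \<in> CS" "\<And>s s'. (s, s') \<in> NR \<Longrightarrow> (f s, f s') \<in> NR"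
  shows "(\<Union>s\<in>cls s. cls (f s)) = cls (f s)"
proof (rule UN_equiv_class[OF NR_equiv _ assms(1)])
  show "(\<lambda>s. cls (f s)) respects NR"
    unfolding congruent_def using equiv_class_eq[OF NR_equiv assms(2)] by fast
qed

lemma AC_mult: "s \<in> CS \<Longrightarrow> t \<in> CS \<Longrightarrow> cls s \<otimes>\<^bsub>AC\<^esub> cls t = cls (\<lambda>n. s n \<otimes> t n)"
  using UN_cls2[of s t "\<lambda>s t n. s n \<otimes> t n"] NR_mult by (simp add: completion_def)

lemma AC_add: "s \<in> CS \<Longrightarrow> t \<in> CS \<Longrightarrow> cls s \<oplus>\<^bsub>AC\<^esub> cls t = cls (\<lambda>n. s n \<oplus> t n)"
  using UN_cls2[of s t "\<lambda>s t n. s n \<oplus> t n"] NR_add by (simp add: completion_def)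

lemma AC_smult: "s \<in> CS \<Longrightarrow> c \<odot>\<^bsub>AC\<^esub> cls s = cls (\<lambda>n. c \<odot> s n)"
  using UN_cls[of s "\<lambda>s n. c \<odot> s n"] NR_smult by (simp add: completion_def)

lemma AC_star: "s \<in> CS \<Longrightarrow> star\<^bsub>AC\<^esub> (cls s) = cls (\<lambda>n. star (s n))"
  using UN_cls[of s "\<lambda>s n. star (s n)"] NR_star by (simp add: completion_def)

lemma AC_one: "\<one>\<^bsub>AC\<^esub> = cls (\<lambda>n. \<one>)" and AC_zero: "\<zero>\<^bsub>AC\<^esub> = cls (\<lambda>n. \<zero>)"
  by (simp_all add: completion_def)

lemma AC_norm: assumes s: "s \<in> CS" shows "(\<lambda>n. N (s n)) \<longlonglongrightarrow> cnorm AC (cls s)"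
proof -
  obtain r where r: "(\<lambda>n. N (s n)) \<longlonglongrightarrow> r" using CS_norm_conv[OF s] by (auto simp: convergent_def)
  have "(\<lambda>n. N (t n)) \<longlonglongrightarrow> r" if "t \<in> cls s" for t
  proof -
    have st: "(s, t) \<in> NR" using that by simp
    hence c: "s \<in> CS" "t \<in> CS" and l: "(\<lambda>n. N (s n \<ominus> t n)) \<longlonglongrightarrow> 0" by (auto simp: null_rel_def)
    have "(\<lambda>n. N (t n) - N (s n)) \<longlonglongrightarrow> 0"
      by (rule tendsto_rabs_zero_cancel, rule null_sandwich[OF l])
        (use c N_abs_diff[OF CS_carrier[of s] CS_carrier[of t]] in \<open>simp_all add: abs_minus_commute\<close>)
    from tendsto_add[OF this r] show ?thesis by simp
  qed
  hence "\<forall>t\<in>cls s. (\<lambda>n. N (t n)) \<longlonglongrightarrow> r" by blast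
  moreover have "s \<in> cls s" using equiv_class_self[OF NR_equiv s] .
  ultimately have "cnorm AC (cls s) = r"
    unfolding completion_def
    by (simp only: cstar_algebra.select_convs, intro the_equality) (auto intro: LIMSEQ_unique)
  thus ?thesis using r by simp
qed

lemma AC_ring: "ring AC"
proof (rule ringI)
  show "abelian_group AC"
  proof (rule abelian_groupI)
    fix a b assume "a \<in> carrier AC" "b \<in> carrier AC"
    then obtain s t where "s \<in> CS" "t \<in> CS" "a = cls s" "b = cls t" by (meson AC_cases)
    thus "a \<oplus>\<^bsub>AC\<^esub> b \<in> carrier AC" "a \<oplus>\<^bsub>AC\<^esub> b = b \<oplus>\<^bsub>AC\<^esub> a"
      by (simp_all add: AC_add cls_carrier CS_add CS_carrier a_comm)
  next
    show "\<zero>\<^bsub>AC\<^esub> \<in> carrier AC" by (simp add: AC_zero cls_carrier CS_const)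
  next
    fix a b c assume "a \<in> carrier AC" "b \<in> carrier AC" "c \<in> carrier AC"
    then obtain s t u where "s \<in> CS" "t \<in> CS" "u \<in> CS" "a = cls s" "b = cls t" "c = cls u"
      by (meson AC_cases)
    thus "a \<oplus>\<^bsub>AC\<^esub> b \<oplus>\<^bsub>AC\<^esub> c = a \<oplus>\<^bsub>AC\<^esub> (b \<oplus>\<^bsub>AC\<^esub> c)"
      by (simp add: AC_add CS_add CS_carrier a_assoc)
  next
    fix a assume "a \<in> carrier AC"
    then obtain s where s: "s \<in> CS" "a = cls s" by (meson AC_cases)
    thus "\<zero>\<^bsub>AC\<^esub> \<oplus>\<^bsub>AC\<^esub> a = a"
      by (simp add: AC_zero AC_add CS_const CS_carrier)
    have "cls (\<lambda>n. (-1) \<odot> s n) \<oplus>\<^bsub>AC\<^esub> a = \<zero>\<^bsub>AC\<^esub>"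
      using AC_add[OF CS_smult[OF s(1), of "-1"] s(1)] s
      by (simp add: AC_zero CS_carrier smult_minus_one l_neg)
    thus "\<exists>y\<in>carrier AC. y \<oplus>\<^bsub>AC\<^esub> a = \<zero>\<^bsub>AC\<^esub>" by (rule bexI) (use s in \<open>simp add: cls_carrier CS_smult\<close>)
  qed
  show "Group.monoid AC"
  proof (rule Group.monoidI)
    fix a b assume "a \<in> carrier AC" "b \<in> carrier AC"
    then obtain s t where "s \<in> CS" "t \<in> CS" "a = cls s" "b = cls t" by (meson AC_cases)
    thus "a \<otimes>\<^bsub>AC\<^esub> b \<in> carrier AC" by (simp add: AC_mult cls_carrier CS_mult)
  next
    show "\<one>\<^bsub>AC\<^esub> \<in> carrier AC" by (simp add: AC_one cls_carrier CS_const)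
  next
    fix a b c assume "a \<in> carrier AC" "b \<in> carrier AC" "c \<in> carrier AC"
    then obtain s t u where "s \<in> CS" "t \<in> CS" "u \<in> CS" "a = cls s" "b = cls t" "c = cls u"
      by (meson AC_cases)
    thus "a \<otimes>\<^bsub>AC\<^esub> b \<otimes>\<^bsub>AC\<^esub> c = a \<otimes>\<^bsub>AC\<^esub> (b \<otimes>\<^bsub>AC\<^esub> c)"
      by (simp add: AC_mult CS_mult CS_carrier m_assoc)
  next
    fix a assume "a \<in> carrier AC"
    then obtain s where s: "s \<in> CS" "a = cls s" by (meson AC_cases)
    thus "\<one>\<^bsub>AC\<^esub> \<otimes>\<^bsub>AC\<^esub> a = a" "a \<otimes>\<^bsub>AC\<^esub> \<one>\<^bsub>AC\<^esub> = a"
      by (simp_all add: AC_one AC_mult CS_const CS_carrier)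
  qed
next
  fix a b c assume "a \<in> carrier AC" "b \<in> carrier AC" "c \<in> carrier AC"
  then obtain s t u where "s \<in> CS" "t \<in> CS" "u \<in> CS" "a = cls s" "b = cls t" "c = cls u"
    by (meson AC_cases)
  thus "(a \<oplus>\<^bsub>AC\<^esub> b) \<otimes>\<^bsub>AC\<^esub> c = a \<otimes>\<^bsub>AC\<^esub> c \<oplus>\<^bsub>AC\<^esub> b \<otimes>\<^bsub>AC\<^esub> c"
    "c \<otimes>\<^bsub>AC\<^esub> (a \<oplus>\<^bsub>AC\<^esub> b) = c \<otimes>\<^bsub>AC\<^esub> a \<oplus>\<^bsub>AC\<^esub> c \<otimes>\<^bsub>AC\<^esub> b"
    by (simp_all add: AC_mult AC_add CS_mult CS_add CS_carrier l_distr r_distr)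
qed

lemma AC_star_algebra: "unital_star_algebra AC"
proof (intro unital_star_algebra.intro AC_ring unital_star_algebra_axioms.intro)
  fix a assume "a \<in> carrier AC"
  then obtain s where s: "s \<in> CS" "a = cls s" by (meson AC_cases)
  fix b assume "b \<in> carrier AC"
  then obtain t where t: "t \<in> CS" "b = cls t" by (meson AC_cases)
  fix c :: complex
  note cc = CS_mult CS_add CS_smult CS_star CS_carrier AC_mult AC_add AC_smult AC_star
  show "c \<odot>\<^bsub>AC\<^esub> (a \<oplus>\<^bsub>AC\<^esub> b) = c \<odot>\<^bsub>AC\<^esub> a \<oplus>\<^bsub>AC\<^esub> c \<odot>\<^bsub>AC\<^esub> b"
    using s t by (simp add: cc smult_r_distr)
  show "(c \<odot>\<^bsub>AC\<^esub> a) \<otimes>\<^bsub>AC\<^esub> b = c \<odot>\<^bsub>AC\<^esub> (a \<otimes>\<^bsub>AC\<^esub> b)"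
    using s t by (simp add: cc smult_mult_l)
  show "a \<otimes>\<^bsub>AC\<^esub> (c \<odot>\<^bsub>AC\<^esub> b) = c \<odot>\<^bsub>AC\<^esub> (a \<otimes>\<^bsub>AC\<^esub> b)"
    using s t by (simp add: cc smult_mult_r)
  show "star\<^bsub>AC\<^esub> (a \<oplus>\<^bsub>AC\<^esub> b) = star\<^bsub>AC\<^esub> a \<oplus>\<^bsub>AC\<^esub> star\<^bsub>AC\<^esub> b"
    using s t by (simp add: cc star_add)
  show "star\<^bsub>AC\<^esub> (a \<otimes>\<^bsub>AC\<^esub> b) = star\<^bsub>AC\<^esub> b \<otimes>\<^bsub>AC\<^esub> star\<^bsub>AC\<^esub> a"
    using s t by (simp add: cc star_mult)
next
  fix a assume "a \<in> carrier AC"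
  then obtain s where s: "s \<in> CS" "a = cls s" by (meson AC_cases)
  fix c d :: complex
  note cc = CS_mult CS_add CS_smult CS_star CS_carrier AC_mult AC_add AC_smult AC_star
  show "c \<odot>\<^bsub>AC\<^esub> a \<in> carrier AC" using s by (simp add: cc cls_carrier)
  show "(c + d) \<odot>\<^bsub>AC\<^esub> a = c \<odot>\<^bsub>AC\<^esub> a \<oplus>\<^bsub>AC\<^esub> d \<odot>\<^bsub>AC\<^esub> a"
    using s by (simp add: cc smult_l_distr)
  show "(c * d) \<odot>\<^bsub>AC\<^esub> a = c \<odot>\<^bsub>AC\<^esub> (d \<odot>\<^bsub>AC\<^esub> a)" using s by (simp add: cc smult_assoc)
  show "1 \<odot>\<^bsub>AC\<^esub> a = a" using s by (simp add: cc smult_one)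
  show "star\<^bsub>AC\<^esub> a \<in> carrier AC" using s by (simp add: cc cls_carrier)
  show "star\<^bsub>AC\<^esub> (star\<^bsub>AC\<^esub> a) = a" using s by (simp add: cc star_star)
  show "star\<^bsub>AC\<^esub> (c \<odot>\<^bsub>AC\<^esub> a) = cnj c \<odot>\<^bsub>AC\<^esub> star\<^bsub>AC\<^esub> a" using s by (simp add: cc star_smult)
qed

lemma AC_uminus: "s \<in> CS \<Longrightarrow> \<ominus>\<^bsub>AC\<^esub> cls s = cls (\<lambda>n. \<ominus> s n)"
proof -
  assume s: "s \<in> CS"
  interpret AC: ring AC by (rule AC_ring)
  have e: "(\<lambda>n. \<ominus> s n) = (\<lambda>n. (-1) \<odot> s n)" using s by (simp add: CS_carrier smult_minus_one)
  have "cls (\<lambda>n. (-1) \<odot> s n) \<oplus>\<^bsub>AC\<^esub> cls s = \<zero>\<^bsub>AC\<^esub>"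
    using AC_add[OF CS_smult[OF s, of "-1"] s] s
      by (simp add: AC_zero CS_carrier smult_minus_one l_neg)
  thus ?thesis using s unfolding e
    by (intro AC.minus_equality) (auto simp: cls_carrier CS_smult)
qed

lemma CS_uminus: "s \<in> CS \<Longrightarrow> (\<lambda>n. \<ominus> s n) \<in> CS"
  using CS_smult[of s "-1"] by (simp add: CS_carrier smult_minus_one)

lemma CS_minus: "s \<in> CS \<Longrightarrow> t \<in> CS \<Longrightarrow> (\<lambda>n. s n \<ominus> t n) \<in> CS"
  using CS_add[OF _ CS_uminus] by (simp add: a_minus_def)

lemma AC_minus: "s \<in> CS \<Longrightarrow> t \<in> CS \<Longrightarrow> cls s \<ominus>\<^bsub>AC\<^esub> cls t = cls (\<lambda>n. s n \<ominus> t n)"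
  by (simp add: a_minus_def AC_uminus AC_add CS_uminus)

lemma AC_seminorm: "cstar_seminorm AC (cnorm AC)"
  unfolding cstar_seminorm_def
proof (intro conjI ballI allI)
  fix a assume "a \<in> carrier AC"
  then obtain s where s: "s \<in> CS" "a = cls s" by (meson AC_cases)
  note ls = AC_norm[OF s(1)]
  show "0 \<le> cnorm AC a" unfolding s(2)
    by (rule LIMSEQ_le_const[OF ls]) (use s in \<open>auto simp: CS_carrier N_nonneg\<close>)
  fix c
  have "(\<lambda>n. cmod c * N (s n)) \<longlonglongrightarrow> cmod c * cnorm AC a"
    unfolding s(2) by (intro tendsto_intros ls)
  moreover have "(\<lambda>n. cmod c * N (s n)) \<longlonglongrightarrow> cnorm AC (c \<odot>\<^bsub>AC\<^esub> a)"
    using AC_norm[OF CS_smult[OF s(1)], of c] s by (simp add: AC_smult CS_carrier N_smult)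
  ultimately show "cnorm AC (c \<odot>\<^bsub>AC\<^esub> a) = cmod c * cnorm AC a" by (metis LIMSEQ_unique)
next
  fix a assume "a \<in> carrier AC"
  then obtain s where s: "s \<in> CS" "a = cls s" by (meson AC_cases)
  note ls = AC_norm[OF s(1)]
  have "(\<lambda>n. (N (s n))\<^sup>2) \<longlonglongrightarrow> (cnorm AC a)\<^sup>2"
    unfolding s(2) by (intro tendsto_intros ls)
  moreover have "(\<lambda>n. (N (s n))\<^sup>2) \<longlonglongrightarrow> cnorm AC (star\<^bsub>AC\<^esub> a \<otimes>\<^bsub>AC\<^esub> a)"
    using AC_norm[OF CS_mult[OF CS_star[OF s(1)] s(1)]] s
    by (simp add: AC_mult AC_star CS_star CS_carrier N_cstar)
  ultimately show "cnorm AC (star\<^bsub>AC\<^esub> a \<otimes>\<^bsub>AC\<^esub> a) = (cnorm AC a)\<^sup>2" by (metis LIMSEQ_unique)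
next
  fix a b assume "a \<in> carrier AC" "b \<in> carrier AC"
  then obtain s t where s: "s \<in> CS" "a = cls s" and t: "t \<in> CS" "b = cls t" by (meson AC_cases)
  note l = AC_norm[OF s(1)] AC_norm[OF t(1)]
  show "cnorm AC (a \<oplus>\<^bsub>AC\<^esub> b) \<le> cnorm AC a + cnorm AC b"
    unfolding s(2) t(2) AC_add[OF s(1) t(1)]
    by (rule LIMSEQ_le[OF AC_norm[OF CS_add[OF s(1) t(1)]] tendsto_add[OF l]])
      (use s t in \<open>auto simp: CS_carrier N_add\<close>)
  show "cnorm AC (a \<otimes>\<^bsub>AC\<^esub> b) \<le> cnorm AC a * cnorm AC b"
    unfolding s(2) t(2) AC_mult[OF s(1) t(1)]
    by (rule LIMSEQ_le[OF AC_norm[OF CS_mult[OF s(1) t(1)]] tendsto_mult[OF l]])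
      (use s t in \<open>auto simp: CS_carrier N_mult\<close>)
qed

lemma AC_definite: "a \<in> carrier AC \<Longrightarrow> cnorm AC a = 0 \<Longrightarrow> a = \<zero>\<^bsub>AC\<^esub>"
proof -
  assume "a \<in> carrier AC" and z: "cnorm AC a = 0"
  then obtain s where s: "s \<in> CS" "a = cls s" by (meson AC_cases)
  have "(s, \<lambda>n. \<zero>) \<in> NR"
    using AC_norm[OF s(1)] z s by (auto simp: null_rel_def CS_const CS_carrier a_minus_def)
  thus ?thesis using s by (simp add: AC_zero cls_eq_iff CS_const)
qed

lemma AC_approx:
  assumes s: "s \<in> CS" and e: "e > 0"
  shows "\<exists>m. cnorm AC (cls s \<ominus>\<^bsub>AC\<^esub> cls (\<lambda>n. s m)) \<le> e"
proof -
  obtain M where M: "\<forall>m\<ge>M. \<forall>n\<ge>M. N (s m \<ominus> s n) < e" using CS_cauchy[OF s e] by blast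
  have c: "(\<lambda>n. s M) \<in> CS" using s by (simp add: CS_const CS_carrier)
  have "(\<lambda>n. N (s n \<ominus> s M)) \<longlonglongrightarrow> cnorm AC (cls s \<ominus>\<^bsub>AC\<^esub> cls (\<lambda>n. s M))"
    using AC_norm[OF CS_minus[OF s c]] s c by (simp add: AC_minus)
  from LIMSEQ_le_const2[OF this, of e] M have "cnorm AC (cls s \<ominus>\<^bsub>AC\<^esub> cls (\<lambda>n. s M)) \<le> e"
    by (meson less_imp_le order_refl)
  thus ?thesis by blast
qed

end

sublocale unital_cstar_algebra \<subseteq> NS: seminormed_star_algebra A "cnorm A"
  by unfold_locales (rule norm_seminorm)

context seminormed_star_algebra begin

lemma AC_const_diff: "x \<in> carrier A \<Longrightarrow> y \<in> carrier A \<Longrightarrow>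
    cnorm AC (cls (\<lambda>n. x) \<ominus>\<^bsub>AC\<^esub> cls (\<lambda>n. y)) = N (x \<ominus> y)"
proof -
  assume xy: "x \<in> carrier A" "y \<in> carrier A"
  have "(\<lambda>n. N (x \<ominus> y)) \<longlonglongrightarrow> cnorm AC (cls (\<lambda>n. x) \<ominus>\<^bsub>AC\<^esub> cls (\<lambda>n. y))"
    using AC_norm[of "\<lambda>n. x \<ominus> y"] xy by (simp add: AC_minus CS_const)
  thus ?thesis using LIMSEQ_unique tendsto_const by blast
qed

lemma AC_cstar: "unital_cstar_algebra AC"
proof (intro unital_cstar_algebra.intro AC_star_algebra unital_cstar_algebra_axioms.intro
    AC_seminorm AC_definite)
  interpret AC: unital_star_algebra AC by (rule AC_star_algebra)
  interpret AC: seminormed_star_algebra AC "cnorm AC"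
    by unfold_locales (rule AC_seminorm)
  fix a :: "nat \<Rightarrow> (nat \<Rightarrow> 'a) set" assume a: "\<And>n. a n \<in> carrier AC"
    and ca: "\<And>e. e > 0 \<Longrightarrow> \<exists>M. \<forall>m\<ge>M. \<forall>n\<ge>M. cnorm AC (a m \<ominus>\<^bsub>AC\<^esub> a n) < e"
  have "\<exists>y\<in>carrier A. cnorm AC (a n \<ominus>\<^bsub>AC\<^esub> cls (\<lambda>k. y)) \<le> 1 / real (Suc n)" for n
  proof -
    obtain s where s: "s \<in> CS" "a n = cls s" using a by (meson AC_cases)
    show ?thesis using AC_approx[OF s(1), of "1 / real (Suc n)"] s by (auto simp: CS_carrier)
  qed
  then obtain y where y: "\<And>n. y n \<in> carrier A"
    and yd: "\<And>n. cnorm AC (a n \<ominus>\<^bsub>AC\<^esub> cls (\<lambda>k. y n)) \<le> 1 / real (Suc n)" by metis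
  have yc: "cls (\<lambda>k. y n) \<in> carrier AC" for n using y by (simp add: cls_carrier CS_const)
  have lim0: "(\<lambda>n. 1 / real (Suc n)) \<longlonglongrightarrow> 0"
    using LIMSEQ_inverse_real_of_nat by (simp add: inverse_eq_divide)
  have yCS: "y \<in> CS"
    unfolding cauchy_seqs_def
  proof (intro CollectI conjI allI impI y)
    fix e :: real assume e: "e > 0"
    obtain M where M: "\<forall>m\<ge>M. \<forall>n\<ge>M. cnorm AC (a m \<ominus>\<^bsub>AC\<^esub> a n) < e/3" using ca[of "e/3"] e by auto
    have "\<forall>\<^sub>F n in sequentially. 1 / real (Suc n) < e/3"
      using order_tendstoD(2)[OF lim0, of "e/3"] e by simp
    then obtain K where K: "\<forall>n\<ge>K. 1 / real (Suc n) < e/3" by (auto simp: eventually_sequentially)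
    have "N (y m \<ominus> y n) < e" if "m \<ge> max M K" "n \<ge> max M K" for m n
    proof -
      let ?y = "\<lambda>n. cls (\<lambda>k. y n)"
      have "N (y m \<ominus> y n) = cnorm AC (?y m \<ominus>\<^bsub>AC\<^esub> ?y n)" using y by (simp add: AC_const_diff)
      also have "\<dots> \<le> cnorm AC (?y m \<ominus>\<^bsub>AC\<^esub> a m) + cnorm AC (a m \<ominus>\<^bsub>AC\<^esub> ?y n)"
        by (rule AC.N_tri[OF yc a yc])
      also have "\<dots> \<le> cnorm AC (?y m \<ominus>\<^bsub>AC\<^esub> a m) + (cnorm AC (a m \<ominus>\<^bsub>AC\<^esub> a n) + cnorm AC (a n \<ominus>\<^bsub>AC\<^esub> ?y n))"
        by (intro add_left_mono AC.N_tri[OF a a yc])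
      also have "\<dots> = cnorm AC (a m \<ominus>\<^bsub>AC\<^esub> ?y m) + cnorm AC (a m \<ominus>\<^bsub>AC\<^esub> a n) + cnorm AC (a n \<ominus>\<^bsub>AC\<^esub> ?y n)"
        using AC.N_sym[OF yc a] by simp
      also have "\<dots> < e/3 + e/3 + e/3"
        using M K that by (intro add_strict_mono order_le_less_trans[OF yd]) auto
      finally show ?thesis by simp
    qed
    thus "\<exists>M. \<forall>m\<ge>M. \<forall>n\<ge>M. N (y m \<ominus> y n) < e" by blast
  qed
  have d: "(\<lambda>m. cnorm AC (cls (\<lambda>k. y m) \<ominus>\<^bsub>AC\<^esub> cls y)) \<longlonglongrightarrow> 0"
  proof (rule LIMSEQ_I)
    fix r :: real assume "r > 0"
    hence r: "r/2 > 0" by simp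
    obtain M where M: "\<forall>m\<ge>M. \<forall>n\<ge>M. N (y m \<ominus> y n) < r/2" using CS_cauchy[OF yCS r] by blast
    have le: "cnorm AC (cls (\<lambda>k. y m) \<ominus>\<^bsub>AC\<^esub> cls y) \<le> r/2" if "m \<ge> M" for m
    proof -
      have "(\<lambda>n. N (y m \<ominus> y n)) \<longlonglongrightarrow> cnorm AC (cls (\<lambda>k. y m) \<ominus>\<^bsub>AC\<^esub> cls y)"
        using AC_norm[OF CS_minus[OF CS_const[OF y] yCS], of m] yCS y by (simp add: AC_minus CS_const)
      thus ?thesis using M that by (meson LIMSEQ_le_const2 less_imp_le)
    qed
    have ge: "0 \<le> cnorm AC (cls (\<lambda>k. y m) \<ominus>\<^bsub>AC\<^esub> cls y)" for m
      by (intro AC.N_nonneg AC.minus_closed yc cls_carrier yCS)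
    have "norm (cnorm AC (cls (\<lambda>k. y m) \<ominus>\<^bsub>AC\<^esub> cls y) - 0) < r" if "m \<ge> M" for m
      using le[OF that] ge[of m] \<open>r > 0\<close> by simp
    thus "\<exists>no. \<forall>n\<ge>no. norm (cnorm AC (cls (\<lambda>k. y n) \<ominus>\<^bsub>AC\<^esub> cls y) - 0) < r"
      by blast
  qed
  have "(\<lambda>n. cnorm AC (a n \<ominus>\<^bsub>AC\<^esub> cls y)) \<longlonglongrightarrow> 0"
  proof (rule tendsto_sandwich[OF _ _ tendsto_const])
    show "(\<lambda>n. 1 / real (Suc n) + cnorm AC (cls (\<lambda>k. y n) \<ominus>\<^bsub>AC\<^esub> cls y)) \<longlonglongrightarrow> 0"
      using tendsto_add[OF lim0 d] by simp
    show "\<forall>\<^sub>F n in sequentially. 0 \<le> cnorm AC (a n \<ominus>\<^bsub>AC\<^esub> cls y)"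
      by (intro always_eventually allI AC.N_nonneg AC.minus_closed a cls_carrier yCS)
    show "\<forall>\<^sub>F n in sequentially. cnorm AC (a n \<ominus>\<^bsub>AC\<^esub> cls y)
        \<le> 1 / real (Suc n) + cnorm AC (cls (\<lambda>k. y n) \<ominus>\<^bsub>AC\<^esub> cls y)"
      using AC.N_tri[OF a yc cls_carrier[OF yCS]] yd
      by (intro always_eventually allI) (meson add_right_mono order_trans)
  qed
  thus "\<exists>x\<in>carrier AC. (\<lambda>n. cnorm AC (a n \<ominus>\<^bsub>AC\<^esub> x)) \<longlonglongrightarrow> 0"
    using cls_carrier[OF yCS] by blast
qed

end


section \<open>The free star-algebra and the universal seminorm\<close>

lemma monomial_simps [simp]:
  "letters (0 :: 'x monomial) = []" "letters (u + w) = letters u @ letters w"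
  by (simp_all add: zero_monomial_def plus_monomial_def)

lemma letter_adj_adj [simp]: "letter_adj (letter_adj l) = l"
  by (cases l) auto

lemma letter_base_adj [simp]: "letter_base (letter_adj l) = letter_base l"
  by (cases l) auto

lemma monomial_adj_adj [simp]: "monomial_adj (monomial_adj w) = w"
  by (simp add: monomial_adj_def rev_map o_def)

lemma monomial_adj_add: "monomial_adj (u + w) = monomial_adj w + monomial_adj u"
  by (simp add: monomial_adj_def plus_monomial_def)

lemma inj_monomial_adj: "inj monomial_adj"
  by (metis injI monomial_adj_adj)

lemma lookup_star_poly_adj:
  "Poly_Mapping.lookup (star_poly_adj f) w = cnj (Poly_Mapping.lookup f (monomial_adj w))"
  by (simp add: star_poly_adj_def map_key.rep_eq[OF inj_monomial_adj] map.rep_eq when_def)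

lemma star_poly_adj_add: "star_poly_adj (f + g) = star_poly_adj f + star_poly_adj g"
  by (rule poly_mapping_eqI) (simp add: lookup_star_poly_adj lookup_add)

lemma star_poly_adj_single:
  "star_poly_adj (Poly_Mapping.single w c) = Poly_Mapping.single (monomial_adj w) (cnj c)"
  using map_key_single[OF inj_monomial_adj, of "monomial_adj w" "cnj c"]
  by (simp add: star_poly_adj_def)

lemma star_poly_adj_zero [simp]: "star_poly_adj 0 = 0"
  using star_poly_adj_add[of 0 0] by simp

lemma star_poly_induct [case_names single add]:
  assumes s: "\<And>w c. P (Poly_Mapping.single w c)" and a: "\<And>f g. P f \<Longrightarrow> P g \<Longrightarrow> P (f + g)"
  shows "P (f :: 'x star_poly)"
proof (induction f rule: update_induct)
  case const
  show ?case using s[of 0 0] by simp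
next
  case (update f w c)
  have "Poly_Mapping.update w c f = Poly_Mapping.single w c + f"
    using update.hyps
    by (intro poly_mapping_eqI)
      (auto simp: lookup_update lookup_add lookup_single when_def in_keys_iff)
  thus ?case using a[OF s[of w c] update.IH] by simp
qed

lemma star_poly_adj_mult: "star_poly_adj (f * g) = star_poly_adj g * star_poly_adj f"
proof (induction f rule: star_poly_induct)
  case (single w c)
  show ?case
    by (induction g rule: star_poly_induct)
      (simp_all add: mult_single star_poly_adj_single star_poly_adj_add monomial_adj_add
        distrib_left distrib_right mult.commute)
qed (simp add: star_poly_adj_add distrib_left distrib_right)

lemma star_poly_adj_adj [simp]: "star_poly_adj (star_poly_adj f) = f"
  by (induction f rule: star_poly_induct) (simp_all add: star_poly_adj_single star_poly_adj_add)

lemma keys_star_poly_adj: "Poly_Mapping.keys (star_poly_adj f) = monomial_adj ` Poly_Mapping.keys f"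
proof -
  have "Poly_Mapping.keys (star_poly_adj f) = {w. monomial_adj w \<in> Poly_Mapping.keys f}"
    by (auto simp: in_keys_iff lookup_star_poly_adj)
  also have "\<dots> = monomial_adj ` Poly_Mapping.keys f"
    by (auto simp: image_iff) (metis monomial_adj_adj)
  finally show ?thesis .
qed

lemma single_zero_commute:
  "Poly_Mapping.single 0 c * f = f * Poly_Mapping.single (0 :: 'x monomial) (c :: complex)"
  by (induction f rule: star_poly_induct)
    (simp_all add: mult_single mult.commute distrib_left distrib_right)

lemma letters_monomial_adj:
  "letter_base ` set (letters (monomial_adj w)) = letter_base ` set (letters w)"
  by (simp add: monomial_adj_def image_image)

lemma free_simps [simp]:
  "mult (free_star_algebra X) = (*)" "one (free_star_algebra X) = 1"
  "zero (free_star_algebra X) = 0" "add (free_star_algebra X) = (+)"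
  "smult (free_star_algebra X) = (\<lambda>c f. Poly_Mapping.single 0 c * f)"
  "adj (free_star_algebra X) = star_poly_adj"
  by (simp_all add: free_star_algebra_def)

lemma free_carrier: "f \<in> carrier (free_star_algebra X) \<longleftrightarrow>
    (\<forall>w\<in>Poly_Mapping.keys f. letter_base ` set (letters w) \<subseteq> X)"
  by (simp add: free_star_algebra_def)

lemma free_single: "letter_base ` set (letters w) \<subseteq> X \<Longrightarrow>
    Poly_Mapping.single w c \<in> carrier (free_star_algebra X)"
  by (simp add: free_carrier)

lemma free_closed:
  assumes f: "f \<in> carrier (free_star_algebra X)"
  shows "star_poly_adj f \<in> carrier (free_star_algebra X)"
    "- f \<in> carrier (free_star_algebra X)"
    "g \<in> carrier (free_star_algebra X) \<Longrightarrow> f + g \<in> carrier (free_star_algebra X)"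
    "g \<in> carrier (free_star_algebra X) \<Longrightarrow> f * g \<in> carrier (free_star_algebra X)"
    "Poly_Mapping.single 0 c * f \<in> carrier (free_star_algebra X)"
proof -
  show "star_poly_adj f \<in> carrier (free_star_algebra X)"
    using f by (simp add: free_carrier keys_star_poly_adj letters_monomial_adj)
  show "- f \<in> carrier (free_star_algebra X)"
    using f by (simp add: free_carrier in_keys_iff)
  show "g \<in> carrier (free_star_algebra X) \<Longrightarrow> f + g \<in> carrier (free_star_algebra X)"
    using f keys_add[of f g] unfolding free_carrier by blast
  have m: "f * g \<in> carrier (free_star_algebra X)"
    if "f \<in> carrier (free_star_algebra X)" "g \<in> carrier (free_star_algebra X)" for f g
    unfolding free_carrier
  proof
    fix w assume "w \<in> Poly_Mapping.keys (f * g)"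
    then obtain u v where uv: "w = u + v" "u \<in> Poly_Mapping.keys f" "v \<in> Poly_Mapping.keys g"
      using keys_mult[of f g] by blast
    thus "letter_base ` set (letters w) \<subseteq> X"
      using that unfolding free_carrier by (auto simp: image_Un)
  qed
  show "g \<in> carrier (free_star_algebra X) \<Longrightarrow> f * g \<in> carrier (free_star_algebra X)"
    using m f by blast
  show "Poly_Mapping.single 0 c * f \<in> carrier (free_star_algebra X)"
    by (rule m[OF free_single f]) simp
qed

lemma free_ring: "ring (free_star_algebra X)"
proof (rule ringI)
  show "abelian_group (free_star_algebra X)"
  proof (rule abelian_groupI)
    fix f assume f: "f \<in> carrier (free_star_algebra X)"
    show "\<exists>g\<in>carrier (free_star_algebra X). g \<oplus>\<^bsub>free_star_algebra X\<^esub> f = \<zero>\<^bsub>free_star_algebra X\<^esub>"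
      by (rule bexI[of _ "- f"]) (use f in \<open>simp_all add: free_closed\<close>)
  qed (simp_all add: free_closed add_ac, simp add: free_carrier)
  show "Group.monoid (free_star_algebra X)"
    by (rule Group.monoidI) (simp_all add: free_closed mult.assoc, simp add: free_carrier)
qed (simp_all add: distrib_left distrib_right)

lemma free_uminus: "f \<in> carrier (free_star_algebra X) \<Longrightarrow> \<ominus>\<^bsub>free_star_algebra X\<^esub> f = - f"
proof -
  assume f: "f \<in> carrier (free_star_algebra X)"
  interpret F: ring "free_star_algebra X" by (rule free_ring)
  show ?thesis by (rule F.minus_equality) (use f in \<open>simp_all add: free_closed\<close>)
qed

lemma free_minus: "g \<in> carrier (free_star_algebra X) \<Longrightarrow> f \<ominus>\<^bsub>free_star_algebra X\<^esub> g = f - g"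
  by (simp add: a_minus_def free_uminus)

lemma free_unital_star_algebra: "unital_star_algebra (free_star_algebra X)"
proof (intro unital_star_algebra.intro free_ring unital_star_algebra_axioms.intro)
  fix f g :: "'a star_poly" and c d :: complex
  show "(c + d) \<odot>\<^bsub>free_star_algebra X\<^esub> f =
      c \<odot>\<^bsub>free_star_algebra X\<^esub> f \<oplus>\<^bsub>free_star_algebra X\<^esub> d \<odot>\<^bsub>free_star_algebra X\<^esub> f"
    by (simp add: single_add distrib_right)
  show "(c * d) \<odot>\<^bsub>free_star_algebra X\<^esub> f =
      c \<odot>\<^bsub>free_star_algebra X\<^esub> (d \<odot>\<^bsub>free_star_algebra X\<^esub> f)"
    by (simp flip: mult.assoc add: mult_single)
  show "f \<otimes>\<^bsub>free_star_algebra X\<^esub> (c \<odot>\<^bsub>free_star_algebra X\<^esub> g) =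
      c \<odot>\<^bsub>free_star_algebra X\<^esub> (f \<otimes>\<^bsub>free_star_algebra X\<^esub> g)"
    using single_zero_commute[of c f] by (simp flip: mult.assoc)
  show "star\<^bsub>free_star_algebra X\<^esub> (c \<odot>\<^bsub>free_star_algebra X\<^esub> f) =
      cnj c \<odot>\<^bsub>free_star_algebra X\<^esub> star\<^bsub>free_star_algebra X\<^esub> f"
    using single_zero_commute[of "cnj c" "star_poly_adj f"]
    by (simp add: star_poly_adj_mult star_poly_adj_single monomial_adj_def zero_monomial_def)
qed (simp_all add: free_closed distrib_left mult.assoc star_poly_adj_add star_poly_adj_mult)

lemma poly_gen_carrier: "x \<in> X \<Longrightarrow> poly_gen x \<in> carrier (free_star_algebra X)"
  by (simp add: poly_gen_def free_single)


lemma zero_admissible: "(\<lambda>_. 0) \<in> admissible_seminorms X R"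
  by (simp add: admissible_seminorms_def cstar_seminorm_def)

lemma seminorm_bounded_by_gens:
  assumes gens: "\<And>x. x \<in> X \<Longrightarrow> \<exists>C. \<forall>N\<in>admissible_seminorms X R. N (poly_gen x) \<le> C"
    and f: "f \<in> carrier (free_star_algebra X)"
  shows "\<exists>C. \<forall>N\<in>admissible_seminorms X R. N f \<le> C"
proof -
  let ?S = "admissible_seminorms X R" and ?F = "free_star_algebra X"
  have sn: "seminormed_star_algebra (free_star_algebra X) N" if "N \<in> ?S" for N
    using that free_unital_star_algebra
    by (auto simp: admissible_seminorms_def seminormed_star_algebra_def seminormed_star_algebra_axioms_def)
  have letter: "\<exists>C\<ge>0. \<forall>N\<in>?S. N (Poly_Mapping.single (Monomial [l]) 1) \<le> C"
    if "letter_base l \<in> X" for l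
  proof -
    obtain C where C: "\<forall>N\<in>?S. N (poly_gen (letter_base l)) \<le> C" using gens \<open>letter_base l \<in> X\<close> by blast
    have eq: "N (Poly_Mapping.single (Monomial [l]) 1) = N (poly_gen (letter_base l))" if N: "N \<in> ?S" for N
    proof -
      interpret seminormed_star_algebra ?F N by (rule sn[OF N])
      have "N (star_poly_adj (poly_gen (letter_base l))) = N (poly_gen (letter_base l))"
        using N_star[OF poly_gen_carrier[OF \<open>letter_base l \<in> X\<close>]] by simp
      thus ?thesis
        by (cases l) (simp_all add: poly_gen_def star_poly_adj_single monomial_adj_def)
    qed
    have "N (Poly_Mapping.single (Monomial [l]) 1) \<le> max 0 C" if N: "N \<in> ?S" for N
      using C N unfolding eq[OF N] by (simp add: le_max_iff_disj)
    thus ?thesis by (intro exI[of _ "max 0 C"]) simp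
  qed
  have word: "\<exists>C\<ge>0. \<forall>N\<in>?S. N (Poly_Mapping.single (Monomial ls) 1) \<le> C"
    if "letter_base ` set ls \<subseteq> X" for ls
    using that
  proof (induction ls)
    case Nil
    have "N (Poly_Mapping.single (Monomial []) 1) \<le> 1" if N: "N \<in> ?S" for N
    proof -
      interpret seminormed_star_algebra ?F N by (rule sn[OF N])
      have "star_poly_adj 1 = (1 :: 'a star_poly)"
        using star_poly_adj_single[of 0 1] by (simp add: monomial_adj_def zero_monomial_def flip: single_one)
      hence "N 1 = (N 1)\<^sup>2" using N_cstar[of 1] one_closed by simp
      hence "N 1 = 0 \<or> N 1 = 1" by (simp add: power2_eq_square)
      thus ?thesis by (auto simp flip: zero_monomial_def)
    qed
    thus ?case by (intro exI[of _ 1]) auto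
  next
    case (Cons l ls)
    then obtain C D where C: "C \<ge> 0" "\<forall>N\<in>?S. N (Poly_Mapping.single (Monomial ls) 1) \<le> C"
      and D: "D \<ge> 0" "\<forall>N\<in>?S. N (Poly_Mapping.single (Monomial [l]) 1) \<le> D"
      using letter[of l] by auto
    have "N (Poly_Mapping.single (Monomial (l # ls)) 1) \<le> D * C" if N: "N \<in> ?S" for N
    proof -
      interpret seminormed_star_algebra ?F N by (rule sn[OF N])
      have c: "Poly_Mapping.single (Monomial [l]) 1 \<in> carrier ?F" "Poly_Mapping.single (Monomial ls) 1 \<in> carrier ?F"
        using Cons.prems by (auto intro!: free_single)
      have "N (Poly_Mapping.single (Monomial (l # ls)) 1) =
        N (Poly_Mapping.single (Monomial [l]) 1 * Poly_Mapping.single (Monomial ls) 1)"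
        by (simp add: mult_single plus_monomial_def)
      also have "\<dots> \<le> N (Poly_Mapping.single (Monomial [l]) 1) * N (Poly_Mapping.single (Monomial ls) 1)"
        using N_mult[OF c] by simp
      also have "\<dots> \<le> D * C"
        using C D N c N_nonneg by (intro mult_mono) auto
      finally show ?thesis .
    qed
    thus ?case using C D by (intro exI[of _ "D * C"]) auto
  qed
  show ?thesis using f
  proof (induction f rule: update_induct)
    case const
    have "N 0 \<le> 0" if N: "N \<in> ?S" for N
    proof -
      interpret seminormed_star_algebra ?F N by (rule sn[OF N])
      show ?thesis using N_zero by simp
    qed
    thus ?case by blast
  next
    case (update f w c)
    have eq: "Poly_Mapping.update w c f = Poly_Mapping.single 0 c * Poly_Mapping.single w 1 + f"
      using update.hyps
      by (intro poly_mapping_eqI)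
        (auto simp: mult_single lookup_update lookup_add lookup_single when_def in_keys_iff)
    have f: "f \<in> carrier ?F" and w: "letter_base ` set (letters w) \<subseteq> X"
      using update.prems update.hyps by (auto simp: free_carrier keys_update)
    obtain C where C: "\<forall>N\<in>?S. N f \<le> C" using update.IH f by blast
    obtain D where D: "\<forall>N\<in>?S. N (Poly_Mapping.single w 1) \<le> D" using word[OF w] by auto
    have "N (Poly_Mapping.update w c f) \<le> cmod c * D + C" if N: "N \<in> ?S" for N
    proof -
      interpret seminormed_star_algebra ?F N by (rule sn[OF N])
      have w1: "Poly_Mapping.single w 1 \<in> carrier ?F" using w by (rule free_single)
      have "N (Poly_Mapping.update w c f) \<le> N (Poly_Mapping.single 0 c * Poly_Mapping.single w 1) + N f"
        unfolding eq using N_add[OF smult_closed[OF w1, of c] f] by simp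
      also have "N (Poly_Mapping.single 0 c * Poly_Mapping.single w 1) = cmod c * N (Poly_Mapping.single w 1)"
        using N_smult[OF w1] by simp
      also have "cmod c * N (Poly_Mapping.single w 1) + N f \<le> cmod c * D + C"
        using C D N by (intro add_mono mult_left_mono) auto
      finally show ?thesis .
    qed
    thus ?case by blast
  qed
qed

locale bounded_presentation =
  fixes X :: "'x set" and R :: "'x star_poly set"
  assumes relators: "R \<subseteq> carrier (free_star_algebra X)"
    and bounded_gens: "x \<in> X \<Longrightarrow> \<exists>C. \<forall>N\<in>admissible_seminorms X R. N (poly_gen x) \<le> C"
begin

abbreviation "FA \<equiv> free_star_algebra X"
abbreviation "US \<equiv> universal_seminorm X R"

lemma bdd: "f \<in> carrier FA \<Longrightarrow> bdd_above ((\<lambda>N. N f) ` admissible_seminorms X R)"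
  using seminorm_bounded_by_gens[of X R f] bounded_gens by (auto simp: bdd_above_def)

lemma le_US: "N \<in> admissible_seminorms X R \<Longrightarrow> f \<in> carrier FA \<Longrightarrow> N f \<le> US f"
  unfolding universal_seminorm_def by (rule cSUP_upper[OF _ bdd])

lemma US_leI: "(\<And>N. N \<in> admissible_seminorms X R \<Longrightarrow> N f \<le> C) \<Longrightarrow> US f \<le> C"
  unfolding universal_seminorm_def by (rule cSUP_least) (use zero_admissible in auto)

lemma adm_seminormed: "N \<in> admissible_seminorms X R \<Longrightarrow> seminormed_star_algebra FA N"
  using free_unital_star_algebra
  by (auto simp: admissible_seminorms_def seminormed_star_algebra_def seminormed_star_algebra_axioms_def)

lemma US_nonneg: "f \<in> carrier FA \<Longrightarrow> 0 \<le> US f"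
  using le_US[OF zero_admissible] by simp

lemma US_relator: "r \<in> R \<Longrightarrow> US r = 0"
proof (rule antisym)
  assume r: "r \<in> R"
  show "US r \<le> 0" by (rule US_leI) (use r in \<open>auto simp: admissible_seminorms_def\<close>)
  show "0 \<le> US r" using r relators US_nonneg by blast
qed

lemma US_smult_le: "f \<in> carrier FA \<Longrightarrow> US (c \<odot>\<^bsub>FA\<^esub> f) \<le> cmod c * US f"
proof (rule US_leI)
  fix N assume f: "f \<in> carrier FA" and N: "N \<in> admissible_seminorms X R"
  interpret seminormed_star_algebra FA N by (rule adm_seminormed[OF N])
  show "N (c \<odot>\<^bsub>FA\<^esub> f) \<le> cmod c * US f"
    unfolding N_smult[OF f] by (intro mult_left_mono le_US N f) simp
qed

lemma US_seminorm: "cstar_seminorm FA US"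
  unfolding cstar_seminorm_def
proof (intro conjI ballI allI US_nonneg)
  interpret F: unital_star_algebra FA by (rule free_unital_star_algebra)
  fix f assume f: "f \<in> carrier FA"
  show "US (c \<odot>\<^bsub>FA\<^esub> f) = cmod c * US f" for c
  proof (cases "c = 0")
    case True
    have "US 0 \<le> 0"
      using US_smult_le[OF f, of 0] by simp
    thus ?thesis using True US_nonneg[OF F.zero_closed] by simp
  next
    case False
    have "f = inverse c \<odot>\<^bsub>FA\<^esub> (c \<odot>\<^bsub>FA\<^esub> f)"
      using False F.smult_assoc[OF f, of "inverse c" c] F.smult_one[OF f] by simp
    hence "US f \<le> cmod (inverse c) * US (c \<odot>\<^bsub>FA\<^esub> f)"
      using US_smult_le[OF F.smult_closed[OF f], of "inverse c" c] by simp
    hence "cmod c * US f \<le> US (c \<odot>\<^bsub>FA\<^esub> f)"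
      using False by (simp add: norm_divide field_simps)
    thus ?thesis using US_smult_le[OF f] by (rule antisym[rotated])
  qed
  show "US (star\<^bsub>FA\<^esub> f \<otimes>\<^bsub>FA\<^esub> f) = (US f)\<^sup>2"
  proof (rule antisym)
    have sf: "star\<^bsub>FA\<^esub> f \<otimes>\<^bsub>FA\<^esub> f \<in> carrier FA" by (intro F.m_closed F.star_closed f)
    show "US (star\<^bsub>FA\<^esub> f \<otimes>\<^bsub>FA\<^esub> f) \<le> (US f)\<^sup>2"
    proof (rule US_leI)
      fix N assume N: "N \<in> admissible_seminorms X R"
      interpret seminormed_star_algebra FA N by (rule adm_seminormed[OF N])
      show "N (star\<^bsub>FA\<^esub> f \<otimes>\<^bsub>FA\<^esub> f) \<le> (US f)\<^sup>2"
        unfolding N_cstar[OF f] by (intro power_mono le_US N f N_nonneg)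
    qed
    have "US f \<le> sqrt (US (star\<^bsub>FA\<^esub> f \<otimes>\<^bsub>FA\<^esub> f))"
    proof (rule US_leI)
      fix N assume N: "N \<in> admissible_seminorms X R"
      interpret seminormed_star_algebra FA N by (rule adm_seminormed[OF N])
      show "N f \<le> sqrt (US (star\<^bsub>FA\<^esub> f \<otimes>\<^bsub>FA\<^esub> f))"
        using le_US[OF N sf] unfolding N_cstar[OF f] by (rule real_le_rsqrt)
    qed
    thus "(US f)\<^sup>2 \<le> US (star\<^bsub>FA\<^esub> f \<otimes>\<^bsub>FA\<^esub> f)"
      using US_nonneg[OF f] US_nonneg[OF sf] by (metis power_mono real_sqrt_pow2)
  qed
  fix g assume g: "g \<in> carrier FA"
  show "US (f \<oplus>\<^bsub>FA\<^esub> g) \<le> US f + US g"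
  proof (rule US_leI)
    fix N assume N: "N \<in> admissible_seminorms X R"
    interpret seminormed_star_algebra FA N by (rule adm_seminormed[OF N])
    show "N (f \<oplus>\<^bsub>FA\<^esub> g) \<le> US f + US g"
      using N_add[OF f g] le_US[OF N f] le_US[OF N g] by simp
  qed
  show "US (f \<otimes>\<^bsub>FA\<^esub> g) \<le> US f * US g"
  proof (rule US_leI)
    fix N assume N: "N \<in> admissible_seminorms X R"
    interpret seminormed_star_algebra FA N by (rule adm_seminormed[OF N])
    have "N (f \<otimes>\<^bsub>FA\<^esub> g) \<le> N f * N g" by (rule N_mult[OF f g])
    also have "\<dots> \<le> US f * US g" by (intro mult_mono le_US N f g N_nonneg US_nonneg)
    finally show "N (f \<otimes>\<^bsub>FA\<^esub> g) \<le> US f * US g" .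
  qed
qed

lemma US_seminormed: "seminormed_star_algebra FA US"
  by (intro seminormed_star_algebra.intro seminormed_star_algebra_axioms.intro
      free_unital_star_algebra US_seminorm)

lemma universal_cstar: "unital_cstar_algebra (universal_cstar X R)"
  unfolding universal_cstar_def
  by (rule seminormed_star_algebra.AC_cstar[OF US_seminormed])

end


section \<open>Extension of homomorphisms\<close>

context unital_cstar_algebra begin

lemma limit_exists:
  assumes "s \<in> cauchy_seqs A (cnorm A)"
  shows "\<exists>b\<in>carrier A. (s, \<lambda>n. b) \<in> null_rel A (cnorm A)"
proof -
  obtain b where b: "b \<in> carrier A" "(\<lambda>n. \<parallel>s n \<ominus> b\<parallel>) \<longlonglongrightarrow> 0"
    using norm_complete[of s] NS.CS_carrier[OF assms] NS.CS_cauchy[OF assms] by blast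
  thus ?thesis using assms NS.CS_const by (auto simp: null_rel_def)
qed

lemma limit_unique:
  assumes "(s, \<lambda>n. b) \<in> null_rel A (cnorm A)" "(s, \<lambda>n. b') \<in> null_rel A (cnorm A)"
  shows "b = b'"
proof -
  have "(\<lambda>n. b, \<lambda>n. b') \<in> null_rel A (cnorm A)"
    using assms NS.NR_equiv by (meson equivE symD transD)
  hence c: "(\<lambda>n. b) \<in> NS.CS" "(\<lambda>n. b') \<in> NS.CS" and "(\<lambda>n::nat. \<parallel>b \<ominus> b'\<parallel>) \<longlonglongrightarrow> 0"
    by (auto simp: null_rel_def)
  hence "\<parallel>b \<ominus> b'\<parallel> = 0" using LIMSEQ_unique tendsto_const by blast
  moreover have bb: "b \<in> carrier A" "b' \<in> carrier A" using NS.CS_carrier c by auto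
  ultimately have "b \<ominus> b' = \<zero>" by (intro norm_definite) auto
  moreover have "b = (b \<ominus> b') \<oplus> b'" using bb unfolding a_minus_def by algebra
  ultimately show ?thesis using bb by simp
qed

end

locale contractive_star_hom =
  A: seminormed_star_algebra A N + B: unital_cstar_algebra B
  for A (structure) and N and B (structure) +
  fixes h
  assumes hom: "h \<in> star_hom A B"
    and contractive: "x \<in> carrier A \<Longrightarrow> cnorm B (h x) \<le> N x"
begin

lemma h_simps:
  "x \<in> carrier A \<Longrightarrow> h x \<in> carrier B"
  "x \<in> carrier A \<Longrightarrow> y \<in> carrier A \<Longrightarrow> h (x \<otimes>\<^bsub>A\<^esub> y) = h x \<otimes>\<^bsub>B\<^esub> h y"
  "x \<in> carrier A \<Longrightarrow> y \<in> carrier A \<Longrightarrow> h (x \<oplus>\<^bsub>A\<^esub> y) = h x \<oplus>\<^bsub>B\<^esub> h y"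
  "h \<one>\<^bsub>A\<^esub> = \<one>\<^bsub>B\<^esub>"
  "x \<in> carrier A \<Longrightarrow> h (c \<odot>\<^bsub>A\<^esub> x) = c \<odot>\<^bsub>B\<^esub> h x"
  "x \<in> carrier A \<Longrightarrow> h (star\<^bsub>A\<^esub> x) = star\<^bsub>B\<^esub> (h x)"
  using hom by (auto simp: star_hom_def ring_hom_def)

lemma h_minus: "x \<in> carrier A \<Longrightarrow> y \<in> carrier A \<Longrightarrow> h (x \<ominus>\<^bsub>A\<^esub> y) = h x \<ominus>\<^bsub>B\<^esub> h y"
  using h_simps(3)[of x "(-1) \<odot>\<^bsub>A\<^esub> y"] h_simps(5)[of y "-1"] h_simps(1)[of y] A.smult_closed[of y "-1"]
  by (simp add: a_minus_def A.smult_minus_one B.NS.smult_minus_one)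

lemma h_CS: "s \<in> A.CS \<Longrightarrow> (\<lambda>n. h (s n)) \<in> B.NS.CS"
proof -
  assume s: "s \<in> A.CS"
  have le: "cnorm B (h (s m) \<ominus>\<^bsub>B\<^esub> h (s n)) \<le> N (s m \<ominus>\<^bsub>A\<^esub> s n)" for m n
    using contractive[of "s m \<ominus>\<^bsub>A\<^esub> s n"] A.CS_carrier[OF s] by (simp add: h_minus)
  show ?thesis
    unfolding cauchy_seqs_def
    using A.CS_cauchy[OF s] A.CS_carrier[OF s] le h_simps(1)
    by (auto; meson order_le_less_trans)
qed

lemma h_NR: "(s, t) \<in> A.NR \<Longrightarrow> (\<lambda>n. h (s n), \<lambda>n. h (t n)) \<in> B.NS.NR"
proof -
  assume "(s, t) \<in> A.NR"
  hence c: "s \<in> A.CS" "t \<in> A.CS" and l: "(\<lambda>n. N (s n \<ominus>\<^bsub>A\<^esub> t n)) \<longlonglongrightarrow> 0"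
    by (auto simp: null_rel_def)
  have cc: "s n \<in> carrier A" "t n \<in> carrier A" for n using c A.CS_carrier by auto
  have "(\<lambda>n. cnorm B (h (s n) \<ominus>\<^bsub>B\<^esub> h (t n))) \<longlonglongrightarrow> 0"
  proof (rule null_sandwich[OF l])
    show "0 \<le> cnorm B (h (s n) \<ominus>\<^bsub>B\<^esub> h (t n))" for n
      using cc h_simps(1) by (intro B.NS.N_nonneg) auto
    show "cnorm B (h (s n) \<ominus>\<^bsub>B\<^esub> h (t n)) \<le> N (s n \<ominus>\<^bsub>A\<^esub> t n)" for n
      using contractive[of "s n \<ominus>\<^bsub>A\<^esub> t n"] cc by (simp add: h_minus)
  qed
  thus ?thesis using h_CS c by (simp add: null_rel_def)
qed

definition ext where
  "ext a = (THE b. \<forall>s\<in>a. (\<lambda>n. h (s n), \<lambda>n. b) \<in> B.NS.NR)"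

lemma ext_eqI:
  assumes s: "s \<in> A.CS" and b: "(\<lambda>n. h (s n), \<lambda>n. b) \<in> B.NS.NR"
  shows "ext (A.cls s) = b"
  unfolding ext_def
proof (rule the_equality)
  show "\<forall>t\<in>A.cls s. (\<lambda>n. h (t n), \<lambda>n. b) \<in> B.NS.NR"
  proof
    fix t assume "t \<in> A.cls s"
    hence "(\<lambda>n. h (s n), \<lambda>n. h (t n)) \<in> B.NS.NR" by (intro h_NR) simp
    thus "(\<lambda>n. h (t n), \<lambda>n. b) \<in> B.NS.NR" using b B.NS.NR_equiv by (meson equivE symD transD)
  qed
  fix b' assume "\<forall>t\<in>A.cls s. (\<lambda>n. h (t n), \<lambda>n. b') \<in> B.NS.NR"
  hence "(\<lambda>n. h (s n), \<lambda>n. b') \<in> B.NS.NR" using equiv_class_self[OF A.NR_equiv s] by blast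
  thus "b' = b" using b B.limit_unique by blast
qed

lemma ext_cls:
  assumes s: "s \<in> A.CS"
  shows "ext (A.cls s) \<in> carrier B" "(\<lambda>n. h (s n), \<lambda>n. ext (A.cls s)) \<in> B.NS.NR"
proof -
  obtain b where "b \<in> carrier B" "(\<lambda>n. h (s n), \<lambda>n. b) \<in> B.NS.NR"
    using B.limit_exists[OF h_CS[OF s]] by blast
  thus "ext (A.cls s) \<in> carrier B" "(\<lambda>n. h (s n), \<lambda>n. ext (A.cls s)) \<in> B.NS.NR"
    using ext_eqI[OF s] by auto
qed

lemma ext_incl: "x \<in> carrier A \<Longrightarrow> ext (completion_incl A N x) = h x"
  unfolding completion_incl_def
proof (rule ext_eqI)
  assume x: "x \<in> carrier A"
  show "(\<lambda>n. x) \<in> A.CS" using x by (rule A.CS_const)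
  have "(\<lambda>n. h x) \<in> B.NS.CS" using x h_simps(1) B.NS.CS_const by blast
  thus "(\<lambda>n. h x, \<lambda>n. h x) \<in> B.NS.NR"
    using B.NS.NR_equiv by (meson equivE refl_onD)
qed

lemma ext_hom: "ext \<in> star_hom A.AC B"
proof -
  have "ext \<in> ring_hom A.AC B"
  proof (rule ring_hom_memI)
    fix a assume "a \<in> carrier A.AC"
    thus "ext a \<in> carrier B" using ext_cls by (metis A.AC_cases)
  next
    fix a b assume "a \<in> carrier A.AC" "b \<in> carrier A.AC"
    then obtain s t where s: "s \<in> A.CS" "a = A.cls s" and t: "t \<in> A.CS" "b = A.cls t"
      by (meson A.AC_cases)
    note c = A.CS_carrier[OF s(1)] A.CS_carrier[OF t(1)]
    show "ext (a \<otimes>\<^bsub>A.AC\<^esub> b) = ext a \<otimes>\<^bsub>B\<^esub> ext b"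
      unfolding s(2) t(2) A.AC_mult[OF s(1) t(1)]
      using B.NS.NR_mult[OF ext_cls(2)[OF s(1)] ext_cls(2)[OF t(1)]] c
      by (intro ext_eqI A.CS_mult s(1) t(1)) (simp add: h_simps)
    show "ext (a \<oplus>\<^bsub>A.AC\<^esub> b) = ext a \<oplus>\<^bsub>B\<^esub> ext b"
      unfolding s(2) t(2) A.AC_add[OF s(1) t(1)]
      using B.NS.NR_add[OF ext_cls(2)[OF s(1)] ext_cls(2)[OF t(1)]] c
      by (intro ext_eqI A.CS_add s(1) t(1)) (simp add: h_simps)
  next
    show "ext \<one>\<^bsub>A.AC\<^esub> = \<one>\<^bsub>B\<^esub>"
      using ext_incl[of "\<one>\<^bsub>A\<^esub>"] by (simp add: A.AC_one completion_incl_def h_simps)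
  qed
  moreover have "ext (c \<odot>\<^bsub>A.AC\<^esub> a) = c \<odot>\<^bsub>B\<^esub> ext a" "ext (star\<^bsub>A.AC\<^esub> a) = star\<^bsub>B\<^esub> (ext a)"
    if a: "a \<in> carrier A.AC" for a c
  proof -
    obtain s where s: "s \<in> A.CS" "a = A.cls s" using a by (meson A.AC_cases)
    note c = A.CS_carrier[OF s(1)]
    show "ext (c \<odot>\<^bsub>A.AC\<^esub> a) = c \<odot>\<^bsub>B\<^esub> ext a"
      unfolding s(2) A.AC_smult[OF s(1)]
      using B.NS.NR_smult[OF ext_cls(2)[OF s(1)], of c] c
      by (intro ext_eqI A.CS_smult s(1)) (simp add: h_simps)
    show "ext (star\<^bsub>A.AC\<^esub> a) = star\<^bsub>B\<^esub> (ext a)"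
      unfolding s(2) A.AC_star[OF s(1)]
      using B.NS.NR_star[OF ext_cls(2)[OF s(1)]] c
      by (intro ext_eqI A.CS_star s(1)) (simp add: h_simps)
  qed
  ultimately show ?thesis by (simp add: star_hom_def)
qed

end


fun letter_val :: "('b, 'm) star_algebra_scheme \<Rightarrow> ('x \<Rightarrow> 'b) \<Rightarrow> 'x letter \<Rightarrow> 'b" where
  "letter_val B g (Gen x) = g x"
| "letter_val B g (Gen_adj x) = star\<^bsub>B\<^esub> (g x)"

definition monomial_val :: "('b, 'm) star_algebra_scheme \<Rightarrow> ('x \<Rightarrow> 'b) \<Rightarrow> 'x monomial \<Rightarrow> 'b" where
  "monomial_val B g w = foldr (\<lambda>l b. letter_val B g l \<otimes>\<^bsub>B\<^esub> b) (letters w) \<one>\<^bsub>B\<^esub>"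

definition poly_val :: "('b, 'm) star_algebra_scheme \<Rightarrow> ('x \<Rightarrow> 'b) \<Rightarrow> 'x star_poly \<Rightarrow> 'b" where
  "poly_val B g f =
     finsum B (\<lambda>w. Poly_Mapping.lookup f w \<odot>\<^bsub>B\<^esub> monomial_val B g w) (Poly_Mapping.keys f)"

locale star_poly_evaluation = unital_star_algebra B for B (structure) +
  fixes g :: "'x \<Rightarrow> 'a"
  assumes gens: "g x \<in> carrier B"
begin

lemma smult_zero: "x \<in> carrier B \<Longrightarrow> 0 \<odot> x = \<zero>"
proof -
  assume x: "x \<in> carrier B"
  have "0 \<odot> x \<oplus> 0 \<odot> x = 0 \<odot> x \<oplus> \<zero>"
    using smult_l_distr[of x 0 0] x smult_closed by simp
  thus ?thesis using x smult_closed add.r_cancel_one[of "0 \<odot> x" "0 \<odot> x"] by simp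
qed

lemma letter_val_closed [simp]: "letter_val B g l \<in> carrier B"
  by (cases l) (simp_all add: gens star_closed)

lemma foldr_closed [simp]: "foldr (\<lambda>l b. letter_val B g l \<otimes> b) ls \<one> \<in> carrier B"
  by (induction ls) auto

lemma mval_closed [simp]: "monomial_val B g w \<in> carrier B"
  by (simp add: monomial_val_def)

lemma mval_add: "monomial_val B g (u + w) = monomial_val B g u \<otimes> monomial_val B g w"
proof -
  have "foldr (\<lambda>l b. letter_val B g l \<otimes> b) (ls @ ms) \<one> =
      foldr (\<lambda>l b. letter_val B g l \<otimes> b) ls \<one> \<otimes> foldr (\<lambda>l b. letter_val B g l \<otimes> b) ms \<one>" for ls ms
    by (induction ls) (simp_all del: foldr_append add: m_assoc)
  thus ?thesis by (simp add: monomial_val_def)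
qed

lemma star_one: "star \<one> = \<one>"
proof -
  have "star (star \<one> \<otimes> \<one>) = star \<one> \<otimes> star (star \<one>)"
    by (rule star_mult) (simp_all add: star_closed)
  thus ?thesis by (simp add: star_closed star_star)
qed

lemma mval_adj: "monomial_val B g (monomial_adj w) = star (monomial_val B g w)"
proof -
  have l: "letter_val B g (letter_adj l) = star (letter_val B g l)" for l
    by (cases l) (simp_all add: star_star gens)
  have "monomial_val B g (monomial_adj (Monomial ls)) = star (monomial_val B g (Monomial ls))" for ls
  proof (induction ls)
    case Nil
    show ?case by (simp add: monomial_adj_def monomial_val_def star_one)
  next
    case (Cons k ls)
    have m: "Monomial (k # ls) = Monomial [k] + Monomial ls" by (simp add: plus_monomial_def)
    have k: "monomial_val B g (monomial_adj (Monomial [k])) = star (monomial_val B g (Monomial [k]))"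
      by (simp add: monomial_adj_def monomial_val_def l star_closed)
    show ?case
      unfolding m monomial_adj_add mval_add by (simp add: k Cons.IH star_mult)
  qed
  thus ?thesis by (metis monomial.collapse)
qed

lemma pval_superset:
  assumes "finite K" "Poly_Mapping.keys f \<subseteq> K"
  shows "poly_val B g f = finsum B (\<lambda>w. Poly_Mapping.lookup f w \<odot> monomial_val B g w) K"
  unfolding poly_val_def
  by (rule add.finprod_mono_neutral_cong_left)
    (use assms in \<open>auto simp: in_keys_iff smult_zero smult_closed\<close>)

lemma pval_closed [simp]: "poly_val B g f \<in> carrier B"
  unfolding poly_val_def by (intro finsum_closed) (auto simp: smult_closed)

lemma pval_add: "poly_val B g (f + f') = poly_val B g f \<oplus> poly_val B g f'"
proof -
  let ?K = "Poly_Mapping.keys f \<union> Poly_Mapping.keys f'"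
  have fin: "finite ?K" by simp
  have "poly_val B g (f + f') =
      finsum B (\<lambda>w. Poly_Mapping.lookup f w \<odot> monomial_val B g w \<oplus> Poly_Mapping.lookup f' w \<odot> monomial_val B g w) ?K"
    using pval_superset[OF fin keys_add] by (simp add: lookup_add smult_l_distr)
  also have "\<dots> = poly_val B g f \<oplus> poly_val B g f'"
    using pval_superset[OF fin, of f] pval_superset[OF fin, of f']
    by (subst finsum_addf) (auto simp: smult_closed)
  finally show ?thesis .
qed

lemma pval_single: "poly_val B g (Poly_Mapping.single w c) = c \<odot> monomial_val B g w"
proof -
  have "poly_val B g (Poly_Mapping.single w c) =
      finsum B (\<lambda>u. Poly_Mapping.lookup (Poly_Mapping.single w c) u \<odot> monomial_val B g u) {w}"
    by (rule pval_superset) auto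
  also have "\<dots> = c \<odot> monomial_val B g w"
    by (subst finsum_insert) (auto simp: smult_closed)
  finally show ?thesis .
qed

lemma pval_mult: "poly_val B g (f * f') = poly_val B g f \<otimes> poly_val B g f'"
proof (induction f rule: star_poly_induct)
  case (single w c)
  show ?case
  proof (induction f' rule: star_poly_induct)
    case (single u d)
    have "(c * d) \<odot> (monomial_val B g w \<otimes> monomial_val B g u) =
        (c \<odot> monomial_val B g w) \<otimes> (d \<odot> monomial_val B g u)"
      using smult_mult_l[of "monomial_val B g w" "d \<odot> monomial_val B g u" c]
        smult_mult_r[of "monomial_val B g w" "monomial_val B g u" d]
        smult_assoc[of "monomial_val B g w \<otimes> monomial_val B g u" c d]
      by (simp add: smult_closed)
    thus ?case by (simp add: mult_single pval_single mval_add)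
  qed (simp add: distrib_left pval_add r_distr)
qed (simp add: distrib_right pval_add l_distr)

lemma pval_star: "poly_val B g (star_poly_adj f) = star (poly_val B g f)"
  by (induction f rule: star_poly_induct)
    (simp_all add: star_poly_adj_single star_poly_adj_add pval_single pval_add mval_adj star_smult star_add)

lemma pval_hom: "poly_val B g \<in> star_hom (free_star_algebra X) B"
proof -
  have m0: "monomial_val B g 0 = \<one>" by (simp add: monomial_val_def)
  have "poly_val B g \<in> ring_hom (free_star_algebra X) B"
  proof (rule ring_hom_memI)
    show "poly_val B g \<one>\<^bsub>free_star_algebra X\<^esub> = \<one>"
      using pval_single[of 0 1] by (simp add: m0 smult_one)
  qed (simp_all add: pval_add pval_mult)
  moreover have "poly_val B g (Poly_Mapping.single 0 c * f) = c \<odot> poly_val B g f" for c f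
    by (simp add: pval_mult pval_single m0 smult_mult_l)
  ultimately show ?thesis by (simp add: star_hom_def pval_star)
qed

lemma pval_gen: "poly_val B g (poly_gen x) = g x"
  by (simp add: poly_gen_def pval_single monomial_val_def gens smult_one)

end

lemma (in bounded_presentation) universal_property:
  assumes B: "unital_cstar_algebra B"
    and hom: "h \<in> star_hom (free_star_algebra X) B"
    and rel: "\<And>r. r \<in> R \<Longrightarrow> h r = \<zero>\<^bsub>B\<^esub>"
  shows "\<exists>\<phi>\<in>star_hom (universal_cstar X R) B. \<forall>x\<in>X. \<phi> (universal_gen X R x) = h (poly_gen x)"
proof -
  interpret B: unital_cstar_algebra B by (rule B)
  interpret A: seminormed_star_algebra FA US by (rule US_seminormed)
  let ?N = "\<lambda>f. cnorm B (h f)"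
  have h: "h f \<in> carrier B" "h (c \<odot>\<^bsub>FA\<^esub> f) = c \<odot>\<^bsub>B\<^esub> h f" "h (star\<^bsub>FA\<^esub> f) = star\<^bsub>B\<^esub> (h f)"
    "f' \<in> carrier FA \<Longrightarrow> h (f \<otimes>\<^bsub>FA\<^esub> f') = h f \<otimes>\<^bsub>B\<^esub> h f'"
    "f' \<in> carrier FA \<Longrightarrow> h (f \<oplus>\<^bsub>FA\<^esub> f') = h f \<oplus>\<^bsub>B\<^esub> h f'" if "f \<in> carrier FA" for f f' c
    using hom that by (auto simp: star_hom_def ring_hom_def)
  have "cstar_seminorm FA ?N"
    unfolding cstar_seminorm_def
    by (auto simp del: free_simps simp: h A.star_closed B.NS.N_nonneg B.NS.N_add B.NS.N_mult B.NS.N_smult B.NS.N_cstar)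
  hence "?N \<in> admissible_seminorms X R"
    by (simp add: admissible_seminorms_def rel B.NS.N_zero)
  hence con: "?N f \<le> US f" if "f \<in> carrier FA" for f using le_US that by blast
  interpret contractive_star_hom FA US B h
    by unfold_locales (use hom con in auto)
  show ?thesis
    using ext_hom ext_incl[OF poly_gen_carrier]
    by (intro bexI[of _ ext]) (auto simp: universal_gen_def universal_cstar_def)
qed


section \<open>Relators under homomorphisms\<close>

context seminormed_star_algebra begin

lemma incl_hom: "completion_incl A N \<in> star_hom A AC"
proof -
  have "completion_incl A N \<in> ring_hom A AC"
    by (rule ring_hom_memI)
      (simp_all add: completion_incl_def cls_carrier CS_const AC_mult AC_add AC_one)
  thus ?thesis
    by (simp add: star_hom_def completion_incl_def AC_smult AC_star CS_const)
qed

lemma incl_zero: "x \<in> carrier A \<Longrightarrow> N x = 0 \<Longrightarrow> completion_incl A N x = \<zero>\<^bsub>AC\<^esub>"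
  using cls_eq_iff[OF CS_const[of x] CS_const[of \<zero>]]
  by (simp add: completion_incl_def AC_zero CS_const null_rel_def a_minus_def)

lemma N_one: "N \<one> \<le> 1"
proof -
  have "star (star \<one> \<otimes> \<one>) = star \<one> \<otimes> star (star \<one>)"
    by (rule star_mult) (simp_all add: star_closed)
  hence "star \<one> = \<one>" by (simp add: star_closed star_star)
  hence "N \<one> = (N \<one>)\<^sup>2" using N_cstar[of \<one>] by simp
  hence "N \<one> = 0 \<or> N \<one> = 1" by (simp add: power2_eq_square)
  thus ?thesis by auto
qed

lemma N_isometry_le:
  assumes v: "v \<in> carrier A" and iso: "N (star v \<otimes> v \<ominus> \<one>) = 0"
  shows "N v \<le> 1"
proof -
  have c: "star v \<otimes> v \<in> carrier A" using v star_closed by simp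
  have "(N v)\<^sup>2 \<le> 1"
    using N_abs_diff[OF c one_closed] iso N_one N_cstar[OF v] by simp
  thus ?thesis using power2_le_imp_le[of "N v" 1] by simp
qed

lemma N_proj_le:
  assumes e: "e \<in> carrier A" and sa: "N (star e \<ominus> e) = 0" and idem: "N (e \<otimes> e \<ominus> e) = 0"
  shows "N e \<le> 1"
proof -
  have c: "star e \<in> carrier A" using e star_closed by simp
  have "star e \<otimes> e \<ominus> e \<otimes> e = (star e \<ominus> e) \<otimes> e"
    using e c unfolding a_minus_def by algebra
  hence "N (star e \<otimes> e \<ominus> e \<otimes> e) \<le> 0"
    using N_mult[of "star e \<ominus> e" e] e c sa by simp
  moreover have "\<bar>N (star e \<otimes> e) - N (e \<otimes> e)\<bar> \<le> N (star e \<otimes> e \<ominus> e \<otimes> e)"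
    "\<bar>N (e \<otimes> e) - N e\<bar> \<le> N (e \<otimes> e \<ominus> e)"
    using e c by (simp_all add: N_abs_diff)
  ultimately have "(N e)\<^sup>2 = N e" using N_cstar[OF e] idem by simp
  hence "N e = 0 \<or> N e = 1" by (simp add: power2_eq_square)
  thus ?thesis by auto
qed

end

lemma words_Nil [simp]: "[] \<in> words P"
  by (simp add: words_def)

lemma words_Cons2 [simp]: "p # q # \<alpha> \<in> words P \<longleftrightarrow> p \<in> P \<and> q \<in> P \<and> \<alpha> \<in> words P"
  by (auto simp: words_def)

lemma words_induct [consumes 1, case_names Nil Cons2]:
  assumes "\<alpha> \<in> words P" "Q []"
    "\<And>p q \<beta>. p \<in> P \<Longrightarrow> q \<in> P \<Longrightarrow> \<beta> \<in> words P \<Longrightarrow> Q \<beta> \<Longrightarrow> Q (p # q # \<beta>)"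
  shows "Q \<alpha>"
  using assms(1)
proof (induction "length \<alpha>" arbitrary: \<alpha> rule: less_induct)
  case less
  show ?case
  proof (cases \<alpha>)
    case Nil
    thus ?thesis using assms(2) by simp
  next
    case (Cons p \<alpha>')
    hence "\<alpha>' \<noteq> []" using less.prems by (auto simp: words_def)
    then obtain q \<beta> where \<alpha>: "\<alpha> = p # q # \<beta>" using Cons by (cases \<alpha>') auto
    hence "p \<in> P" "q \<in> P" "\<beta> \<in> words P" using less.prems by simp_all
    moreover from this have "Q \<beta>" using less.hyps[of \<beta>] \<alpha> by simp
    ultimately show ?thesis using assms(3) \<alpha> by simp
  qed
qed

lemma neutral_words_words: "\<alpha> \<in> neutral_words G P \<Longrightarrow> \<alpha> \<in> words P"
  by (simp add: neutral_words_def)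

lemma (in unital_star_algebra) word_op_closed:
  assumes "\<And>p. p \<in> P \<Longrightarrow> w p \<in> carrier A" "\<alpha> \<in> words P"
  shows "word_op A w \<alpha> \<in> carrier A"
  using assms(2) by (induction rule: words_induct) (use assms(1) in \<open>simp_all add: star_closed\<close>)

locale star_algebra_hom = A: unital_star_algebra A + B: unital_star_algebra B
  for A (structure) and B (structure) +
  fixes h
  assumes hom: "h \<in> star_hom A B"
begin

lemma h_simps:
  "x \<in> carrier A \<Longrightarrow> h x \<in> carrier B"
  "x \<in> carrier A \<Longrightarrow> y \<in> carrier A \<Longrightarrow> h (x \<otimes>\<^bsub>A\<^esub> y) = h x \<otimes>\<^bsub>B\<^esub> h y"
  "x \<in> carrier A \<Longrightarrow> y \<in> carrier A \<Longrightarrow> h (x \<oplus>\<^bsub>A\<^esub> y) = h x \<oplus>\<^bsub>B\<^esub> h y"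
  "h \<one>\<^bsub>A\<^esub> = \<one>\<^bsub>B\<^esub>"
  "x \<in> carrier A \<Longrightarrow> h (star\<^bsub>A\<^esub> x) = star\<^bsub>B\<^esub> (h x)"
  using hom by (auto simp: star_hom_def ring_hom_def)

lemma h_minus: "x \<in> carrier A \<Longrightarrow> y \<in> carrier A \<Longrightarrow> h (x \<ominus>\<^bsub>A\<^esub> y) = h x \<ominus>\<^bsub>B\<^esub> h y"
proof -
  assume xy: "x \<in> carrier A" "y \<in> carrier A"
  have "h (x \<ominus>\<^bsub>A\<^esub> y) \<oplus>\<^bsub>B\<^esub> h y = h ((x \<ominus>\<^bsub>A\<^esub> y) \<oplus>\<^bsub>A\<^esub> y)" using xy by (simp add: h_simps)
  also have "(x \<ominus>\<^bsub>A\<^esub> y) \<oplus>\<^bsub>A\<^esub> y = x" using xy unfolding a_minus_def by algebra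
  finally have e: "h (x \<ominus>\<^bsub>A\<^esub> y) \<oplus>\<^bsub>B\<^esub> h y = h x" .
  have "b = (b \<oplus>\<^bsub>B\<^esub> c) \<ominus>\<^bsub>B\<^esub> c" if "b \<in> carrier B" "c \<in> carrier B" for b c
    using that by (simp add: a_minus_def B.add.m_assoc B.r_neg)
  from this[of "h (x \<ominus>\<^bsub>A\<^esub> y)" "h y"]
  have "h (x \<ominus>\<^bsub>A\<^esub> y) = (h (x \<ominus>\<^bsub>A\<^esub> y) \<oplus>\<^bsub>B\<^esub> h y) \<ominus>\<^bsub>B\<^esub> h y"
    using xy h_simps(1) by simp
  thus ?thesis unfolding e .
qed

lemma h_word_op:
  assumes w: "\<And>p. p \<in> P \<Longrightarrow> w p \<in> carrier A" "\<And>p. p \<in> P \<Longrightarrow> h (w p) = w' p" and \<alpha>: "\<alpha> \<in> words P"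
  shows "h (word_op A w \<alpha>) = word_op B w' \<alpha>"
  using \<alpha>
proof (induction rule: words_induct)
  case (Cons2 p q \<beta>)
  thus ?case
    using w A.word_op_closed[of P w \<beta>, OF w(1) Cons2(3)] by (simp add: h_simps A.star_closed)
qed (simp add: h_simps)

lemma foldr_diff_closed:
  assumes "a \<in> carrier A" "\<And>\<beta>. \<beta> \<in> set \<beta>s \<Longrightarrow> f \<beta> \<in> carrier A"
  shows "foldr (\<otimes>\<^bsub>A\<^esub>) (map (\<lambda>\<beta>. a \<ominus>\<^bsub>A\<^esub> f \<beta>) \<beta>s) \<one>\<^bsub>A\<^esub> \<in> carrier A"
  using assms(2) by (induction \<beta>s) (use assms(1) in auto)

lemma h_foldr:
  assumes "a \<in> carrier A" "h a = a'" "\<And>\<beta>. \<beta> \<in> set \<beta>s \<Longrightarrow> f \<beta> \<in> carrier A"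
    "\<And>\<beta>. \<beta> \<in> set \<beta>s \<Longrightarrow> h (f \<beta>) = f' \<beta>"
  shows "h (foldr (\<otimes>\<^bsub>A\<^esub>) (map (\<lambda>\<beta>. a \<ominus>\<^bsub>A\<^esub> f \<beta>) \<beta>s) \<one>\<^bsub>A\<^esub>) =
    foldr (\<otimes>\<^bsub>B\<^esub>) (map (\<lambda>\<beta>. a' \<ominus>\<^bsub>B\<^esub> f' \<beta>) \<beta>s) \<one>\<^bsub>B\<^esub>"
  using assms(3,4)
proof (induction \<beta>s)
  case (Cons \<beta> \<beta>s)
  thus ?case using assms(1,2) foldr_diff_closed[of a \<beta>s f] by (simp add: h_simps h_minus)
qed (simp add: h_simps)

end

lemma star_algebra_homI:
  "unital_star_algebra A \<Longrightarrow> unital_star_algebra B \<Longrightarrow> h \<in> star_hom A B \<Longrightarrow> star_algebra_hom A B h"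
  by (intro star_algebra_hom.intro star_algebra_hom_axioms.intro)

lemma (in bounded_presentation) incl_relator:
  assumes "r \<in> R"
  shows "completion_incl FA US r = \<zero>\<^bsub>universal_cstar X R\<^esub>"
proof -
  interpret A: seminormed_star_algebra FA US by (rule US_seminormed)
  show ?thesis
    unfolding universal_cstar_def
    using A.incl_zero US_relator[OF assms] relators assms by auto
qed

lemma (in bounded_presentation) incl_star_hom:
  "star_algebra_hom FA (universal_cstar X R) (completion_incl FA US)"
proof -
  interpret A: seminormed_star_algebra FA US by (rule US_seminormed)
  show ?thesis
    unfolding universal_cstar_def
    by (intro star_algebra_homI free_unital_star_algebra A.AC_star_algebra A.incl_hom)
qed

locale submonoid_of_group = group G + submonoid P G for G (structure) and P
begin

lemma li_relators_hom:
  assumes "star_algebra_hom A B h"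
    and v: "\<And>p. p \<in> P \<Longrightarrow> v p \<in> carrier A" "\<And>p. p \<in> P \<Longrightarrow> h (v p) = v' p"
    and e: "\<And>S. S \<in> constr_ideals G P \<union> {{}} \<Longrightarrow> e S \<in> carrier A"
      "\<And>S. S \<in> constr_ideals G P \<union> {{}} \<Longrightarrow> h (e S) = e' S"
  shows "li_relators G P A v e \<subseteq> carrier A"
    and "h ` li_relators G P A v e = li_relators G P B v' e'"
proof -
  interpret star_algebra_hom A B h by fact
  note w = A.word_op_closed[of P v, OF v(1) neutral_words_words[where G = G]]
  note hw = h_word_op[of P v v', OF v neutral_words_words[where G = G]]
  show "li_relators G P A v e \<subseteq> carrier A"
    unfolding li_relators_def
    using v(1) e(1) w by (auto simp: A.star_closed m_closed)
  have "h ` {star\<^bsub>A\<^esub> (v p) \<otimes>\<^bsub>A\<^esub> v p \<ominus>\<^bsub>A\<^esub> \<one>\<^bsub>A\<^esub> | p. p \<in> P} =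
      {star\<^bsub>B\<^esub> (v' p) \<otimes>\<^bsub>B\<^esub> v' p \<ominus>\<^bsub>B\<^esub> \<one>\<^bsub>B\<^esub> | p. p \<in> P}"
    unfolding Setcompr_eq_image image_image
    by (intro image_cong refl) (use v in \<open>simp add: h_minus h_simps A.star_closed\<close>)
  moreover have "h ` {star\<^bsub>A\<^esub> (e S) \<ominus>\<^bsub>A\<^esub> e S | S. S \<in> constr_ideals G P \<union> {{}}} =
      {star\<^bsub>B\<^esub> (e' S) \<ominus>\<^bsub>B\<^esub> e' S | S. S \<in> constr_ideals G P \<union> {{}}}"
    unfolding Setcompr_eq_image image_image
    by (intro image_cong refl) (use e in \<open>simp add: h_minus h_simps A.star_closed\<close>)
  moreover have "h ` {e S \<otimes>\<^bsub>A\<^esub> e S \<ominus>\<^bsub>A\<^esub> e S | S. S \<in> constr_ideals G P \<union> {{}}} =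
      {e' S \<otimes>\<^bsub>B\<^esub> e' S \<ominus>\<^bsub>B\<^esub> e' S | S. S \<in> constr_ideals G P \<union> {{}}}"
    unfolding Setcompr_eq_image image_image
    by (intro image_cong refl) (use e in \<open>simp add: h_minus h_simps\<close>)
  moreover have "h ` {v p \<otimes>\<^bsub>A\<^esub> v q \<ominus>\<^bsub>A\<^esub> v (p \<otimes> q) | p q. p \<in> P \<and> q \<in> P} =
      {v' p \<otimes>\<^bsub>B\<^esub> v' q \<ominus>\<^bsub>B\<^esub> v' (p \<otimes> q) | p q. p \<in> P \<and> q \<in> P}"
  proof -
    have *: "{f p q | p q. p \<in> P \<and> q \<in> P} = (\<lambda>(p, q). f p q) ` (P \<times> P)" for f :: "'a \<Rightarrow> 'a \<Rightarrow> 'z"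
      by auto
    show ?thesis
      unfolding * image_image
      by (intro image_cong refl) (use v in \<open>auto simp: h_minus h_simps m_closed\<close>)
  qed
  moreover have "h ` {e {}} = {e' {}}" using e(2)[of "{}"] by simp
  moreover have "h ` {word_op A v \<alpha> \<ominus>\<^bsub>A\<^esub> e S | \<alpha> S.
        S \<in> constr_ideals G P \<and> \<alpha> \<in> neutral_words G P \<and> constr_ideal G P \<alpha> = S} =
      {word_op B v' \<alpha> \<ominus>\<^bsub>B\<^esub> e' S | \<alpha> S.
        S \<in> constr_ideals G P \<and> \<alpha> \<in> neutral_words G P \<and> constr_ideal G P \<alpha> = S}"
  proof -
    have *: "{f \<alpha> S | \<alpha> S. S \<in> constr_ideals G P \<and> \<alpha> \<in> neutral_words G P \<and> constr_ideal G P \<alpha> = S} =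
        (\<lambda>\<alpha>. f \<alpha> (constr_ideal G P \<alpha>)) ` neutral_words G P" for f :: "'a list \<Rightarrow> 'a set \<Rightarrow> 'z"
      by (auto simp: constr_ideals_def neutral_words_def)
    have J: "constr_ideal G P \<alpha> \<in> constr_ideals G P \<union> {{}}" if "\<alpha> \<in> neutral_words G P" for \<alpha>
      using that by (auto simp: constr_ideals_def neutral_words_def)
    show ?thesis
      unfolding * image_image
      by (intro image_cong refl, subst h_minus) (use e(1)[OF J] e(2)[OF J] w hw in simp_all)
  qed
  ultimately show "h ` li_relators G P A v e = li_relators G P B v' e'"
    unfolding li_relators_def image_Un by (simp only:)
qed

lemma toeplitz_relators_hom:
  assumes "star_algebra_hom A B h"
    and t: "\<And>p. p \<in> P \<Longrightarrow> t p \<in> carrier A" "\<And>p. p \<in> P \<Longrightarrow> h (t p) = t' p"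
  shows "toeplitz_relators G P A t \<subseteq> carrier A"
    and "h ` toeplitz_relators G P A t = toeplitz_relators G P B t'"
proof -
  interpret star_algebra_hom A B h by fact
  let ?W = "neutral_words G P"
  note w = A.word_op_closed[of P t, OF t(1) neutral_words_words[where G = G]]
  note hw = h_word_op[of P t t', OF t neutral_words_words[where G = G]]
  have fc: "foldr (\<otimes>\<^bsub>A\<^esub>) (map (\<lambda>\<beta>. word_op A t \<alpha> \<ominus>\<^bsub>A\<^esub> word_op A t \<beta>) \<beta>s) \<one>\<^bsub>A\<^esub> \<in> carrier A"
    if "\<alpha> \<in> ?W" "set \<beta>s \<subseteq> ?W" for \<alpha> \<beta>s
    by (rule foldr_diff_closed) (use that w in auto)
  show "toeplitz_relators G P A t \<subseteq> carrier A"
    unfolding toeplitz_relators_def using t(1) w fc by auto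
  have "h ` {t \<one> \<ominus>\<^bsub>A\<^esub> \<one>\<^bsub>A\<^esub>} = {t' \<one> \<ominus>\<^bsub>B\<^esub> \<one>\<^bsub>B\<^esub>}"
    using t by (simp add: h_minus h_simps)
  moreover have "h ` {word_op A t \<alpha> | \<alpha>. \<alpha> \<in> ?W \<and> constr_ideal G P \<alpha> = {}} =
      {word_op B t' \<alpha> | \<alpha>. \<alpha> \<in> ?W \<and> constr_ideal G P \<alpha> = {}}"
  proof -
    have *: "{f \<alpha> | \<alpha>. \<alpha> \<in> ?W \<and> constr_ideal G P \<alpha> = {}} =
        f ` {\<alpha> \<in> ?W. constr_ideal G P \<alpha> = {}}" for f :: "'a list \<Rightarrow> 'z"
      by auto
    show ?thesis
      unfolding * image_image by (intro image_cong refl) (use hw in auto)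
  qed
  moreover have "h ` {word_op A t \<alpha> \<ominus>\<^bsub>A\<^esub> word_op A t \<beta> | \<alpha> \<beta>. \<alpha> \<in> ?W \<and>
        \<beta> \<in> ?W \<and> constr_ideal G P \<alpha> = constr_ideal G P \<beta>} =
      {word_op B t' \<alpha> \<ominus>\<^bsub>B\<^esub> word_op B t' \<beta> | \<alpha> \<beta>. \<alpha> \<in> ?W \<and>
        \<beta> \<in> ?W \<and> constr_ideal G P \<alpha> = constr_ideal G P \<beta>}"
  proof -
    let ?D = "{(\<alpha>, \<beta>). \<alpha> \<in> ?W \<and> \<beta> \<in> ?W \<and> constr_ideal G P \<alpha> = constr_ideal G P \<beta>}"
    have *: "{f \<alpha> \<beta> | \<alpha> \<beta>. \<alpha> \<in> ?W \<and> \<beta> \<in> ?W \<and> constr_ideal G P \<alpha> = constr_ideal G P \<beta>} =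
        (\<lambda>(\<alpha>, \<beta>). f \<alpha> \<beta>) ` ?D" for f :: "'a list \<Rightarrow> 'a list \<Rightarrow> 'z"
      by auto
    show ?thesis
      unfolding * image_image by (intro image_cong refl) (use w hw in \<open>auto simp: h_minus\<close>)
  qed
  moreover have "h ` {foldr (\<otimes>\<^bsub>A\<^esub>) (map (\<lambda>\<beta>. word_op A t \<alpha> \<ominus>\<^bsub>A\<^esub> word_op A t \<beta>) \<beta>s) \<one>\<^bsub>A\<^esub> | \<alpha> \<beta>s.
        \<alpha> \<in> ?W \<and> \<beta>s \<noteq> [] \<and> distinct \<beta>s \<and> set \<beta>s \<subseteq> ?W \<and>
        constr_ideal G P \<alpha> = (\<Union>\<beta>\<in>set \<beta>s. constr_ideal G P \<beta>)} =
      {foldr (\<otimes>\<^bsub>B\<^esub>) (map (\<lambda>\<beta>. word_op B t' \<alpha> \<ominus>\<^bsub>B\<^esub> word_op B t' \<beta>) \<beta>s) \<one>\<^bsub>B\<^esub> | \<alpha> \<beta>s.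
        \<alpha> \<in> ?W \<and> \<beta>s \<noteq> [] \<and> distinct \<beta>s \<and> set \<beta>s \<subseteq> ?W \<and>
        constr_ideal G P \<alpha> = (\<Union>\<beta>\<in>set \<beta>s. constr_ideal G P \<beta>)}"
  proof -
    let ?Q = "\<lambda>\<alpha> \<beta>s. \<alpha> \<in> ?W \<and> \<beta>s \<noteq> [] \<and> distinct \<beta>s \<and> set \<beta>s \<subseteq> ?W \<and>
        constr_ideal G P \<alpha> = (\<Union>\<beta>\<in>set \<beta>s. constr_ideal G P \<beta>)"
    have *: "{f \<alpha> \<beta>s | \<alpha> \<beta>s. ?Q \<alpha> \<beta>s} = (\<lambda>(\<alpha>, \<beta>s). f \<alpha> \<beta>s) ` {(\<alpha>, \<beta>s). ?Q \<alpha> \<beta>s}"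
      for f :: "'a list \<Rightarrow> 'a list list \<Rightarrow> 'z"
      by auto
    have "h (foldr (\<otimes>\<^bsub>A\<^esub>) (map (\<lambda>\<beta>. word_op A t \<alpha> \<ominus>\<^bsub>A\<^esub> word_op A t \<beta>) \<beta>s) \<one>\<^bsub>A\<^esub>) =
        foldr (\<otimes>\<^bsub>B\<^esub>) (map (\<lambda>\<beta>. word_op B t' \<alpha> \<ominus>\<^bsub>B\<^esub> word_op B t' \<beta>) \<beta>s) \<one>\<^bsub>B\<^esub>"
      if "?Q \<alpha> \<beta>s" for \<alpha> \<beta>s
      by (rule h_foldr) (use that w hw in auto)
    thus ?thesis
      unfolding * image_image by (intro image_cong refl) auto
  qed
  ultimately show "h ` toeplitz_relators G P A t = toeplitz_relators G P B t'"
    unfolding toeplitz_relators_def image_Un by (simp only:)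
qed

lemma constr_ideal_square:
  assumes "p \<in> P"
  shows "constr_ideal G P [p, p] = P"
proof -
  have 1: "\<one> <# P = P" using subset by (force simp: l_coset_def)
  have "{0..(1::nat)} = {0, 1}" by auto
  thus ?thesis using assms 1 by (simp add: constr_ideal_def)
qed

lemma constr_ideal_Nil: "constr_ideal G P [] = P"
proof -
  have 1: "\<one> <# P = P" using subset by (force simp: l_coset_def)
  thus ?thesis by (simp add: constr_ideal_def)
qed

end


section \<open>Universal properties of the two algebras\<close>

context submonoid_of_group begin

lemma poly_val_hom:
  assumes "unital_star_algebra B" "\<And>x. g x \<in> carrier B"
  shows "star_algebra_hom (free_star_algebra X) B (poly_val B g)"
    and "poly_val B g (poly_gen x) = g x"
proof -
  interpret star_poly_evaluation B g
    using assms by (simp add: star_poly_evaluation_def star_poly_evaluation_axioms_def)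
  show "star_algebra_hom (free_star_algebra X) B (poly_val B g)"
    by (intro star_algebra_homI free_unital_star_algebra assms(1) pval_hom)
  show "poly_val B g (poly_gen x) = g x" by (rule pval_gen)
qed

lemma free_id_hom: "star_algebra_hom (free_star_algebra X) (free_star_algebra X) (\<lambda>x. x)"
  by (intro star_algebra_homI free_unital_star_algebra) (simp add: star_hom_def ring_hom_def)

lemma li_relators_isom:
  "p \<in> P \<Longrightarrow> star\<^bsub>A\<^esub> (v p) \<otimes>\<^bsub>A\<^esub> v p \<ominus>\<^bsub>A\<^esub> \<one>\<^bsub>A\<^esub> \<in> li_relators G P A v e"
  unfolding li_relators_def by (intro UnI1) blast

lemma li_relators_sa:
  "S \<in> constr_ideals G P \<union> {{}} \<Longrightarrow> star\<^bsub>A\<^esub> (e S) \<ominus>\<^bsub>A\<^esub> e S \<in> li_relators G P A v e"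
  unfolding li_relators_def by (rule UnI1, rule UnI1, rule UnI1, rule UnI1, rule UnI2) blast

lemma li_relators_idem:
  "S \<in> constr_ideals G P \<union> {{}} \<Longrightarrow> e S \<otimes>\<^bsub>A\<^esub> e S \<ominus>\<^bsub>A\<^esub> e S \<in> li_relators G P A v e"
  unfolding li_relators_def by (rule UnI1, rule UnI1, rule UnI1, rule UnI2) blast

lemma li_presentation: "bounded_presentation (li_gens G P) (li_rels G P)"
proof
  show sub: "li_rels G P \<subseteq> carrier (free_star_algebra (li_gens G P))"
    unfolding li_rels_def
    by (rule li_relators_hom(1)[OF free_id_hom]) (auto simp: li_gens_def intro!: poly_gen_carrier)
  fix x assume x: "x \<in> li_gens G P"
  have "N (poly_gen x) \<le> 1" if N: "N \<in> admissible_seminorms (li_gens G P) (li_rels G P)" for N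
  proof -
    interpret seminormed_star_algebra "free_star_algebra (li_gens G P)" N
      using N free_unital_star_algebra
      by (auto simp: admissible_seminorms_def seminormed_star_algebra_def seminormed_star_algebra_axioms_def)
    have z: "N r = 0" if "r \<in> li_rels G P" for r
      using that N by (auto simp: admissible_seminorms_def)
    from x consider p where "x = Isom p" "p \<in> P"
      | S where "x = Proj S" "S \<in> constr_ideals G P \<union> {{}}"
      by (auto simp: li_gens_def)
    thus ?thesis
    proof cases
      case 1
      show ?thesis
        using N_isometry_le[OF poly_gen_carrier[OF x]] z
          li_relators_isom[OF 1(2), where A = "free_star_algebra (li_gens G P)" and v = "\<lambda>p. poly_gen (Isom p)"]
        unfolding li_rels_def 1(1) by blast
    next
      case 2
      show ?thesis
        using N_proj_le[OF poly_gen_carrier[OF x]] z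
          li_relators_sa[OF 2(2), where A = "free_star_algebra (li_gens G P)" and e = "\<lambda>S. poly_gen (Proj S)"]
          li_relators_idem[OF 2(2), where A = "free_star_algebra (li_gens G P)" and e = "\<lambda>S. poly_gen (Proj S)"]
        unfolding li_rels_def 2(1) by blast
    qed
  qed
  thus "\<exists>C. \<forall>N\<in>admissible_seminorms (li_gens G P) (li_rels G P). N (poly_gen x) \<le> C" by blast
qed

lemma toeplitz_presentation: "bounded_presentation P (toeplitz_rels G P)"
proof
  show sub: "toeplitz_rels G P \<subseteq> carrier (free_star_algebra P)"
    unfolding toeplitz_rels_def
    by (rule toeplitz_relators_hom(1)[OF free_id_hom]) (auto intro!: poly_gen_carrier)
  fix p assume p: "p \<in> P"
  have "N (poly_gen p) \<le> 1" if N: "N \<in> admissible_seminorms P (toeplitz_rels G P)" for N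
  proof -
    interpret F: seminormed_star_algebra "free_star_algebra P" N
      using N free_unital_star_algebra
      by (auto simp: admissible_seminorms_def seminormed_star_algebra_def seminormed_star_algebra_axioms_def)
    let ?F = "free_star_algebra P"
    have z: "N r = 0" if "r \<in> toeplitz_rels G P" for r
      using that N by (auto simp: admissible_seminorms_def)
    have "[p, p] \<in> neutral_words G P" "[] \<in> neutral_words G P"
      using p by (simp_all add: neutral_words_def words_def)
    moreover have "constr_ideal G P [p, p] = constr_ideal G P []"
      using p by (simp add: constr_ideal_square constr_ideal_Nil)
    ultimately have "word_op ?F poly_gen [p, p] \<ominus>\<^bsub>?F\<^esub> word_op ?F poly_gen [] \<in> toeplitz_rels G P"
      unfolding toeplitz_rels_def toeplitz_relators_def by blast
    hence "star\<^bsub>?F\<^esub> (poly_gen p) \<otimes>\<^bsub>?F\<^esub> poly_gen p \<ominus>\<^bsub>?F\<^esub> \<one>\<^bsub>?F\<^esub> \<in> toeplitz_rels G P"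
      by simp
    from F.N_isometry_le[OF poly_gen_carrier[OF p] z[OF this]] show ?thesis .
  qed
  thus "\<exists>C. \<forall>N\<in>admissible_seminorms P (toeplitz_rels G P). N (poly_gen p) \<le> C" by blast
qed

lemma li_algebra_cstar: "unital_cstar_algebra (li_algebra G P)"
  unfolding li_algebra_def by (rule bounded_presentation.universal_cstar[OF li_presentation])

lemma toeplitz_algebra_cstar: "unital_cstar_algebra (toeplitz_algebra G P)"
  unfolding toeplitz_algebra_def by (rule bounded_presentation.universal_cstar[OF toeplitz_presentation])

lemma li_algebra_relations:
  "li_relators G P (li_algebra G P) (li_isom G P) (li_proj G P) = {\<zero>\<^bsub>li_algebra G P\<^esub>}"
proof -
  interpret bounded_presentation "li_gens G P" "li_rels G P" by (rule li_presentation)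
  have "completion_incl FA US ` li_rels G P =
      li_relators G P (universal_cstar (li_gens G P) (li_rels G P)) (li_isom G P) (li_proj G P)"
    unfolding li_rels_def[of G P, THEN arg_cong[where f = "(`) (completion_incl FA US)"]]
    by (rule li_relators_hom(2)[OF incl_star_hom])
      (auto simp: li_gens_def li_isom_def li_proj_def universal_gen_def intro!: poly_gen_carrier)
  moreover have "li_rels G P \<noteq> {}" by (auto simp: li_rels_def li_relators_def)
  ultimately show ?thesis
    unfolding li_algebra_def using incl_relator by (metis (no_types, lifting) image_cong image_constant_conv)
qed

lemma toeplitz_algebra_relations:
  "toeplitz_relators G P (toeplitz_algebra G P) (toeplitz_gen G P) = {\<zero>\<^bsub>toeplitz_algebra G P\<^esub>}"
proof -
  interpret bounded_presentation P "toeplitz_rels G P" by (rule toeplitz_presentation)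
  have "completion_incl FA US ` toeplitz_rels G P =
      toeplitz_relators G P (universal_cstar P (toeplitz_rels G P)) (toeplitz_gen G P)"
    unfolding toeplitz_rels_def[of G P, THEN arg_cong[where f = "(`) (completion_incl FA US)"]]
    by (rule toeplitz_relators_hom(2)[OF incl_star_hom])
      (auto simp: toeplitz_gen_def universal_gen_def intro!: poly_gen_carrier)
  moreover have "toeplitz_rels G P \<noteq> {}" by (auto simp: toeplitz_rels_def toeplitz_relators_def)
  ultimately show ?thesis
    unfolding toeplitz_algebra_def using incl_relator by (metis (no_types, lifting) image_cong image_constant_conv)
qed

lemma li_algebra_universal:
  assumes "unital_cstar_algebra B" "v \<in> P \<rightarrow> carrier B" "e \<in> constr_ideals G P \<union> {{}} \<rightarrow> carrier B"
    and rel: "li_relators G P B v e \<subseteq> {\<zero>\<^bsub>B\<^esub>}"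
  shows "\<exists>\<phi>\<in>star_hom (li_algebra G P) B. (\<forall>p\<in>P. \<phi> (li_isom G P p) = v p) \<and>
    (\<forall>S\<in>constr_ideals G P \<union> {{}}. \<phi> (li_proj G P S) = e S)"
proof -
  interpret B: unital_cstar_algebra B by fact
  interpret bounded_presentation "li_gens G P" "li_rels G P" by (rule li_presentation)
  define g where "g x = (if x \<in> li_gens G P then case x of Isom p \<Rightarrow> v p | Proj S \<Rightarrow> e S else \<zero>\<^bsub>B\<^esub>)" for x
  have gi: "g (Isom p) = v p" if "p \<in> P" for p using that by (auto simp: g_def li_gens_def)
  have gp: "g (Proj S) = e S" if "S \<in> constr_ideals G P \<union> {{}}" for S
    using that by (auto simp: g_def li_gens_def)
  have g: "g x \<in> carrier B" for x
    using assms(2,3) by (auto simp: g_def li_gens_def)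
  note h = poly_val_hom[OF B.unital_star_algebra_axioms g]
  have "poly_val B g ` li_rels G P = li_relators G P B v e"
    unfolding li_rels_def
    by (rule li_relators_hom(2)[OF h(1)]) (auto simp: li_gens_def h(2) gi gp intro!: poly_gen_carrier)
  hence z: "poly_val B g r = \<zero>\<^bsub>B\<^esub>" if "r \<in> li_rels G P" for r using that rel by blast
  from universal_property[OF assms(1) star_algebra_hom.hom[OF h(1)] z]
  obtain \<phi> where "\<phi> \<in> star_hom (li_algebra G P) B"
    "\<forall>x\<in>li_gens G P. \<phi> (universal_gen (li_gens G P) (li_rels G P) x) = g x"
    unfolding li_algebra_def h(2) by blast
  thus ?thesis
    unfolding li_isom_def li_proj_def using gi gp by (intro bexI[of _ \<phi>]) (simp_all add: li_gens_def)
qed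

lemma toeplitz_algebra_universal:
  assumes "unital_cstar_algebra B" "t \<in> P \<rightarrow> carrier B"
    and rel: "toeplitz_relators G P B t \<subseteq> {\<zero>\<^bsub>B\<^esub>}"
  shows "\<exists>\<phi>\<in>star_hom (toeplitz_algebra G P) B. \<forall>p\<in>P. \<phi> (toeplitz_gen G P p) = t p"
proof -
  interpret B: unital_cstar_algebra B by fact
  interpret bounded_presentation P "toeplitz_rels G P" by (rule toeplitz_presentation)
  define g where "g x = (if x \<in> P then t x else \<zero>\<^bsub>B\<^esub>)" for x
  have gt: "g p = t p" if "p \<in> P" for p using that by (simp add: g_def)
  have g: "g x \<in> carrier B" for x using assms(2) by (auto simp: g_def)
  note h = poly_val_hom[OF B.unital_star_algebra_axioms g]
  have "poly_val B g ` toeplitz_rels G P = toeplitz_relators G P B t"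
    unfolding toeplitz_rels_def
    by (rule toeplitz_relators_hom(2)[OF h(1)]) (simp_all add: h(2) gt poly_gen_carrier)
  hence z: "poly_val B g r = \<zero>\<^bsub>B\<^esub>" if "r \<in> toeplitz_rels G P" for r using that rel by blast
  from universal_property[OF assms(1) star_algebra_hom.hom[OF h(1)] z]
  obtain \<phi> where "\<phi> \<in> star_hom (toeplitz_algebra G P) B"
    "\<forall>x\<in>P. \<phi> (universal_gen P (toeplitz_rels G P) x) = g x"
    unfolding toeplitz_algebra_def h(2) by blast
  thus ?thesis
    unfolding toeplitz_gen_def using gt by (intro bexI[of _ \<phi>]) simp_all
qed

end

end

theory Submission
  imports Defs "HOL-Algebra.Multiplicative_Group" "HOL-Analysis.L2_Norm"
begin

text \<open>In both algebras the operators \<open>w\<^sub>\<alpha>\<close> of neutral words \<open>\<alpha>\<close> are commuting projections, and they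
  generate a Boolean algebra that is stable under \<open>x \<mapsto> w\<^sub>p\<^sup>* x w\<^sub>p\<close> and \<open>x \<mapsto> w\<^sub>p x w\<^sub>p\<^sup>*\<close>.  Hence the
  projections of this Boolean algebra killed by \<open>\<Lambda>\<close> generate a two-sided ideal of \<open>C\<^sup>*\<^sub>s(P)\<close> whose
  quotient norm satisfies the C*-identity by a direct computation, without functional calculus.  All
  relators (T1)-(T4) lie in that ideal, so its quotient norm is dominated by the norm of \<open>T\<^sub>u(P)\<close>, and
  Cauchy sequences lift along \<open>\<Lambda>\<close>.

  Under independence one factor of every product in (T4) vanishes already in \<open>C\<^sup>*\<^sub>s(P)\<close>, and the
  universal property of \<open>T\<^sub>u(P)\<close> provides the inverse of \<open>\<Lambda>\<close>.  If instead \<open>K(\<alpha>)\<close> is a finite union of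
  strictly smaller \<open>K(\<beta>)\<close>, translations on \<open>\<ell>\<^sup>2({g. g K(\<alpha>) \<subseteq> P})\<close> represent \<open>C\<^sup>*\<^sub>s(P)\<close>, and the
  product of the \<open>e\<^bsub>K(\<alpha>)\<^esub> - e\<^bsub>K(\<beta>)\<^esub>\<close>, which \<open>\<Lambda>\<close> kills, fixes the basis vector at the identity.\<close>

section \<open>Words and their ideals\<close>

text \<open>Both algebras are completions of a free star-algebra in its largest C*-seminorm that
  kills the relators. A seminorm with these two properties is therefore below the universal norm at
  once, and it need not come from a complete algebra. This is why the quotient of
  \<open>C*_s(P)\<close> occurs only as a seminorm on polynomials, and why the operators used for
  the converse act on finitely supported functions. The obstacle is surjectivity. The range of
  \<Lambda> contains all polynomials in the generators, so it is dense, but that it is closed is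
  usually deduced from spectral theory and from approximate units in ideals. Here the relators are
  commuting projections and their complements take the place of an approximate unit; contractivity
  is recorded with each homomorphism instead of being derived afterwards. Multiplicativity of the
  \<open>t_p\<close> is not among (T1)-(T4). It has to be recovered from neutral words before
  diagonal projections can be conjugated by generators.\<close>

context submonoid_of_group begin

lemma P_carrier [simp]: "p \<in> P \<Longrightarrow> p \<in> carrier G"
  using subset by blast

lemma words_append: "\<alpha> \<in> words P \<Longrightarrow> \<beta> \<in> words P \<Longrightarrow> \<alpha> @ \<beta> \<in> words P"
  by (auto simp: words_def)

lemma words_rev: "\<alpha> \<in> words P \<Longrightarrow> rev \<alpha> \<in> words P"
  by (simp add: words_def)

lemma word_eval_closed [simp]: "\<alpha> \<in> words P \<Longrightarrow> word_eval G \<alpha> \<in> carrier G"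
  by (induction rule: words_induct) auto

lemma word_eval_append:
  assumes "\<alpha> \<in> words P" "\<beta> \<in> words P"
  shows "word_eval G (\<alpha> @ \<beta>) = word_eval G \<alpha> \<otimes> word_eval G \<beta>"
  using assms(1) by (induction rule: words_induct) (simp_all add: assms(2) m_assoc)

lemma word_eval_rev: "\<alpha> \<in> words P \<Longrightarrow> word_eval G (rev \<alpha>) = inv (word_eval G \<alpha>)"
proof (induction rule: words_induct)
  case (Cons2 p q \<beta>)
  have "word_eval G (rev (p # q # \<beta>)) = word_eval G (rev \<beta>) \<otimes> word_eval G [q, p]"
    using Cons2 word_eval_append[of "rev \<beta>" "[q, p]"] by (simp add: words_rev)
  thus ?case using Cons2 by (simp add: inv_mult_group m_assoc)
qed simp

lemma l_coset_iff:
  assumes "g \<in> carrier G" "x \<in> carrier G"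
  shows "x \<in> g <# P \<longleftrightarrow> inv g \<otimes> x \<in> P"
proof
  show "inv g \<otimes> x \<in> P" if "x \<in> g <# P"
    using that assms by (auto simp: l_coset_def m_assoc[symmetric])
  show "x \<in> g <# P" if "inv g \<otimes> x \<in> P"
    using that assms by (force simp: l_coset_def m_assoc[symmetric])
qed

text \<open>The intersection is indexed by suffixes, so prefixing a pair only adds the index for the
  whole word. The inductions on words below use this recursion in place of the intersection.\<close>

lemma constr_ideal_Cons2:
  assumes "p \<in> P" "q \<in> P" "\<alpha> \<in> words P" "x \<in> carrier G"
  shows "x \<in> constr_ideal G P (p # q # \<alpha>) \<longleftrightarrow>
    x \<in> constr_ideal G P \<alpha> \<and> inv p \<otimes> (q \<otimes> (word_eval G \<alpha> \<otimes> x)) \<in> P"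
proof -
  have w: "p # q # \<alpha> \<in> words P" using assms by simp
  have "{0..Suc (length \<alpha> div 2)} = insert 0 (Suc ` {0..length \<alpha> div 2})"
    using atLeast0_atMost_Suc_eq_insert_0 by (simp add: atMost_atLeast0 del: image_Suc_atLeastAtMost)
  hence "constr_ideal G P (p # q # \<alpha>) =
      (word_eval G (rev (p # q # \<alpha>)) <# P) \<inter> constr_ideal G P \<alpha>"
    by (simp add: constr_ideal_def del: image_Suc_atLeastAtMost)
  thus ?thesis
    using l_coset_iff[of "word_eval G (rev (p # q # \<alpha>))" x] word_eval_closed[OF w] assms
    by (simp only: word_eval_rev[OF w] inv_inv inv_closed Int_iff) (auto simp: m_assoc)
qed

lemma constr_ideal_subset: "\<alpha> \<in> words P \<Longrightarrow> constr_ideal G P \<alpha> \<subseteq> P"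
proof -
  assume "\<alpha> \<in> words P"
  \<comment> \<open>The last index, whose suffix is empty, contributes \<open>P\<close>.\<close>
  hence "constr_ideal G P \<alpha> \<subseteq> word_eval G (rev (drop (2 * (length \<alpha> div 2)) \<alpha>)) <# P"
    unfolding constr_ideal_def by (intro INT_lower) simp
  thus ?thesis
    using \<open>\<alpha> \<in> words P\<close> constr_ideal_Nil by (simp add: words_def constr_ideal_def)
qed

lemma constr_ideal_carrier: "\<alpha> \<in> words P \<Longrightarrow> x \<in> constr_ideal G P \<alpha> \<Longrightarrow> x \<in> carrier G"
  using constr_ideal_subset P_carrier by blast

text \<open>A word acts from right to left as a partial translation of \<open>P\<close>, and its
  ideal is the domain; this is the domain of a composite. The case of an empty \<alpha> is not
  vacuous: it says that \<beta> maps its domain into \<open>P\<close>.\<close>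

lemma constr_ideal_append:
  assumes "\<alpha> \<in> words P" "\<beta> \<in> words P" "x \<in> carrier G"
  shows "x \<in> constr_ideal G P (\<alpha> @ \<beta>) \<longleftrightarrow>
    x \<in> constr_ideal G P \<beta> \<and> word_eval G \<beta> \<otimes> x \<in> constr_ideal G P \<alpha>"
  using assms(1)
proof (induction rule: words_induct)
  case Nil
  have "constr_ideal G P \<beta> \<subseteq> P" using assms by (rule_tac constr_ideal_subset)
  moreover have "word_eval G \<beta> \<otimes> x \<in> P" if "x \<in> constr_ideal G P \<beta>"
    using assms(2) that assms(3)
    by (induction rule: words_induct) (auto simp: constr_ideal_Nil constr_ideal_Cons2 m_assoc)
  ultimately show ?case by (auto simp: constr_ideal_Nil)
next
  case (Cons2 p q \<alpha>)
  thus ?case using assms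
    by (auto simp: constr_ideal_Cons2 words_append word_eval_append m_assoc)
qed

lemma word_eval_constr_ideal:
  assumes "\<alpha> \<in> words P" "x \<in> constr_ideal G P \<alpha>"
  shows "word_eval G \<alpha> \<otimes> x \<in> P"
  using constr_ideal_append[of "[]" \<alpha> x] assms constr_ideal_carrier[OF assms]
  by (simp add: constr_ideal_Nil)

text \<open>The reversed word is the inverse partial translation, so its domain is the range of the
  original one.\<close>

lemma constr_ideal_rev:
  assumes "\<alpha> \<in> words P" "x \<in> carrier G"
  shows "x \<in> constr_ideal G P (rev \<alpha>) \<longleftrightarrow> word_eval G (rev \<alpha>) \<otimes> x \<in> constr_ideal G P \<alpha>"
  using assms
proof (induction arbitrary: x rule: words_induct)
  case (Cons2 p q \<alpha>)
  let ?y = "inv q \<otimes> (p \<otimes> x)"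
  have r: "rev (p # q # \<alpha>) = rev \<alpha> @ [q, p]" by simp
  have e: "word_eval G (rev (p # q # \<alpha>)) \<otimes> x = inv (word_eval G \<alpha>) \<otimes> ?y"
    unfolding r using Cons2 by (simp add: word_eval_append words_rev word_eval_rev m_assoc)
  have c: "inv p \<otimes> (q \<otimes> (word_eval G \<alpha> \<otimes> (inv (word_eval G \<alpha>) \<otimes> ?y))) = x"
    using Cons2 by (simp add: m_assoc[symmetric])
  have "x \<in> constr_ideal G P (rev (p # q # \<alpha>)) \<longleftrightarrow>
      x \<in> P \<and> ?y \<in> P \<and> ?y \<in> constr_ideal G P (rev \<alpha>)"
    unfolding r using Cons2
    by (auto simp: constr_ideal_append words_rev constr_ideal_Cons2 constr_ideal_Nil m_assoc)
  also have "\<dots> \<longleftrightarrow> x \<in> P \<and> ?y \<in> constr_ideal G P (rev \<alpha>)"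
    using constr_ideal_subset[OF words_rev[OF Cons2(3)]] by blast
  also have "\<dots> \<longleftrightarrow> x \<in> P \<and> inv (word_eval G \<alpha>) \<otimes> ?y \<in> constr_ideal G P \<alpha>"
    using Cons2 by (simp add: word_eval_rev)
  also have "\<dots> \<longleftrightarrow> word_eval G (rev (p # q # \<alpha>)) \<otimes> x \<in> constr_ideal G P (p # q # \<alpha>)"
    unfolding e using Cons2 by (subst constr_ideal_Cons2) (auto simp: c)
  finally show ?case .
qed (simp add: constr_ideal_Nil)

lemma set_eqI_carrier:
  assumes "S \<subseteq> P" "T \<subseteq> P" "\<And>x. x \<in> carrier G \<Longrightarrow> x \<in> S \<longleftrightarrow> x \<in> T"
  shows "S = T"
  using assms P_carrier by blast

text \<open>Neutral words act as identities on their ideals, so composition intersects the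
  ideals.\<close>

lemma neutral_append:
  assumes "\<alpha> \<in> neutral_words G P" "\<beta> \<in> neutral_words G P"
  shows "\<alpha> @ \<beta> \<in> neutral_words G P"
    and "constr_ideal G P (\<alpha> @ \<beta>) = constr_ideal G P \<alpha> \<inter> constr_ideal G P \<beta>"
proof -
  have w: "\<alpha> \<in> words P" "\<beta> \<in> words P" "word_eval G \<beta> = \<one>"
    using assms by (auto simp: neutral_words_def)
  show "\<alpha> @ \<beta> \<in> neutral_words G P"
    using assms by (simp add: neutral_words_def words_append word_eval_append)
  show "constr_ideal G P (\<alpha> @ \<beta>) = constr_ideal G P \<alpha> \<inter> constr_ideal G P \<beta>"
    by (rule set_eqI_carrier) (use w constr_ideal_subset[of \<alpha>] constr_ideal_subset[of "\<alpha> @ \<beta>"] in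
        \<open>auto simp: constr_ideal_append words_append\<close>)
qed

lemma neutral_rev:
  assumes "\<alpha> \<in> neutral_words G P"
  shows "rev \<alpha> \<in> neutral_words G P" "constr_ideal G P (rev \<alpha>) = constr_ideal G P \<alpha>"
proof -
  have w: "\<alpha> \<in> words P" "word_eval G (rev \<alpha>) = \<one>"
    using assms by (auto simp: neutral_words_def word_eval_rev)
  show "rev \<alpha> \<in> neutral_words G P" using w by (simp add: neutral_words_def words_rev)
  show "constr_ideal G P (rev \<alpha>) = constr_ideal G P \<alpha>"
    by (rule set_eqI_carrier) (use w in \<open>simp_all add: constr_ideal_rev words_rev constr_ideal_subset\<close>)
qed

text \<open>A partial translation followed by its inverse is the identity on its domain. Hence
  restricting to neutral words loses no constructible ideal.\<close>

lemma neutral_square: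
  assumes "\<alpha> \<in> words P"
  shows "rev \<alpha> @ \<alpha> \<in> neutral_words G P" "constr_ideal G P (rev \<alpha> @ \<alpha>) = constr_ideal G P \<alpha>"
proof -
  show "rev \<alpha> @ \<alpha> \<in> neutral_words G P"
    using assms by (simp add: neutral_words_def words_append words_rev word_eval_append word_eval_rev)
  have "x \<in> constr_ideal G P (rev \<alpha> @ \<alpha>) \<longleftrightarrow> x \<in> constr_ideal G P \<alpha>" if "x \<in> carrier G" for x
    using assms that
    by (simp add: constr_ideal_append words_rev constr_ideal_rev word_eval_rev m_assoc[symmetric])
  thus "constr_ideal G P (rev \<alpha> @ \<alpha>) = constr_ideal G P \<alpha>"
    using assms by (intro set_eqI_carrier) (simp_all add: constr_ideal_subset words_append words_rev)
qed

lemma constr_ideals_neutral: "constr_ideals G P = constr_ideal G P ` neutral_words G P"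
proof
  show "constr_ideals G P \<subseteq> constr_ideal G P ` neutral_words G P"
    unfolding constr_ideals_def using neutral_square by (auto intro!: rev_image_eqI)
qed (auto simp: constr_ideals_def neutral_words_def)

end


section \<open>Star-algebras and their homomorphisms\<close>

text \<open>In contrast to \<open>star_poly_induct\<close>, all polynomials stay over the generators
  in \<open>X\<close>. Adjoints are needed at generators only, since every monomial is a product of
  letters.\<close>

lemma free_star_algebra_induct [consumes 1, case_names one gen adj smult add mult]:
  assumes f: "f \<in> carrier (free_star_algebra X)"
    and one: "Q 1"
    and gen: "\<And>x. x \<in> X \<Longrightarrow> Q (poly_gen x)"
    and adj: "\<And>x. x \<in> X \<Longrightarrow> Q (star_poly_adj (poly_gen x))"
    and smult: "\<And>c f. f \<in> carrier (free_star_algebra X) \<Longrightarrow> Q f \<Longrightarrow> Q (Poly_Mapping.single 0 c * f)"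
    and add: "\<And>f g. f \<in> carrier (free_star_algebra X) \<Longrightarrow> g \<in> carrier (free_star_algebra X) \<Longrightarrow>
      Q f \<Longrightarrow> Q g \<Longrightarrow> Q (f + g)"
    and mult: "\<And>f g. f \<in> carrier (free_star_algebra X) \<Longrightarrow> g \<in> carrier (free_star_algebra X) \<Longrightarrow>
      Q f \<Longrightarrow> Q g \<Longrightarrow> Q (f * g)"
  shows "Q f"
proof -
  have letter: "Q (Poly_Mapping.single (Monomial [l]) 1)" if "letter_base l \<in> X" for l
    using that gen adj
    by (cases l) (fastforce simp: poly_gen_def star_poly_adj_single monomial_adj_def)+
  have word: "Q (Poly_Mapping.single (Monomial ls) 1)" if "letter_base ` set ls \<subseteq> X" for ls
    using that
  proof (induction ls)
    case Nil
    show ?case using one by (simp flip: zero_monomial_def)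
  next
    case (Cons l ls)
    have "Poly_Mapping.single (Monomial (l # ls)) (1::complex) =
        Poly_Mapping.single (Monomial [l]) 1 * Poly_Mapping.single (Monomial ls) 1"
      by (simp add: mult_single plus_monomial_def)
    thus ?case
      using Cons letter[of l] by (auto intro!: mult free_single)
  qed
  show ?thesis using f
  proof (induction f rule: update_induct)
    case const
    \<comment> \<open>The zero polynomial is \<open>0\<close> times the unit, so it needs no case of
      its own.\<close>
    show ?case using smult[OF free_single[of 0 X 1], of 0] one by simp
  next
    case (update f w c)
    have eq: "Poly_Mapping.update w c f = Poly_Mapping.single 0 c * Poly_Mapping.single w 1 + f"
      using update.hyps
      by (intro poly_mapping_eqI)
        (auto simp: mult_single lookup_update lookup_add lookup_single when_def in_keys_iff)
    have f: "f \<in> carrier (free_star_algebra X)" and w: "letter_base ` set (letters w) \<subseteq> X"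
      using update.prems update.hyps by (auto simp: free_carrier keys_update)
    show ?case
      unfolding eq
      using word[of "letters w"] w f update.IH free_single[OF w]
      by (intro add smult free_closed(5)) auto
  qed
qed

lemma star_hom_simps:
  assumes "h \<in> star_hom A B"
  shows "x \<in> carrier A \<Longrightarrow> h x \<in> carrier B"
    "x \<in> carrier A \<Longrightarrow> y \<in> carrier A \<Longrightarrow> h (x \<otimes>\<^bsub>A\<^esub> y) = h x \<otimes>\<^bsub>B\<^esub> h y"
    "x \<in> carrier A \<Longrightarrow> y \<in> carrier A \<Longrightarrow> h (x \<oplus>\<^bsub>A\<^esub> y) = h x \<oplus>\<^bsub>B\<^esub> h y"
    "h \<one>\<^bsub>A\<^esub> = \<one>\<^bsub>B\<^esub>"
    "x \<in> carrier A \<Longrightarrow> h (c \<odot>\<^bsub>A\<^esub> x) = c \<odot>\<^bsub>B\<^esub> h x"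
    "x \<in> carrier A \<Longrightarrow> h (star\<^bsub>A\<^esub> x) = star\<^bsub>B\<^esub> (h x)"
  using assms by (auto simp: star_hom_def ring_hom_def)

lemma star_hom_comp:
  assumes "h \<in> star_hom A B" "k \<in> star_hom B C"
  shows "(\<lambda>x. k (h x)) \<in> star_hom A C"
proof -
  note hk = star_hom_simps[OF assms(1)] star_hom_simps[OF assms(2)]
  have "(\<lambda>x. k (h x)) \<in> ring_hom A C"
    by (rule ring_hom_memI) (simp_all add: hk)
  thus ?thesis unfolding star_hom_def by (simp add: hk)
qed

text \<open>The source of admissible seminorms: a representation of the free algebra may take values
  in any star-algebra with a C*-seminorm, complete or not.\<close>

lemma cstar_seminorm_comp:
  assumes "unital_star_algebra A" and h: "h \<in> star_hom A B" and N: "cstar_seminorm B N"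
  shows "cstar_seminorm A (\<lambda>x. N (h x))"
proof -
  interpret A: unital_star_algebra A by fact
  show ?thesis
    using N unfolding cstar_seminorm_def
    by (simp add: star_hom_simps[OF h] A.star_closed)
qed

lemma star_hom_free_eqI:
  assumes h: "h \<in> star_hom (free_star_algebra X) B" and k: "k \<in> star_hom (free_star_algebra X) B"
    and gens: "\<And>x. x \<in> X \<Longrightarrow> h (poly_gen x) = k (poly_gen x)"
    and f: "f \<in> carrier (free_star_algebra X)"
  shows "h f = k f"
  using f
proof (induction f rule: free_star_algebra_induct)
  case one
  show ?case using star_hom_simps(4)[OF h] star_hom_simps(4)[OF k] by simp
next
  case (adj x)
  show ?case
    using star_hom_simps(6)[OF h poly_gen_carrier[OF adj]] star_hom_simps(6)[OF k poly_gen_carrier[OF adj]]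
      gens[OF adj] by simp
next
  case (smult c f)
  thus ?case using star_hom_simps(5)[OF h smult(1), of c] star_hom_simps(5)[OF k smult(1), of c] by simp
next
  case (add f g)
  thus ?case using star_hom_simps(3)[OF h add(1,2)] star_hom_simps(3)[OF k add(1,2)] by simp
next
  case (mult f g)
  thus ?case using star_hom_simps(2)[OF h mult(1,2)] star_hom_simps(2)[OF k mult(1,2)] by simp
qed (rule gens)

section \<open>Contractive extensions and density in universal algebras\<close>

context bounded_presentation begin

text \<open>Adds the norm bound to \<open>universal_property\<close>. On polynomials, the norm of
  the image is an admissible seminorm and hence below the universal one; the bound then passes to
  limits of Cauchy sequences.\<close>

lemma contractive_extension:
  assumes B: "unital_cstar_algebra B"
    and hom: "h \<in> star_hom FA B"
    and rel: "\<And>r. r \<in> R \<Longrightarrow> h r = \<zero>\<^bsub>B\<^esub>"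
  shows "\<exists>\<phi>\<in>star_hom (universal_cstar X R) B.
    (\<forall>f\<in>carrier FA. \<phi> (completion_incl FA US f) = h f) \<and>
    (\<forall>a\<in>carrier (universal_cstar X R). cnorm B (\<phi> a) \<le> cnorm (universal_cstar X R) a)"
proof -
  interpret B: unital_cstar_algebra B by (rule B)
  interpret A: seminormed_star_algebra FA US by (rule US_seminormed)
  let ?N = "\<lambda>f. cnorm B (h f)"
  have "cstar_seminorm FA ?N"
    by (rule cstar_seminorm_comp[OF free_unital_star_algebra hom B.norm_seminorm])
  hence "?N \<in> admissible_seminorms X R"
    by (simp add: admissible_seminorms_def rel B.NS.N_zero)
  hence con: "?N f \<le> US f" if "f \<in> carrier FA" for f using le_US that by blast
  interpret contractive_star_hom FA US B h
    by unfold_locales (use hom con in auto)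
  have "cnorm B (ext a) \<le> cnorm A.AC a" if a: "a \<in> carrier A.AC" for a
  proof -
    obtain s where s: "s \<in> A.CS" "a = A.cls s" using A.AC_cases[OF a] .
    have e: "ext a \<in> carrier B" and l: "(\<lambda>n. cnorm B (h (s n) \<ominus>\<^bsub>B\<^esub> ext a)) \<longlonglongrightarrow> 0"
      using ext_cls[OF s(1)] s(2) by (auto simp: null_rel_def)
    have hs: "h (s n) \<in> carrier B" for n using A.CS_carrier[OF s(1)] h_simps(1) by blast
    have "(\<lambda>n. cnorm B (h (s n)) - cnorm B (ext a)) \<longlonglongrightarrow> 0"
      by (rule tendsto_rabs_zero_cancel, rule null_sandwich[OF l])
        (use B.NS.N_abs_diff[OF hs e] in simp_all)
    from tendsto_add[OF this tendsto_const[of "cnorm B (ext a)"]]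
    have "(\<lambda>n. cnorm B (h (s n))) \<longlonglongrightarrow> cnorm B (ext a)" by simp
    moreover have "(\<lambda>n. US (s n)) \<longlonglongrightarrow> cnorm A.AC a" using A.AC_norm[OF s(1)] s(2) by simp
    ultimately show ?thesis
      by (rule LIMSEQ_le) (use con A.CS_carrier[OF s(1)] in blast)
  qed
  thus ?thesis
    unfolding universal_cstar_def using ext_hom ext_incl by (intro bexI[of _ ext]) simp_all
qed

lemma incl_dense:
  assumes "a \<in> carrier (universal_cstar X R)" "e > 0"
  shows "\<exists>f\<in>carrier FA.
    cnorm (universal_cstar X R) (a \<ominus>\<^bsub>universal_cstar X R\<^esub> completion_incl FA US f) < e"
proof -
  interpret A: seminormed_star_algebra FA US by (rule US_seminormed)
  obtain s where s: "s \<in> A.CS" "a = A.cls s" using assms unfolding universal_cstar_def by (meson A.AC_cases)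
  obtain m where "cnorm A.AC (a \<ominus>\<^bsub>A.AC\<^esub> A.cls (\<lambda>n. s m)) \<le> e / 2"
    using A.AC_approx[OF s(1), of "e / 2"] assms(2) s(2) by auto
  thus ?thesis
    using A.CS_carrier[OF s(1), of m] assms(2)
    unfolding universal_cstar_def completion_incl_def by (intro bexI[of _ "s m"]) auto
qed

lemma norm_incl: "f \<in> carrier FA \<Longrightarrow> cnorm (universal_cstar X R) (completion_incl FA US f) = US f"
proof -
  assume f: "f \<in> carrier FA"
  interpret A: seminormed_star_algebra FA US by (rule US_seminormed)
  show ?thesis
    using A.AC_norm[OF A.CS_const[OF f]] LIMSEQ_unique[OF tendsto_const]
    unfolding universal_cstar_def completion_incl_def by metis
qed

lemma incl_hom: "completion_incl FA US \<in> star_hom FA (universal_cstar X R)"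
  using incl_star_hom by (rule star_algebra_hom.hom)

lemma universal_gen_incl: "completion_incl FA US (poly_gen x) = universal_gen X R x"
  by (simp add: universal_gen_def)

text \<open>The uniqueness half of the universal property, for the identity. Both maps agree on
  polynomials, which are dense, and contractivity supplies the continuity.\<close>

lemma identity_on_gens:
  assumes \<phi>: "\<phi> \<in> star_hom (universal_cstar X R) (universal_cstar X R)"
    and con: "\<And>a. a \<in> carrier (universal_cstar X R) \<Longrightarrow>
      cnorm (universal_cstar X R) (\<phi> a) \<le> cnorm (universal_cstar X R) a"
    and gens: "\<And>x. x \<in> X \<Longrightarrow> \<phi> (universal_gen X R x) = universal_gen X R x"
    and a: "a \<in> carrier (universal_cstar X R)"
  shows "\<phi> a = a"
proof -
  let ?U = "universal_cstar X R" and ?i = "completion_incl FA US"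
  interpret U: unital_cstar_algebra ?U by (rule universal_cstar)
  interpret \<phi>: star_algebra_hom ?U ?U \<phi> by unfold_locales (rule \<phi>)
  have fixed: "\<phi> (?i f) = ?i f" if "f \<in> carrier FA" for f
    by (rule star_hom_free_eqI[OF star_hom_comp[OF incl_hom \<phi>] incl_hom _ that])
      (simp add: universal_gen_incl gens)
  have "cnorm ?U (\<phi> a \<ominus>\<^bsub>?U\<^esub> a) \<le> 0 + e" if e: "e > 0" for e
  proof -
    obtain f where f: "f \<in> carrier FA" "cnorm ?U (a \<ominus>\<^bsub>?U\<^esub> ?i f) < e / 2"
      using incl_dense[OF a, of "e / 2"] e by auto
    have i: "?i f \<in> carrier ?U" using star_hom_simps(1)[OF incl_hom f(1)] .
    have "cnorm ?U (\<phi> a \<ominus>\<^bsub>?U\<^esub> a) \<le> cnorm ?U (\<phi> a \<ominus>\<^bsub>?U\<^esub> ?i f) + cnorm ?U (?i f \<ominus>\<^bsub>?U\<^esub> a)"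
      by (rule U.NS.N_tri) (use a i \<phi>.h_simps in auto)
    also have "\<phi> a \<ominus>\<^bsub>?U\<^esub> ?i f = \<phi> (a \<ominus>\<^bsub>?U\<^esub> ?i f)" using fixed[OF f(1)] a i by (simp add: \<phi>.h_minus)
    also have "cnorm ?U \<dots> \<le> cnorm ?U (a \<ominus>\<^bsub>?U\<^esub> ?i f)" using a i by (intro con) simp
    also have "cnorm ?U (?i f \<ominus>\<^bsub>?U\<^esub> a) = cnorm ?U (a \<ominus>\<^bsub>?U\<^esub> ?i f)" by (rule U.NS.N_sym[OF i a])
    finally show ?thesis using f(2) by simp
  qed
  hence "cnorm ?U (\<phi> a \<ominus>\<^bsub>?U\<^esub> a) \<le> 0" by (rule field_le_epsilon)
  hence "\<phi> a \<ominus>\<^bsub>?U\<^esub> a = \<zero>\<^bsub>?U\<^esub>"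
    using U.NS.N_nonneg[of "\<phi> a \<ominus>\<^bsub>?U\<^esub> a"] a \<phi>.h_simps(1)[OF a] by (intro U.norm_definite) auto
  thus ?thesis using a \<phi>.h_simps(1)[OF a] by (simp add: U.r_right_minus_eq)
qed

end


section \<open>Cutting down by commuting projections\<close>

text \<open>If \<open>C\<close> is a directed family of commuting projections, the numbers \<open>\<parallel>x c\<parallel>\<close> decrease to the
  distance of \<open>x\<close> from the left ideal generated by the complements \<open>1 - c\<close>.  The absorption
  hypothesis makes this ideal two-sided on the range of \<open>h\<close>, and the C*-identity for the quotient
  norm then needs no approximate units beyond the complements themselves.\<close>

lemma corner_seminorm:
  fixes A :: "('a, 'm) cstar_algebra_scheme" (structure) and F :: "('f, 'n) star_algebra_scheme"
  assumes "unital_cstar_algebra A" "unital_star_algebra F" and h: "h \<in> star_hom F A"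
    and ne: "C \<noteq> {}"
    and proj: "\<And>c. c \<in> C \<Longrightarrow> c \<in> carrier A" "\<And>c. c \<in> C \<Longrightarrow> star c = c" "\<And>c. c \<in> C \<Longrightarrow> c \<otimes> c = c"
    and meet: "\<And>c d. c \<in> C \<Longrightarrow> d \<in> C \<Longrightarrow> c \<otimes> d \<in> C"
    and comm: "\<And>c d. c \<in> C \<Longrightarrow> d \<in> C \<Longrightarrow> c \<otimes> d = d \<otimes> c"
    and absorb: "\<And>f c. f \<in> carrier F \<Longrightarrow> c \<in> C \<Longrightarrow> \<exists>d\<in>C. h f \<otimes> d = c \<otimes> (h f \<otimes> d)"
  shows "cstar_seminorm F (\<lambda>f. INF c\<in>C. \<parallel>h f \<otimes> c\<parallel>)"
proof -
  interpret A: unital_cstar_algebra A by fact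
  interpret F: unital_star_algebra F by fact
  note hs = star_hom_simps[OF h]
  define N where "N f = (INF c\<in>C. \<parallel>h f \<otimes> c\<parallel>)" for f
  have bdd: "bdd_below ((\<lambda>c. \<parallel>h f \<otimes> c\<parallel>) ` C)" if "f \<in> carrier F" for f
    by (rule bdd_belowI[of _ 0]) (use that proj hs in \<open>auto intro!: A.NS.N_nonneg\<close>)
  have le: "N f \<le> \<parallel>h f \<otimes> c\<parallel>" if "f \<in> carrier F" "c \<in> C" for f c
    unfolding N_def by (rule cINF_lower[OF bdd]) (use that in auto)
  have ge: "r \<le> N f" if "\<And>c. c \<in> C \<Longrightarrow> r \<le> \<parallel>h f \<otimes> c\<parallel>" for r f
    unfolding N_def by (rule cINF_greatest[OF ne that])
  have nonneg: "0 \<le> N f" if "f \<in> carrier F" for f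
    by (rule ge) (use that proj hs in \<open>auto intro!: A.NS.N_nonneg\<close>)
  have approx: "\<exists>c\<in>C. \<parallel>h f \<otimes> c\<parallel> < N f + e" if "f \<in> carrier F" "e > 0" for f e
  proof -
    have "N f < N f + e" using that by simp
    thus ?thesis unfolding N_def by (rule iffD1[OF cINF_less_iff[OF ne bdd[OF that(1)]]])
  qed
  have le1: "\<parallel>c\<parallel> \<le> 1" if "c \<in> C" for c
    by (rule A.NS.N_proj_le)
      (simp_all only: proj[OF that] A.NS.N_diff_self[OF proj(1)[OF that]])
  have mono: "\<parallel>x \<otimes> (c \<otimes> d)\<parallel> \<le> \<parallel>x \<otimes> c\<parallel>" if "x \<in> carrier A" "c \<in> C" "d \<in> C" for x c d
  proof -
    have "\<parallel>(x \<otimes> c) \<otimes> d\<parallel> \<le> \<parallel>x \<otimes> c\<parallel> * \<parallel>d\<parallel>"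
      using that proj by (intro A.NS.N_mult) auto
    also have "\<dots> \<le> \<parallel>x \<otimes> c\<parallel>"
      using that proj le1 by (intro mult_right_le_one_le A.NS.N_nonneg) auto
    finally show ?thesis using that proj by (simp add: A.m_assoc)
  qed
  have mono': "\<parallel>x \<otimes> (c \<otimes> d)\<parallel> \<le> \<parallel>x \<otimes> d\<parallel>" if "x \<in> carrier A" "c \<in> C" "d \<in> C" for x c d
    using mono[of x d c] comm[of c d] that by simp
  have smult_le: "N (k \<odot>\<^bsub>F\<^esub> f) \<le> cmod k * \<parallel>h f \<otimes> c\<parallel>" if "f \<in> carrier F" "c \<in> C" for f c k
    using le[of "k \<odot>\<^bsub>F\<^esub> f" c] that proj
    by (simp add: hs F.smult_closed A.smult_mult_l A.NS.N_smult)
  have smult: "N (k \<odot>\<^bsub>F\<^esub> f) = cmod k * N f" if f: "f \<in> carrier F" for f k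
  proof (rule antisym)
    show "cmod k * N f \<le> N (k \<odot>\<^bsub>F\<^esub> f)"
    proof (rule ge)
      fix c assume c: "c \<in> C"
      show "cmod k * N f \<le> \<parallel>h (k \<odot>\<^bsub>F\<^esub> f) \<otimes> c\<parallel>"
        using mult_left_mono[OF le[OF f c], of "cmod k"] f c proj
        by (simp add: hs A.smult_mult_l A.NS.N_smult)
    qed
    show "N (k \<odot>\<^bsub>F\<^esub> f) \<le> cmod k * N f"
    proof (cases "k = 0")
      case True
      obtain c where "c \<in> C" using ne by blast
      thus ?thesis using smult_le[OF f, of c k] True by simp
    next
      case False
      have "N (k \<odot>\<^bsub>F\<^esub> f) / cmod k \<le> N f"
        by (rule ge) (use smult_le[OF f] False in \<open>simp add: pos_divide_le_eq mult.commute[of _ "cmod k"]\<close>)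
      thus ?thesis using False by (simp add: pos_divide_le_eq mult.commute[of _ "cmod k"])
    qed
  qed
  have add: "N (f \<oplus>\<^bsub>F\<^esub> g) \<le> N f + N g" if f: "f \<in> carrier F" and g: "g \<in> carrier F" for f g
  proof (rule field_le_epsilon)
    fix e :: real assume e: "e > 0"
    obtain c where c: "c \<in> C" "\<parallel>h f \<otimes> c\<parallel> < N f + e / 2" using approx[OF f, of "e / 2"] e by auto
    obtain d where d: "d \<in> C" "\<parallel>h g \<otimes> d\<parallel> < N g + e / 2" using approx[OF g, of "e / 2"] e by auto
    have "N (f \<oplus>\<^bsub>F\<^esub> g) \<le> \<parallel>h f \<otimes> (c \<otimes> d) \<oplus> h g \<otimes> (c \<otimes> d)\<parallel>"
      using le[of "f \<oplus>\<^bsub>F\<^esub> g" "c \<otimes> d"] meet[OF c(1) d(1)] f g proj by (simp add: hs A.l_distr)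
    also have "\<dots> \<le> \<parallel>h f \<otimes> (c \<otimes> d)\<parallel> + \<parallel>h g \<otimes> (c \<otimes> d)\<parallel>"
      using f g c d proj by (intro A.NS.N_add) (auto simp: hs)
    also have "\<dots> \<le> \<parallel>h f \<otimes> c\<parallel> + \<parallel>h g \<otimes> d\<parallel>"
      using f g c d by (intro add_mono mono mono') (auto simp: hs)
    finally show "N (f \<oplus>\<^bsub>F\<^esub> g) \<le> N f + N g + e" using c d by simp
  qed
  have mult: "N (f \<otimes>\<^bsub>F\<^esub> g) \<le> N f * N g" if f: "f \<in> carrier F" and g: "g \<in> carrier F" for f g
  proof -
    \<comment> \<open>Absorption lets \<open>c\<close> be inserted between \<open>h f\<close> and
      \<open>h g\<close> once the product is cut by a suitable \<open>c'\<close> on the right;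
      cutting further does not increase norms.\<close>
    have le_c: "N (f \<otimes>\<^bsub>F\<^esub> g) \<le> \<parallel>h f \<otimes> c\<parallel> * \<parallel>h g \<otimes> d\<parallel>" if c: "c \<in> C" and d: "d \<in> C" for c d
    proof -
      obtain c' where c': "c' \<in> C" "h g \<otimes> c' = c \<otimes> (h g \<otimes> c')" using absorb[OF g c] by blast
      have car: "h f \<in> carrier A" "h g \<in> carrier A" "c \<in> carrier A" "c' \<in> carrier A" "d \<in> carrier A"
        using f g c c' d proj by (auto simp: hs)
      have "N (f \<otimes>\<^bsub>F\<^esub> g) \<le> \<parallel>h (f \<otimes>\<^bsub>F\<^esub> g) \<otimes> (c' \<otimes> d)\<parallel>"
        using f g c' d meet by (intro le) auto
      also have "h (f \<otimes>\<^bsub>F\<^esub> g) \<otimes> (c' \<otimes> d) = h f \<otimes> (h g \<otimes> c') \<otimes> d"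
        using f g car by (simp add: hs A.m_assoc)
      also have "\<dots> = h f \<otimes> c \<otimes> (h g \<otimes> (c' \<otimes> d))"
        by (subst c'(2)) (use car in \<open>simp add: A.m_assoc\<close>)
      also have "\<parallel>\<dots>\<parallel> \<le> \<parallel>h f \<otimes> c\<parallel> * \<parallel>h g \<otimes> (c' \<otimes> d)\<parallel>"
        using car by (intro A.NS.N_mult) auto
      also have "\<dots> \<le> \<parallel>h f \<otimes> c\<parallel> * \<parallel>h g \<otimes> d\<parallel>"
        using car c' d by (intro mult_left_mono mono' A.NS.N_nonneg) auto
      finally show ?thesis .
    qed
    \<comment> \<open>The infima over \<open>c\<close> and over \<open>d\<close> are taken one after
      the other by dividing, so a vanishing factor is treated apart.\<close>
    have le_f: "N (f \<otimes>\<^bsub>F\<^esub> g) \<le> N f * \<parallel>h g \<otimes> d\<parallel>" if d: "d \<in> C" for d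
    proof (cases "\<parallel>h g \<otimes> d\<parallel> = 0")
      case True
      obtain c where "c \<in> C" using ne by blast
      thus ?thesis using le_c[of c d] d True by simp
    next
      case False
      hence pos: "\<parallel>h g \<otimes> d\<parallel> > 0"
        using A.NS.N_nonneg[of "h g \<otimes> d"] g d proj by (simp add: hs)
      have "N (f \<otimes>\<^bsub>F\<^esub> g) / \<parallel>h g \<otimes> d\<parallel> \<le> N f"
        by (rule ge) (use le_c[OF _ d] pos in \<open>simp add: pos_divide_le_eq\<close>)
      thus ?thesis using pos by (simp add: pos_divide_le_eq mult.commute)
    qed
    show ?thesis
    proof (cases "N f = 0")
      case True
      obtain c where "c \<in> C" using ne by blast
      thus ?thesis using le_f[of c] True by simp
    next
      case False
      hence pos: "N f > 0" using nonneg[OF f] by simp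
      have "N (f \<otimes>\<^bsub>F\<^esub> g) / N f \<le> N g"
        by (rule ge) (use le_f pos in \<open>simp add: pos_divide_le_eq mult.commute[of _ "N f"]\<close>)
      thus ?thesis using pos by (simp add: pos_divide_le_eq mult.commute)
    qed
  qed
  \<comment> \<open>The square of the norm of \<open>h f \<otimes> c\<close> involves
    \<open>c\<close> on both sides; the left one is dropped because \<open>c\<close> has norm at
    most one. This half of the C*-identity needs no absorption.\<close>
  have sq_le: "(N f)\<^sup>2 \<le> N (star\<^bsub>F\<^esub> f \<otimes>\<^bsub>F\<^esub> f)" if f: "f \<in> carrier F" for f
  proof (rule ge)
    fix c assume c: "c \<in> C"
    have car: "h f \<in> carrier A" "c \<in> carrier A" "star (h f) \<in> carrier A"
      using f c proj by (auto simp: hs A.star_closed)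
    have "(N f)\<^sup>2 \<le> (\<parallel>h f \<otimes> c\<parallel>)\<^sup>2" by (intro power_mono le nonneg f c)
    also have "\<dots> = \<parallel>star (h f \<otimes> c) \<otimes> (h f \<otimes> c)\<parallel>" using car by (simp add: A.NS.N_cstar)
    also have "star (h f \<otimes> c) \<otimes> (h f \<otimes> c) = c \<otimes> (star (h f) \<otimes> h f \<otimes> c)"
      using car c proj by (simp add: A.star_mult A.m_assoc)
    also have "\<parallel>\<dots>\<parallel> \<le> \<parallel>c\<parallel> * \<parallel>star (h f) \<otimes> h f \<otimes> c\<parallel>" using car by (intro A.NS.N_mult) auto
    also have "\<dots> \<le> \<parallel>star (h f) \<otimes> h f \<otimes> c\<parallel>"
      using car le1[OF c] by (intro mult_left_le_one_le A.NS.N_nonneg) auto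
    finally show "(N f)\<^sup>2 \<le> \<parallel>h (star\<^bsub>F\<^esub> f \<otimes>\<^bsub>F\<^esub> f) \<otimes> c\<parallel>"
      using f by (simp add: hs F.star_closed)
  qed
  \<comment> \<open>Combining \<open>sq_le\<close> with submultiplicativity and cancelling
    \<open>N f\<close> makes the adjoint isometric, which yields the other half of the
    C*-identity.\<close>
  have star_ge: "N f \<le> N (star\<^bsub>F\<^esub> f)" if f: "f \<in> carrier F" for f
  proof (cases "N f = 0")
    case True
    thus ?thesis using nonneg[OF F.star_closed[OF f]] by simp
  next
    case False
    hence pos: "N f > 0" using nonneg[OF f] by simp
    have "N f * N f \<le> N (star\<^bsub>F\<^esub> f) * N f"
      using sq_le[OF f] mult[OF F.star_closed[OF f] f] by (simp add: power2_eq_square)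
    thus ?thesis using pos by simp
  qed
  have star_eq: "N (star\<^bsub>F\<^esub> f) = N f" if f: "f \<in> carrier F" for f
    using star_ge[OF f] star_ge[OF F.star_closed[OF f]] f by (simp add: F.star_star)
  have cstar: "N (star\<^bsub>F\<^esub> f \<otimes>\<^bsub>F\<^esub> f) = (N f)\<^sup>2" if f: "f \<in> carrier F" for f
    using sq_le[OF f] mult[OF F.star_closed[OF f] f] star_eq[OF f]
    by (simp add: power2_eq_square)
  have "cstar_seminorm F N"
    unfolding cstar_seminorm_def
    by (intro conjI ballI allI) (simp_all add: nonneg add smult mult cstar)
  thus ?thesis unfolding N_def .
qed


section \<open>Surjectivity of contractive maps with almost contractive lifts\<close>

text \<open>The series argument of the open mapping theorem. Successive approximants from
  \<open>D\<close> have differences in \<open>D\<close>; these lift with geometrically small norms,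
  and the lifts sum to a preimage. Contractivity identifies the image of the sum.\<close>

lemma contractive_hom_surj:
  fixes A :: "('a, 'm) cstar_algebra_scheme" and B :: "('b, 'n) cstar_algebra_scheme"
  assumes "unital_cstar_algebra A" "unital_cstar_algebra B" and h: "h \<in> star_hom A B"
    and con: "\<And>x. x \<in> carrier A \<Longrightarrow> cnorm B (h x) \<le> cnorm A x"
    and D: "D \<subseteq> carrier B" "\<And>x y. x \<in> D \<Longrightarrow> y \<in> D \<Longrightarrow> x \<ominus>\<^bsub>B\<^esub> y \<in> D"
    and dense: "\<And>y e. y \<in> carrier B \<Longrightarrow> e > 0 \<Longrightarrow> \<exists>z\<in>D. cnorm B (y \<ominus>\<^bsub>B\<^esub> z) < e"
    and lift: "\<And>y e. y \<in> D \<Longrightarrow> e > 0 \<Longrightarrow> \<exists>x\<in>carrier A. h x = y \<and> cnorm A x < cnorm B y + e"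
  shows "h ` carrier A = carrier B"
proof
  interpret A: unital_cstar_algebra A by fact
  interpret B: unital_cstar_algebra B by fact
  interpret star_algebra_hom A B h by unfold_locales (rule h)
  show "h ` carrier A \<subseteq> carrier B" using h_simps(1) by blast
  show "carrier B \<subseteq> h ` carrier A"
  proof
    fix y assume y: "y \<in> carrier B"
    define \<delta> where "\<delta> n = (1/2 :: real) ^ n" for n :: nat
    have \<delta>: "\<delta> n > 0" "\<delta> (Suc n) = \<delta> n / 2" for n by (auto simp: \<delta>_def)
    have \<delta>_mono: "\<delta> n \<le> \<delta> m" if "m \<le> n" for m n
      unfolding \<delta>_def using that by (intro power_decreasing) auto
    have \<delta>_lim: "\<delta> \<longlonglongrightarrow> 0" unfolding \<delta>_def by (intro LIMSEQ_power_zero) simp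
    obtain z where z: "\<And>n. z n \<in> D" "\<And>n. cnorm B (y \<ominus>\<^bsub>B\<^esub> z n) < \<delta> n"
      using dense[OF y \<delta>(1)] by metis
    hence zc: "z n \<in> carrier B" for n using D by blast
    have dz: "z (Suc n) \<ominus>\<^bsub>B\<^esub> z n \<in> D" for n using D(2) z by blast
    \<comment> \<open>The two errors add up to less than \<open>3/2 * \<delta> n\<close>. An almost
      contractive lift may exceed the bound \<open>2 * \<delta> n\<close> by another
      \<open>\<delta> n\<close>, which gives the factor 3 below.\<close>
    have ndz: "cnorm B (z (Suc n) \<ominus>\<^bsub>B\<^esub> z n) < 2 * \<delta> n" for n
    proof -
      have "cnorm B (z (Suc n) \<ominus>\<^bsub>B\<^esub> z n) \<le> cnorm B (z (Suc n) \<ominus>\<^bsub>B\<^esub> y) + cnorm B (y \<ominus>\<^bsub>B\<^esub> z n)"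
        by (rule B.NS.N_tri[OF zc y zc])
      also have "cnorm B (z (Suc n) \<ominus>\<^bsub>B\<^esub> y) = cnorm B (y \<ominus>\<^bsub>B\<^esub> z (Suc n))"
        by (rule B.NS.N_sym[OF zc y])
      also have "cnorm B (y \<ominus>\<^bsub>B\<^esub> z (Suc n)) + cnorm B (y \<ominus>\<^bsub>B\<^esub> z n) < 2 * \<delta> n"
        using z(2)[of n] z(2)[of "Suc n"] \<delta>(1)[of n] \<delta>(2)[of n] by simp
      finally show ?thesis .
    qed
    have "\<exists>x\<in>carrier A. h x = z (Suc n) \<ominus>\<^bsub>B\<^esub> z n \<and> cnorm A x < 3 * \<delta> n" for n
    proof -
      obtain x where "x \<in> carrier A" "h x = z (Suc n) \<ominus>\<^bsub>B\<^esub> z n"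
          "cnorm A x < cnorm B (z (Suc n) \<ominus>\<^bsub>B\<^esub> z n) + \<delta> n"
        using lift[OF dz \<delta>(1)] by blast
      thus ?thesis using ndz[of n] by (intro bexI[of _ x]) auto
    qed
    then obtain d where d: "\<And>n. d n \<in> carrier A" "\<And>n. h (d n) = z (Suc n) \<ominus>\<^bsub>B\<^esub> z n"
        "\<And>n. cnorm A (d n) < 3 * \<delta> n" by metis
    obtain x0 where x0: "x0 \<in> carrier A" "h x0 = z 0" using lift[OF z(1) zero_less_one] by blast
    define x where "x = rec_nat x0 (\<lambda>n a. a \<oplus>\<^bsub>A\<^esub> d n)"
    have xs: "x 0 = x0" "x (Suc n) = x n \<oplus>\<^bsub>A\<^esub> d n" for n by (auto simp: x_def)
    have xc: "x n \<in> carrier A" for n by (induction n) (use x0 d in \<open>auto simp: xs\<close>)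
    have hx: "h (x n) = z n" for n
    proof (induction n)
      case (Suc n)
      have "h (x (Suc n)) = z n \<oplus>\<^bsub>B\<^esub> (z (Suc n) \<ominus>\<^bsub>B\<^esub> z n)"
        using Suc xc d by (simp add: xs h_simps)
      also have "\<dots> = z (Suc n)"
        using zc[of n] zc[of "Suc n"] unfolding a_minus_def by algebra
      finally show ?case .
    qed (simp add: xs x0)
    \<comment> \<open>Since \<open>\<delta>\<close> halves at each step,
      \<open>3 * \<delta> j\<close> equals \<open>6 * (\<delta> j - \<delta> (Suc j))\<close>, and
      the bound telescopes.\<close>
    have tail: "cnorm A (x (m + k) \<ominus>\<^bsub>A\<^esub> x m) \<le> 6 * (\<delta> m - \<delta> (m + k))" for m k
    proof (induction k)
      case 0
      show ?case using A.NS.N_diff_self[OF xc[of m]] by simp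
    next
      case (Suc k)
      have "x (m + Suc k) \<ominus>\<^bsub>A\<^esub> x m = (x (m + k) \<ominus>\<^bsub>A\<^esub> x m) \<oplus>\<^bsub>A\<^esub> d (m + k)"
        using xc[of "m + k"] xc[of m] d(1)[of "m + k"] by (simp add: xs a_minus_def A.a_ac)
      hence "cnorm A (x (m + Suc k) \<ominus>\<^bsub>A\<^esub> x m) \<le> cnorm A (x (m + k) \<ominus>\<^bsub>A\<^esub> x m) + cnorm A (d (m + k))"
        using xc d(1) by (simp add: A.NS.N_add)
      also have "\<dots> \<le> 6 * (\<delta> m - \<delta> (m + k)) + 3 * \<delta> (m + k)"
        using Suc d(3)[of "m + k"] by simp
      finally show ?case using \<delta>(2)[of "m + k"] by simp
    qed
    have near: "cnorm A (x n \<ominus>\<^bsub>A\<^esub> x m) \<le> 6 * \<delta> m" if "m \<le> n" for m n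
      using tail[of m "n - m"] that \<delta>(1)[of n] by simp
    have "\<exists>M. \<forall>m\<ge>M. \<forall>n\<ge>M. cnorm A (x m \<ominus>\<^bsub>A\<^esub> x n) < e" if e: "e > 0" for e
    proof -
      \<comment> \<open>Both \<open>x m\<close> and \<open>x n\<close> lie within
        \<open>6 * \<delta> M\<close> of \<open>x M\<close>.\<close>
      obtain M where M: "\<delta> M < e / 12"
        using eventually_happens'[OF _ order_tendstoD(2)[OF \<delta>_lim, of "e / 12"]] e by auto
      have "cnorm A (x m \<ominus>\<^bsub>A\<^esub> x n) < e" if "m \<ge> M" "n \<ge> M" for m n
        using A.NS.N_tri[OF xc[of m] xc[of M] xc[of n]] near[OF that(1)] near[OF that(2)]
          A.NS.N_sym[OF xc[of M] xc[of n]] M by linarith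
      thus ?thesis by blast
    qed
    from A.norm_complete[OF xc this]
    obtain a where a: "a \<in> carrier A" "(\<lambda>n. cnorm A (x n \<ominus>\<^bsub>A\<^esub> a)) \<longlonglongrightarrow> 0"
      by blast
    have ha: "h a \<in> carrier B" using a h_simps(1) by blast
    have lim: "(\<lambda>n. cnorm A (x n \<ominus>\<^bsub>A\<^esub> a) + \<delta> n) \<longlonglongrightarrow> 0"
      using tendsto_add[OF a(2) \<delta>_lim] by simp
    have bound: "cnorm B (y \<ominus>\<^bsub>B\<^esub> h a) \<le> cnorm A (x n \<ominus>\<^bsub>A\<^esub> a) + \<delta> n" for n
    proof -
      have "cnorm B (y \<ominus>\<^bsub>B\<^esub> h a) \<le> cnorm B (y \<ominus>\<^bsub>B\<^esub> z n) + cnorm B (z n \<ominus>\<^bsub>B\<^esub> h a)"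
        by (rule B.NS.N_tri[OF y zc ha])
      moreover have "cnorm B (z n \<ominus>\<^bsub>B\<^esub> h a) \<le> cnorm A (x n \<ominus>\<^bsub>A\<^esub> a)"
        using con[of "x n \<ominus>\<^bsub>A\<^esub> a"] xc a by (simp add: h_minus hx)
      ultimately show ?thesis using z(2)[of n] by simp
    qed
    have "cnorm B (y \<ominus>\<^bsub>B\<^esub> h a) \<le> 0"
      by (rule LIMSEQ_le_const[OF lim]) (use bound in blast)
    hence "y \<ominus>\<^bsub>B\<^esub> h a = \<zero>\<^bsub>B\<^esub>"
      using B.NS.N_nonneg[of "y \<ominus>\<^bsub>B\<^esub> h a"] y ha by (intro B.norm_definite) auto
    thus "y \<in> h ` carrier A" using y ha a(1) by simp
  qed
qed


section \<open>Families of isometries with diagonal word operators\<close>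

context unital_star_algebra begin

lemma adj_one: "star \<one> = \<one>"
proof -
  have "star (star \<one> \<otimes> \<one>) = star \<one> \<otimes> star (star \<one>)"
    by (rule star_mult) (simp_all add: star_closed)
  thus ?thesis by (simp add: star_closed star_star)
qed

lemma word_op_append:
  assumes w: "\<And>p. p \<in> P \<Longrightarrow> w p \<in> carrier A" and "\<alpha> \<in> words P" "\<beta> \<in> words P"
  shows "word_op A w (\<alpha> @ \<beta>) = word_op A w \<alpha> \<otimes> word_op A w \<beta>"
  using assms(2)
  by (induction rule: words_induct)
    (simp_all add: w m_assoc star_closed word_op_closed[OF w] assms(3))

lemma word_op_rev:
  assumes w: "\<And>p. p \<in> P \<Longrightarrow> w p \<in> carrier A" and "\<alpha> \<in> words P"
  shows "word_op A w (rev \<alpha>) = star (word_op A w \<alpha>)"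
  using assms(2)
proof (induction rule: words_induct)
  case (Cons2 p q \<beta>)
  have "word_op A w (rev \<beta> @ [q, p]) = word_op A w (rev \<beta>) \<otimes> word_op A w [q, p]"
    by (rule word_op_append[OF w]) (use Cons2 in \<open>auto simp: words_def\<close>)
  thus ?case
    using Cons2 by (simp add: w m_assoc star_closed star_mult star_star word_op_closed[OF w])
qed (simp add: adj_one)

end

text \<open>Expanding the product of the adjoint of \<open>a \<ominus> b\<close> with
  \<open>a \<ominus> b\<close> gives 1 - 1 - 1 + 1 = 0, and the C*-identity turns this into
  equality.\<close>

lemma (in unital_cstar_algebra) isometry_eqI:
  assumes c: "a \<in> carrier A" "b \<in> carrier A"
    and 1: "star a \<otimes> a = \<one>" "star b \<otimes> b = \<one>" "star a \<otimes> b = \<one>"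
  shows "a = b"
proof -
  have sc: "star a \<in> carrier A" "star b \<in> carrier A" using c star_closed by auto
  have ba: "star b \<otimes> a = \<one>"
    using arg_cong[OF 1(3), of "adj A"] c sc by (simp add: star_mult star_star adj_one)
  have "(star a \<ominus> star b) \<otimes> (a \<ominus> b) =
      (star a \<otimes> a \<ominus> star a \<otimes> b) \<ominus> (star b \<otimes> a \<ominus> star b \<otimes> b)"
    using c sc unfolding a_minus_def by algebra
  hence "star (a \<ominus> b) \<otimes> (a \<ominus> b) = \<zero>"
    using c by (simp add: NS.star_diff[symmetric] 1 ba)
  hence "\<parallel>a \<ominus> b\<parallel> = 0" using NS.N_cstar[of "a \<ominus> b"] c by (simp add: NS.N_zero)
  hence "a \<ominus> b = \<zero>" using c by (intro norm_definite) auto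
  thus ?thesis using c by simp
qed

text \<open>The common ground of both algebras, namely (T1) and (T3). That the \<open>w p\<close>
  are isometries, that they multiply and that neutral words give commuting projections are
  consequences, so the diagonal calculus is developed once.\<close>

locale diagonal_family = submonoid_of_group G P + A: unital_cstar_algebra A
  for G :: "('g, 'm) monoid_scheme" (structure) and P
    and A :: "('a, 'k) cstar_algebra_scheme" +
  fixes w :: "'g \<Rightarrow> 'a"
  assumes w_closed [simp]: "p \<in> P \<Longrightarrow> w p \<in> carrier A"
    and w_one: "w \<one> = \<one>\<^bsub>A\<^esub>"
    and w_word: "\<alpha> \<in> neutral_words G P \<Longrightarrow> \<beta> \<in> neutral_words G P \<Longrightarrow>
      constr_ideal G P \<alpha> = constr_ideal G P \<beta> \<Longrightarrow> word_op A w \<alpha> = word_op A w \<beta>"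
begin

abbreviation W where "W \<equiv> word_op A w"
abbreviation ws where "ws p \<equiv> star\<^bsub>A\<^esub> (w p)"

lemma ws_closed [simp]: "p \<in> P \<Longrightarrow> ws p \<in> carrier A"
  by (simp add: A.star_closed)

lemma W_closed [simp]: "\<alpha> \<in> words P \<Longrightarrow> W \<alpha> \<in> carrier A"
  by (rule A.word_op_closed) auto

lemma W_append: "\<alpha> \<in> words P \<Longrightarrow> \<beta> \<in> words P \<Longrightarrow> W (\<alpha> @ \<beta>) = W \<alpha> \<otimes>\<^bsub>A\<^esub> W \<beta>"
  by (rule A.word_op_append) auto

lemma W_neutral_closed [simp]: "\<alpha> \<in> neutral_words G P \<Longrightarrow> W \<alpha> \<in> carrier A"
  by (simp add: neutral_words_words)

text \<open>The adjoint belongs to the reversed word, which is neutral with the same ideal.\<close>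

lemma W_star: "\<alpha> \<in> neutral_words G P \<Longrightarrow> star\<^bsub>A\<^esub> (W \<alpha>) = W \<alpha>"
  using A.word_op_rev[of P w \<alpha>] neutral_words_words[of \<alpha> G P]
    w_word[of "rev \<alpha>" \<alpha>] neutral_rev[of \<alpha>] by simp

lemma W_mult:
  assumes "\<alpha> \<in> neutral_words G P" "\<beta> \<in> neutral_words G P" "\<gamma> \<in> neutral_words G P"
    "constr_ideal G P \<gamma> = constr_ideal G P \<alpha> \<inter> constr_ideal G P \<beta>"
  shows "W \<alpha> \<otimes>\<^bsub>A\<^esub> W \<beta> = W \<gamma>"
  using w_word[OF neutral_append(1)[OF assms(1,2)] assms(3)] neutral_append(2)[OF assms(1,2)] assms(4)
    W_append[of \<alpha> \<beta>] neutral_words_words[OF assms(1)] neutral_words_words[OF assms(2)] by simp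

lemma W_comm:
  "\<alpha> \<in> neutral_words G P \<Longrightarrow> \<beta> \<in> neutral_words G P \<Longrightarrow> W \<alpha> \<otimes>\<^bsub>A\<^esub> W \<beta> = W \<beta> \<otimes>\<^bsub>A\<^esub> W \<alpha>"
  using W_mult[of \<alpha> \<beta> "\<alpha> @ \<beta>"] W_mult[of \<beta> \<alpha> "\<alpha> @ \<beta>"] neutral_append[of \<alpha> \<beta>] by (simp add: Int_commute)

lemma neutral_Nil: "[] \<in> neutral_words G P"
  by (simp add: neutral_words_def)

text \<open>The word (p, p) has the same ideal as the empty word.\<close>

lemma isometry: "p \<in> P \<Longrightarrow> ws p \<otimes>\<^bsub>A\<^esub> w p = \<one>\<^bsub>A\<^esub>"
  using w_word[OF _ neutral_Nil, of "[p, p]"]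
  by (simp add: neutral_words_def constr_ideal_square constr_ideal_Nil)

lemma isometry_cancel: "p \<in> P \<Longrightarrow> x \<in> carrier A \<Longrightarrow> ws p \<otimes>\<^bsub>A\<^esub> (w p \<otimes>\<^bsub>A\<^esub> x) = x"
  using isometry[of p] by (simp add: A.m_assoc[symmetric])

text \<open>The word \<open>(pq, p, e, q)\<close> is neutral with ideal \<open>P\<close>, so the isometries \<open>w (pq)\<close> and
  \<open>w p w q\<close> have inner product \<open>1\<close>.\<close>

lemma w_mult:
  assumes pq: "p \<in> P" "q \<in> P"
  shows "w p \<otimes>\<^bsub>A\<^esub> w q = w (p \<otimes> q)"
proof -
  let ?\<alpha> = "[p \<otimes> q, p, \<one>, q]"
  have n: "?\<alpha> \<in> neutral_words G P" using pq by (simp add: neutral_words_def m_assoc)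
  have "inv (p \<otimes> q) \<otimes> (p \<otimes> (q \<otimes> x)) = x" if "x \<in> carrier G" for x
    using pq that m_assoc[of "inv (p \<otimes> q)" "p \<otimes> q" x] m_assoc[of p q x] by simp
  hence "constr_ideal G P ?\<alpha> = constr_ideal G P []"
    using pq neutral_words_words[OF n]
    by (intro set_eqI_carrier) (auto simp: constr_ideal_subset constr_ideal_Cons2 constr_ideal_Nil)
  hence "W ?\<alpha> = \<one>\<^bsub>A\<^esub>" using w_word[OF n neutral_Nil] by simp
  hence 1: "ws (p \<otimes> q) \<otimes>\<^bsub>A\<^esub> (w p \<otimes>\<^bsub>A\<^esub> w q) = \<one>\<^bsub>A\<^esub>"
    using pq by (simp add: w_one A.adj_one A.m_assoc)
  have 2: "star\<^bsub>A\<^esub> (w p \<otimes>\<^bsub>A\<^esub> w q) \<otimes>\<^bsub>A\<^esub> (w p \<otimes>\<^bsub>A\<^esub> w q) = \<one>\<^bsub>A\<^esub>"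
    using pq by (simp add: A.star_mult A.m_assoc isometry_cancel isometry)
  show ?thesis
    by (rule A.isometry_eqI[OF _ _ isometry 2 1, symmetric]) (use pq in simp_all)
qed

text \<open>Complements make the products in (T4) members, and they provide, for each member killed
  by the canonical map, a projection that the map sends to the unit.\<close>

inductive_set diagonal where
  word: "\<alpha> \<in> neutral_words G P \<Longrightarrow> W \<alpha> \<in> diagonal"
| compl: "d \<in> diagonal \<Longrightarrow> \<one>\<^bsub>A\<^esub> \<ominus>\<^bsub>A\<^esub> d \<in> diagonal"
| meet: "c \<in> diagonal \<Longrightarrow> d \<in> diagonal \<Longrightarrow> c \<otimes>\<^bsub>A\<^esub> d \<in> diagonal"

lemma diagonal_closed [simp]: "d \<in> diagonal \<Longrightarrow> d \<in> carrier A"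
  by (induction rule: diagonal.induct) auto

lemma one_diagonal: "\<one>\<^bsub>A\<^esub> \<in> diagonal"
  using diagonal.word[OF neutral_Nil] by simp

lemma comm_compl:
  assumes "c \<in> carrier A" "d \<in> carrier A" "c \<otimes>\<^bsub>A\<^esub> d = d \<otimes>\<^bsub>A\<^esub> c"
  shows "(\<one>\<^bsub>A\<^esub> \<ominus>\<^bsub>A\<^esub> c) \<otimes>\<^bsub>A\<^esub> d = d \<otimes>\<^bsub>A\<^esub> (\<one>\<^bsub>A\<^esub> \<ominus>\<^bsub>A\<^esub> c)"
  using assms by (simp add: a_minus_def A.l_distr A.r_distr A.l_minus A.r_minus)

lemma comm_meet:
  assumes "c \<in> carrier A" "c' \<in> carrier A" "d \<in> carrier A"
    "c \<otimes>\<^bsub>A\<^esub> d = d \<otimes>\<^bsub>A\<^esub> c" "c' \<otimes>\<^bsub>A\<^esub> d = d \<otimes>\<^bsub>A\<^esub> c'"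
  shows "(c \<otimes>\<^bsub>A\<^esub> c') \<otimes>\<^bsub>A\<^esub> d = d \<otimes>\<^bsub>A\<^esub> (c \<otimes>\<^bsub>A\<^esub> c')"
proof -
  have "(c \<otimes>\<^bsub>A\<^esub> c') \<otimes>\<^bsub>A\<^esub> d = c \<otimes>\<^bsub>A\<^esub> (d \<otimes>\<^bsub>A\<^esub> c')" using assms by (simp add: A.m_assoc)
  also have "\<dots> = d \<otimes>\<^bsub>A\<^esub> c \<otimes>\<^bsub>A\<^esub> c'" using assms by (simp add: A.m_assoc[symmetric])
  finally show ?thesis using assms by (simp add: A.m_assoc)
qed

lemma diagonal_comm:
  assumes "c \<in> diagonal" "d \<in> diagonal"
  shows "c \<otimes>\<^bsub>A\<^esub> d = d \<otimes>\<^bsub>A\<^esub> c"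
proof -
  have w: "d \<otimes>\<^bsub>A\<^esub> W \<alpha> = W \<alpha> \<otimes>\<^bsub>A\<^esub> d" if "d \<in> diagonal" "\<alpha> \<in> neutral_words G P" for d \<alpha>
    using that(1)
  proof (induction rule: diagonal.induct)
    case (word \<beta>)
    thus ?case using W_comm that(2) by blast
  next
    case (compl d)
    thus ?case using comm_compl[of d "W \<alpha>"] that(2) by simp
  next
    case (meet c d)
    thus ?case using comm_meet[of c d "W \<alpha>"] that(2) by simp
  qed
  show ?thesis
    using assms(1)
  proof (induction rule: diagonal.induct)
    case (word \<beta>)
    thus ?case using w assms(2) by simp
  next
    case (compl c)
    thus ?case using comm_compl[of c d] assms(2) by simp
  next
    case (meet c c')
    thus ?case using comm_meet[of c c' d] assms(2) by simp
  qed
qed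

lemma diagonal_star: "d \<in> diagonal \<Longrightarrow> star\<^bsub>A\<^esub> d = d"
proof (induction rule: diagonal.induct)
  case (compl d)
  thus ?case using A.NS.star_diff[of "\<one>\<^bsub>A\<^esub>" d] by (simp add: A.adj_one)
next
  case (meet c d)
  thus ?case using diagonal_comm[OF meet(1,2)] by (simp add: A.star_mult)
qed (rule W_star)

lemma diagonal_idem: "d \<in> diagonal \<Longrightarrow> d \<otimes>\<^bsub>A\<^esub> d = d"
proof (induction rule: diagonal.induct)
  case (word \<alpha>)
  thus ?case using W_mult[of \<alpha> \<alpha> \<alpha>] by simp
next
  case (compl d)
  have "(\<one>\<^bsub>A\<^esub> \<ominus>\<^bsub>A\<^esub> d) \<otimes>\<^bsub>A\<^esub> (\<one>\<^bsub>A\<^esub> \<ominus>\<^bsub>A\<^esub> d) = \<one>\<^bsub>A\<^esub> \<ominus>\<^bsub>A\<^esub> d \<ominus>\<^bsub>A\<^esub> (d \<ominus>\<^bsub>A\<^esub> d \<otimes>\<^bsub>A\<^esub> d)"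
    using diagonal_closed[OF compl(1)]
    by (simp add: a_minus_def A.l_distr A.r_distr A.l_minus A.r_minus A.minus_add A.a_assoc)
  thus ?case using compl by (simp add: a_minus_def A.r_neg)
next
  case (meet c d)
  have "c \<otimes>\<^bsub>A\<^esub> d \<otimes>\<^bsub>A\<^esub> (c \<otimes>\<^bsub>A\<^esub> d) = c \<otimes>\<^bsub>A\<^esub> (d \<otimes>\<^bsub>A\<^esub> c) \<otimes>\<^bsub>A\<^esub> d"
    using meet by (simp add: A.m_assoc)
  also have "\<dots> = c \<otimes>\<^bsub>A\<^esub> (c \<otimes>\<^bsub>A\<^esub> d) \<otimes>\<^bsub>A\<^esub> d" using diagonal_comm[OF meet(1,2)] by simp
  also have "\<dots> = (c \<otimes>\<^bsub>A\<^esub> c) \<otimes>\<^bsub>A\<^esub> (d \<otimes>\<^bsub>A\<^esub> d)" using meet(1,2) by (simp add: A.m_assoc)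
  also have "\<dots> = c \<otimes>\<^bsub>A\<^esub> d" using meet by simp
  finally show ?case .
qed

text \<open>A word operator begins with an adjoint; padding by the identity of the group allows
  \<open>w p\<close> to stand before \<open>ws p\<close>.\<close>

lemma range_diagonal: "p \<in> P \<Longrightarrow> w p \<otimes>\<^bsub>A\<^esub> ws p \<in> diagonal"
  using diagonal.word[of "[\<one>, p, p, \<one>]"]
  by (simp add: neutral_words_def w_one A.adj_one m_assoc[symmetric] A.m_assoc)

text \<open>Words are conjugated by padding with the identity, and complements are preserved because
  \<open>w p\<close> is an isometry. Only meets need an argument, since a range projection appears
  between the factors.\<close>

lemma diagonal_pull:
  assumes "d \<in> diagonal" and p: "p \<in> P"
  shows "ws p \<otimes>\<^bsub>A\<^esub> (d \<otimes>\<^bsub>A\<^esub> w p) \<in> diagonal"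
  using assms(1)
proof (induction rule: diagonal.induct)
  case (word \<alpha>)
  let ?\<beta> = "[p, \<one>] @ \<alpha> @ [\<one>, p]"
  have \<alpha>: "\<alpha> \<in> words P" "word_eval G \<alpha> = \<one>" using word by (auto simp: neutral_words_def)
  have "?\<beta> \<in> neutral_words G P"
    using \<alpha> p by (simp add: neutral_words_def words_append word_eval_append)
  from diagonal.word[OF this] show ?case
    using \<alpha> p by (simp add: W_append w_one A.adj_one words_append)
next
  case (compl d)
  have "ws p \<otimes>\<^bsub>A\<^esub> ((\<one>\<^bsub>A\<^esub> \<ominus>\<^bsub>A\<^esub> d) \<otimes>\<^bsub>A\<^esub> w p) = \<one>\<^bsub>A\<^esub> \<ominus>\<^bsub>A\<^esub> ws p \<otimes>\<^bsub>A\<^esub> (d \<otimes>\<^bsub>A\<^esub> w p)"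
    using compl p by (simp add: a_minus_def A.l_distr A.r_distr A.l_minus A.r_minus isometry)
  thus ?case using diagonal.compl[OF compl(2)] by simp
next
  case (meet c d)
  let ?r = "w p \<otimes>\<^bsub>A\<^esub> ws p"
  have "(ws p \<otimes>\<^bsub>A\<^esub> (c \<otimes>\<^bsub>A\<^esub> w p)) \<otimes>\<^bsub>A\<^esub> (ws p \<otimes>\<^bsub>A\<^esub> (d \<otimes>\<^bsub>A\<^esub> w p)) =
      ws p \<otimes>\<^bsub>A\<^esub> ((c \<otimes>\<^bsub>A\<^esub> ?r) \<otimes>\<^bsub>A\<^esub> (d \<otimes>\<^bsub>A\<^esub> w p))"
    using meet p by (simp add: A.m_assoc)
  \<comment> \<open>Being diagonal, the range projection commutes with \<open>c\<close>; moved to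
    the left, it is absorbed by \<open>ws p\<close>.\<close>
  also have "c \<otimes>\<^bsub>A\<^esub> ?r = ?r \<otimes>\<^bsub>A\<^esub> c" using diagonal_comm[OF meet(1) range_diagonal[OF p]] .
  finally have "(ws p \<otimes>\<^bsub>A\<^esub> (c \<otimes>\<^bsub>A\<^esub> w p)) \<otimes>\<^bsub>A\<^esub> (ws p \<otimes>\<^bsub>A\<^esub> (d \<otimes>\<^bsub>A\<^esub> w p)) =
      ws p \<otimes>\<^bsub>A\<^esub> (c \<otimes>\<^bsub>A\<^esub> d \<otimes>\<^bsub>A\<^esub> w p)"
    using meet p by (simp add: A.m_assoc isometry_cancel)
  thus ?case using diagonal.meet[OF meet(3,4)] by simp
qed

lemma diagonal_push:
  assumes "d \<in> diagonal" and p: "p \<in> P"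
  shows "w p \<otimes>\<^bsub>A\<^esub> (d \<otimes>\<^bsub>A\<^esub> ws p) \<in> diagonal"
  using assms(1)
proof (induction rule: diagonal.induct)
  case (word \<alpha>)
  let ?\<beta> = "[\<one>, p] @ \<alpha> @ [p, \<one>]"
  have \<alpha>: "\<alpha> \<in> words P" "word_eval G \<alpha> = \<one>" using word by (auto simp: neutral_words_def)
  have "?\<beta> \<in> neutral_words G P"
    using \<alpha> p by (simp add: neutral_words_def words_append word_eval_append)
  from diagonal.word[OF this] show ?case
    using \<alpha> p by (simp add: W_append w_one A.adj_one words_append)
next
  case (compl d)
  \<comment> \<open>Here it is the complement that changes: since \<open>w p\<close> need not be
    unitary, a complement is pushed to the complement inside the range projection, which is a
    meet.\<close>
  let ?r = "w p \<otimes>\<^bsub>A\<^esub> ws p" and ?d = "w p \<otimes>\<^bsub>A\<^esub> (d \<otimes>\<^bsub>A\<^esub> ws p)"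
  have "?r \<otimes>\<^bsub>A\<^esub> ?d = ?d" using compl p by (simp add: A.m_assoc isometry_cancel)
  hence "w p \<otimes>\<^bsub>A\<^esub> ((\<one>\<^bsub>A\<^esub> \<ominus>\<^bsub>A\<^esub> d) \<otimes>\<^bsub>A\<^esub> ws p) = ?r \<otimes>\<^bsub>A\<^esub> (\<one>\<^bsub>A\<^esub> \<ominus>\<^bsub>A\<^esub> ?d)"
    using compl p by (simp add: a_minus_def A.l_distr A.r_distr A.l_minus A.r_minus)
  thus ?case using diagonal.meet[OF range_diagonal[OF p] diagonal.compl[OF compl(2)]] by simp
next
  case (meet c d)
  have "(w p \<otimes>\<^bsub>A\<^esub> (c \<otimes>\<^bsub>A\<^esub> ws p)) \<otimes>\<^bsub>A\<^esub> (w p \<otimes>\<^bsub>A\<^esub> (d \<otimes>\<^bsub>A\<^esub> ws p)) =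
      w p \<otimes>\<^bsub>A\<^esub> (c \<otimes>\<^bsub>A\<^esub> d \<otimes>\<^bsub>A\<^esub> ws p)"
    using meet p by (simp add: A.m_assoc isometry_cancel)
  thus ?case using diagonal.meet[OF meet(3,4)] by simp
qed

text \<open>The projection of the smaller ideal lies below the other one, so the difference is the
  meet of \<open>W \<alpha>\<close> with the complement of \<open>W \<beta>\<close>.\<close>

lemma diff_diagonal:
  assumes "\<alpha> \<in> neutral_words G P" "\<beta> \<in> neutral_words G P"
    and sub: "constr_ideal G P \<beta> \<subseteq> constr_ideal G P \<alpha>"
  shows "W \<alpha> \<ominus>\<^bsub>A\<^esub> W \<beta> \<in> diagonal"
proof -
  have "W \<alpha> \<otimes>\<^bsub>A\<^esub> W \<beta> = W \<beta>" using W_mult[of \<alpha> \<beta> \<beta>] assms by blast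
  hence "W \<alpha> \<ominus>\<^bsub>A\<^esub> W \<beta> = W \<alpha> \<otimes>\<^bsub>A\<^esub> (\<one>\<^bsub>A\<^esub> \<ominus>\<^bsub>A\<^esub> W \<beta>)"
    using assms by (simp add: a_minus_def A.r_distr A.r_minus)
  thus ?thesis using assms by (simp add: diagonal.intros)
qed

lemma gap_diagonal:
  assumes "\<alpha> \<in> neutral_words G P" "set \<beta>s \<subseteq> neutral_words G P"
    "\<And>\<beta>. \<beta> \<in> set \<beta>s \<Longrightarrow> constr_ideal G P \<beta> \<subseteq> constr_ideal G P \<alpha>"
  shows "foldr (\<otimes>\<^bsub>A\<^esub>) (map (\<lambda>\<beta>. W \<alpha> \<ominus>\<^bsub>A\<^esub> W \<beta>) \<beta>s) \<one>\<^bsub>A\<^esub> \<in> diagonal"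
  using assms(2,3)
  by (induction \<beta>s) (auto simp: one_diagonal intro!: diagonal.meet diff_diagonal assms(1))

end


section \<open>Li's algebra and the Toeplitz algebra\<close>

context diagonal_family begin

text \<open>For the absorption hypothesis of \<open>corner_seminorm\<close> at a generator, the
  witness is the pulled back projection. It is absorbed because the range projection of
  \<open>w p\<close> commutes with the idempotent \<open>c\<close>.\<close>

lemma absorb_isometry:
  assumes "c \<in> diagonal" "p \<in> P"
  shows "w p \<otimes>\<^bsub>A\<^esub> (ws p \<otimes>\<^bsub>A\<^esub> (c \<otimes>\<^bsub>A\<^esub> w p)) = c \<otimes>\<^bsub>A\<^esub> (w p \<otimes>\<^bsub>A\<^esub> (ws p \<otimes>\<^bsub>A\<^esub> (c \<otimes>\<^bsub>A\<^esub> w p)))"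
proof -
  let ?r = "w p \<otimes>\<^bsub>A\<^esub> ws p"
  have "c \<otimes>\<^bsub>A\<^esub> (w p \<otimes>\<^bsub>A\<^esub> (ws p \<otimes>\<^bsub>A\<^esub> (c \<otimes>\<^bsub>A\<^esub> w p))) = (c \<otimes>\<^bsub>A\<^esub> ?r) \<otimes>\<^bsub>A\<^esub> (c \<otimes>\<^bsub>A\<^esub> w p)"
    using assms by (simp add: A.m_assoc)
  also have "c \<otimes>\<^bsub>A\<^esub> ?r = ?r \<otimes>\<^bsub>A\<^esub> c" using assms by (intro diagonal_comm range_diagonal)
  also have "(?r \<otimes>\<^bsub>A\<^esub> c) \<otimes>\<^bsub>A\<^esub> (c \<otimes>\<^bsub>A\<^esub> w p) = ?r \<otimes>\<^bsub>A\<^esub> (c \<otimes>\<^bsub>A\<^esub> c) \<otimes>\<^bsub>A\<^esub> w p"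
    using assms by (simp add: A.m_assoc)
  also have "\<dots> = w p \<otimes>\<^bsub>A\<^esub> (ws p \<otimes>\<^bsub>A\<^esub> (c \<otimes>\<^bsub>A\<^esub> w p))"
    using assms by (simp add: diagonal_idem A.m_assoc)
  finally show ?thesis ..
qed

text \<open>The witness at the adjoint of a generator. Pushing \<open>c\<close> forward would
  satisfy the same identity, but if \<Lambda> sends \<open>c\<close> to the unit, it sends the push
  to a range projection, in general not the unit. Taking complements before and after the push
  repairs this and still gives \<open>ws p \<otimes> d = c \<otimes> ws p\<close>.\<close>

lemma absorb_adjoint:
  assumes "c \<in> diagonal" "p \<in> P"
  defines "d \<equiv> \<one>\<^bsub>A\<^esub> \<ominus>\<^bsub>A\<^esub> w p \<otimes>\<^bsub>A\<^esub> ((\<one>\<^bsub>A\<^esub> \<ominus>\<^bsub>A\<^esub> c) \<otimes>\<^bsub>A\<^esub> ws p)"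
  shows "ws p \<otimes>\<^bsub>A\<^esub> d = c \<otimes>\<^bsub>A\<^esub> (ws p \<otimes>\<^bsub>A\<^esub> d)"
proof -
  have "ws p \<otimes>\<^bsub>A\<^esub> d = ws p \<ominus>\<^bsub>A\<^esub> (\<one>\<^bsub>A\<^esub> \<ominus>\<^bsub>A\<^esub> c) \<otimes>\<^bsub>A\<^esub> ws p"
    using assms(1,2) unfolding d_def
    by (simp add: a_minus_def[of A "\<one>\<^bsub>A\<^esub>" "w p \<otimes>\<^bsub>A\<^esub> x" for x] a_minus_def[of A "ws p"]
        A.r_distr A.r_minus isometry_cancel)
  also have "\<dots> = c \<otimes>\<^bsub>A\<^esub> ws p"
    using assms(1,2) by (simp add: a_minus_def A.l_distr A.l_minus A.minus_add A.r_neg2 A.r_neg)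
  finally have "ws p \<otimes>\<^bsub>A\<^esub> d = c \<otimes>\<^bsub>A\<^esub> ws p" .
  thus ?thesis using assms(1,2) by (simp add: A.m_assoc[symmetric] diagonal_idem)
qed

text \<open>Junk at sets that are not constructible, where the choice ranges over an empty predicate.\<close>

definition ideal_proj where
  "ideal_proj S = (if S = {} then \<zero>\<^bsub>A\<^esub> else W (SOME \<alpha>. \<alpha> \<in> neutral_words G P \<and> constr_ideal G P \<alpha> = S))"

lemma ideal_proj_word:
  assumes "\<alpha> \<in> neutral_words G P" "constr_ideal G P \<alpha> \<noteq> {}"
  shows "ideal_proj (constr_ideal G P \<alpha>) = W \<alpha>"
proof -
  let ?Q = "\<lambda>\<beta>. \<beta> \<in> neutral_words G P \<and> constr_ideal G P \<beta> = constr_ideal G P \<alpha>"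
  define \<gamma> where "\<gamma> = (SOME \<beta>. ?Q \<beta>)"
  have "?Q \<gamma>" unfolding \<gamma>_def by (rule someI[of ?Q \<alpha>]) (use assms in simp)
  hence "W \<gamma> = W \<alpha>" using w_word[of \<gamma> \<alpha>] assms(1) by blast
  thus ?thesis using assms(2) by (simp add: ideal_proj_def \<gamma>_def)
qed

text \<open>Word operators serve as Li's projections, and multiplicativity is \<open>w_mult\<close>.
  The hypothesis is (T2): the projection of the empty set is zero by definition, and words with
  empty ideal have to agree with it.\<close>

lemma li_relators_vanish:
  assumes empty: "\<And>\<alpha>. \<alpha> \<in> neutral_words G P \<Longrightarrow> constr_ideal G P \<alpha> = {} \<Longrightarrow> W \<alpha> = \<zero>\<^bsub>A\<^esub>"
  shows "li_relators G P A w ideal_proj \<subseteq> {\<zero>\<^bsub>A\<^esub>}"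
    and "ideal_proj \<in> constr_ideals G P \<union> {{}} \<rightarrow> carrier A"
proof -
  have z: "star\<^bsub>A\<^esub> \<zero>\<^bsub>A\<^esub> = \<zero>\<^bsub>A\<^esub>"
    using A.star_add[of "\<zero>\<^bsub>A\<^esub>" "\<zero>\<^bsub>A\<^esub>"] A.star_closed[of "\<zero>\<^bsub>A\<^esub>"] by simp
  have word: "ideal_proj (constr_ideal G P \<alpha>) = W \<alpha>" if "\<alpha> \<in> neutral_words G P" for \<alpha>
    using ideal_proj_word[OF that] empty[OF that] by (auto simp: ideal_proj_def)
  have e: "ideal_proj S \<in> carrier A \<and> star\<^bsub>A\<^esub> (ideal_proj S) = ideal_proj S \<and>
      ideal_proj S \<otimes>\<^bsub>A\<^esub> ideal_proj S = ideal_proj S" if "S \<in> constr_ideals G P \<union> {{}}" for S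
  proof (cases "S = {}")
    case True
    thus ?thesis by (simp add: ideal_proj_def z)
  next
    case False
    then obtain \<alpha> where "\<alpha> \<in> neutral_words G P" "S = constr_ideal G P \<alpha>"
      using \<open>S \<in> constr_ideals G P \<union> {{}}\<close> unfolding constr_ideals_neutral by blast
    thus ?thesis
      using word[of \<alpha>] diagonal_star[OF diagonal.word] diagonal_idem[OF diagonal.word] by simp
  qed
  thus "ideal_proj \<in> constr_ideals G P \<union> {{}} \<rightarrow> carrier A" by blast
  have "ideal_proj {} = \<zero>\<^bsub>A\<^esub>" by (simp add: ideal_proj_def)
  thus "li_relators G P A w ideal_proj \<subseteq> {\<zero>\<^bsub>A\<^esub>}"
    unfolding li_relators_def using e word by (auto simp: isometry w_mult z)
qed

end

section \<open>Both algebras as diagonal families, and the canonical map\<close>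

context submonoid_of_group begin

lemma li_gens_iff:
  "Isom p \<in> li_gens G P \<longleftrightarrow> p \<in> P"
  "Proj S \<in> li_gens G P \<longleftrightarrow> S \<in> constr_ideals G P \<union> {{}}"
  by (auto simp: li_gens_def)

text \<open>Adds to \<open>li_algebra_universal\<close> the norm bound that stands in for continuity
  in the arguments below.\<close>

lemma li_contractive_hom:
  fixes B :: "('z, 'k) cstar_algebra_scheme"
  assumes B: "unital_cstar_algebra B" and v: "v \<in> P \<rightarrow> carrier B"
    and e: "e \<in> constr_ideals G P \<union> {{}} \<rightarrow> carrier B"
    and rel: "li_relators G P B v e \<subseteq> {\<zero>\<^bsub>B\<^esub>}"
  shows "\<exists>\<phi>\<in>star_hom (li_algebra G P) B. (\<forall>p\<in>P. \<phi> (li_isom G P p) = v p) \<and>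
    (\<forall>a\<in>carrier (li_algebra G P). cnorm B (\<phi> a) \<le> cnorm (li_algebra G P) a)"
proof -
  interpret B: unital_cstar_algebra B by fact
  interpret bounded_presentation "li_gens G P" "li_rels G P" by (rule li_presentation)
  define g where "g x = (if x \<in> li_gens G P then case x of Isom p \<Rightarrow> v p | Proj S \<Rightarrow> e S else \<zero>\<^bsub>B\<^esub>)" for x
  have gi: "g (Isom p) = v p" if "p \<in> P" for p using that by (auto simp: g_def li_gens_def)
  have gp: "g (Proj S) = e S" if "S \<in> constr_ideals G P \<union> {{}}" for S
    using that by (auto simp: g_def li_gens_def)
  have g: "g x \<in> carrier B" for x using v e by (auto simp: g_def li_gens_def)
  note h = poly_val_hom[where g = g, OF B.unital_star_algebra_axioms g]
  have "poly_val B g ` li_rels G P = li_relators G P B v e"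
    unfolding li_rels_def
    by (rule li_relators_hom(2)[OF h(1)]) (auto simp: li_gens_def h(2) gi gp intro!: poly_gen_carrier)
  hence z: "poly_val B g r = \<zero>\<^bsub>B\<^esub>" if "r \<in> li_rels G P" for r using that rel by blast
  from contractive_extension[OF B star_algebra_hom.hom[OF h(1)] z]
  obtain \<phi> where \<phi>: "\<phi> \<in> star_hom (li_algebra G P) B"
    "\<forall>f\<in>carrier FA. \<phi> (completion_incl FA US f) = poly_val B g f"
    "\<forall>a\<in>carrier (li_algebra G P). cnorm B (\<phi> a) \<le> cnorm (li_algebra G P) a"
    unfolding li_algebra_def by blast
  have "\<phi> (li_isom G P p) = v p" if p: "p \<in> P" for p
    using \<phi>(2)[rule_format, OF poly_gen_carrier, of "Isom p"] p
    by (simp add: li_isom_def universal_gen_incl[symmetric] li_gens_iff h(2) gi)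
  thus ?thesis using \<phi>(1,3) by (intro bexI[of _ \<phi>]) simp_all
qed

lemma toeplitz_contractive_hom:
  fixes B :: "('z, 'k) cstar_algebra_scheme"
  assumes B: "unital_cstar_algebra B" and t: "t \<in> P \<rightarrow> carrier B"
    and rel: "toeplitz_relators G P B t \<subseteq> {\<zero>\<^bsub>B\<^esub>}"
  shows "\<exists>\<phi>\<in>star_hom (toeplitz_algebra G P) B. (\<forall>p\<in>P. \<phi> (toeplitz_gen G P p) = t p) \<and>
    (\<forall>a\<in>carrier (toeplitz_algebra G P). cnorm B (\<phi> a) \<le> cnorm (toeplitz_algebra G P) a)"
proof -
  interpret B: unital_cstar_algebra B by fact
  interpret bounded_presentation P "toeplitz_rels G P" by (rule toeplitz_presentation)
  define g where "g x = (if x \<in> P then t x else \<zero>\<^bsub>B\<^esub>)" for x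
  have gt: "g p = t p" if "p \<in> P" for p using that by (simp add: g_def)
  have g: "g x \<in> carrier B" for x using t by (auto simp: g_def)
  note h = poly_val_hom[where g = g, OF B.unital_star_algebra_axioms g]
  have "poly_val B g ` toeplitz_rels G P = toeplitz_relators G P B t"
    unfolding toeplitz_rels_def
    by (rule toeplitz_relators_hom(2)[OF h(1)]) (simp_all add: h(2) gt poly_gen_carrier)
  hence z: "poly_val B g r = \<zero>\<^bsub>B\<^esub>" if "r \<in> toeplitz_rels G P" for r using that rel by blast
  from contractive_extension[OF B star_algebra_hom.hom[OF h(1)] z]
  obtain \<phi> where \<phi>: "\<phi> \<in> star_hom (toeplitz_algebra G P) B"
    "\<forall>f\<in>carrier FA. \<phi> (completion_incl FA US f) = poly_val B g f"
    "\<forall>a\<in>carrier (toeplitz_algebra G P). cnorm B (\<phi> a) \<le> cnorm (toeplitz_algebra G P) a"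
    unfolding toeplitz_algebra_def by blast
  have "\<phi> (toeplitz_gen G P p) = t p" if p: "p \<in> P" for p
    using \<phi>(2)[rule_format, OF poly_gen_carrier, of p] p
    by (simp add: toeplitz_gen_def universal_gen_incl[symmetric] h(2) gt)
  thus ?thesis using \<phi>(1,3) by (intro bexI[of _ \<phi>]) simp_all
qed

lemma li_isom_closed: "p \<in> P \<Longrightarrow> li_isom G P p \<in> carrier (li_algebra G P)"
proof -
  interpret bounded_presentation "li_gens G P" "li_rels G P" by (rule li_presentation)
  show "p \<in> P \<Longrightarrow> ?thesis"
    using star_hom_simps(1)[OF incl_hom poly_gen_carrier, of "Isom p"]
    by (simp add: li_isom_def li_algebra_def universal_gen_incl li_gens_iff)
qed

lemma li_proj_closed:
  "S \<in> constr_ideals G P \<union> {{}} \<Longrightarrow> li_proj G P S \<in> carrier (li_algebra G P)"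
proof -
  interpret bounded_presentation "li_gens G P" "li_rels G P" by (rule li_presentation)
  show "S \<in> constr_ideals G P \<union> {{}} \<Longrightarrow> ?thesis"
    using star_hom_simps(1)[OF incl_hom poly_gen_carrier, of "Proj S"]
    by (simp add: li_proj_def li_algebra_def universal_gen_incl li_gens_iff)
qed

lemma toeplitz_gen_closed: "p \<in> P \<Longrightarrow> toeplitz_gen G P p \<in> carrier (toeplitz_algebra G P)"
proof -
  interpret bounded_presentation P "toeplitz_rels G P" by (rule toeplitz_presentation)
  show "p \<in> P \<Longrightarrow> ?thesis"
    using star_hom_simps(1)[OF incl_hom poly_gen_carrier, of p]
    by (simp add: toeplitz_gen_def toeplitz_algebra_def universal_gen_incl)
qed

lemma li_word:
  assumes "\<alpha> \<in> neutral_words G P"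
  shows "word_op (li_algebra G P) (li_isom G P) \<alpha> = li_proj G P (constr_ideal G P \<alpha>)"
proof -
  let ?L = "li_algebra G P"
  interpret L: unital_cstar_algebra ?L by (rule li_algebra_cstar)
  have "constr_ideal G P \<alpha> \<in> constr_ideals G P" using assms by (simp add: constr_ideals_neutral)
  hence "word_op ?L (li_isom G P) \<alpha> \<ominus>\<^bsub>?L\<^esub> li_proj G P (constr_ideal G P \<alpha>) \<in>
      li_relators G P ?L (li_isom G P) (li_proj G P)"
    unfolding li_relators_def using assms by blast
  moreover have "word_op ?L (li_isom G P) \<alpha> \<in> carrier ?L"
    by (rule L.word_op_closed[OF li_isom_closed neutral_words_words[OF assms]])
  moreover have "li_proj G P (constr_ideal G P \<alpha>) \<in> carrier ?L"
    using assms by (intro li_proj_closed) (simp add: constr_ideals_neutral)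
  ultimately show ?thesis unfolding li_algebra_relations by simp
qed

lemma li_proj_empty: "li_proj G P {} = \<zero>\<^bsub>li_algebra G P\<^esub>"
proof -
  have "li_proj G P {} \<in> li_relators G P (li_algebra G P) (li_isom G P) (li_proj G P)"
    by (simp add: li_relators_def)
  thus ?thesis unfolding li_algebra_relations by simp
qed

lemma li_family: "diagonal_family G P (li_algebra G P) (li_isom G P)"
proof -
  let ?L = "li_algebra G P" and ?v = "li_isom G P"
  interpret L: unital_cstar_algebra ?L by (rule li_algebra_cstar)
  have one_P: "\<one> \<in> P" by simp
  have v1: "?v \<one> \<in> carrier ?L" by (simp add: li_isom_closed)
  have s1: "star\<^bsub>?L\<^esub> (?v \<one>) \<in> carrier ?L" using v1 by (rule L.star_closed)
  have "star\<^bsub>?L\<^esub> (?v \<one>) \<otimes>\<^bsub>?L\<^esub> ?v \<one> \<ominus>\<^bsub>?L\<^esub> \<one>\<^bsub>?L\<^esub> \<in> li_relators G P ?L ?v (li_proj G P)"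
    by (rule li_relators_isom) simp
  hence iso: "star\<^bsub>?L\<^esub> (?v \<one>) \<otimes>\<^bsub>?L\<^esub> ?v \<one> = \<one>\<^bsub>?L\<^esub>"
    unfolding li_algebra_relations using v1 s1 by simp
  have "?v \<one> \<otimes>\<^bsub>?L\<^esub> ?v \<one> \<ominus>\<^bsub>?L\<^esub> ?v (\<one> \<otimes> \<one>) \<in> li_relators G P ?L ?v (li_proj G P)"
    unfolding li_relators_def by (rule UnI1, rule UnI1, rule UnI2) (use one_P in blast)
  \<comment> \<open>An idempotent isometry is the unit, as multiplication by its adjoint
    shows.\<close>
  hence "?v \<one> \<otimes>\<^bsub>?L\<^esub> ?v \<one> = ?v \<one>" unfolding li_algebra_relations using v1 by simp
  hence "star\<^bsub>?L\<^esub> (?v \<one>) \<otimes>\<^bsub>?L\<^esub> ?v \<one> \<otimes>\<^bsub>?L\<^esub> ?v \<one> = star\<^bsub>?L\<^esub> (?v \<one>) \<otimes>\<^bsub>?L\<^esub> ?v \<one>"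
    using v1 s1 by (simp add: L.m_assoc)
  hence one: "?v \<one> = \<one>\<^bsub>?L\<^esub>" unfolding iso using v1 by simp
  show ?thesis
    by unfold_locales (simp_all add: li_isom_closed one li_word)
qed

lemma toeplitz_relation:
  "r \<in> toeplitz_relators G P (toeplitz_algebra G P) (toeplitz_gen G P) \<Longrightarrow> r = \<zero>\<^bsub>toeplitz_algebra G P\<^esub>"
  by (simp add: toeplitz_algebra_relations)

lemma toeplitz_family: "diagonal_family G P (toeplitz_algebra G P) (toeplitz_gen G P)"
proof -
  let ?T = "toeplitz_algebra G P" and ?t = "toeplitz_gen G P"
  interpret T: unital_cstar_algebra ?T by (rule toeplitz_algebra_cstar)
  have W: "word_op ?T ?t \<alpha> \<in> carrier ?T" if "\<alpha> \<in> neutral_words G P" for \<alpha>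
    by (rule T.word_op_closed[OF toeplitz_gen_closed neutral_words_words[OF that]])
  have "?t \<one> \<ominus>\<^bsub>?T\<^esub> \<one>\<^bsub>?T\<^esub> = \<zero>\<^bsub>?T\<^esub>"
    by (rule toeplitz_relation) (simp add: toeplitz_relators_def)
  hence one: "?t \<one> = \<one>\<^bsub>?T\<^esub>" by (simp add: toeplitz_gen_closed)
  have "word_op ?T ?t \<alpha> = word_op ?T ?t \<beta>"
    if "\<alpha> \<in> neutral_words G P" "\<beta> \<in> neutral_words G P" "constr_ideal G P \<alpha> = constr_ideal G P \<beta>" for \<alpha> \<beta>
  proof -
    have d: "word_op ?T ?t \<alpha> \<ominus>\<^bsub>?T\<^esub> word_op ?T ?t \<beta> = \<zero>\<^bsub>?T\<^esub>"
      by (rule toeplitz_relation, unfold toeplitz_relators_def, rule UnI1, rule UnI2)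
        (intro CollectI exI[of _ \<alpha>] exI[of _ \<beta>] conjI refl that)
    show ?thesis using iffD1[OF T.r_right_minus_eq d] W that by blast
  qed
  note word = this
  show ?thesis
    by unfold_locales (fact toeplitz_gen_closed, fact one, fact word)
qed

text \<open>Relation (T2) is what allows the projection of the empty set to go to zero; the other
  relations of Li hold in any diagonal family.\<close>

lemma canonical_hom:
  "\<exists>\<Lambda>\<in>star_hom (li_algebra G P) (toeplitz_algebra G P).
    (\<forall>p\<in>P. \<Lambda> (li_isom G P p) = toeplitz_gen G P p) \<and>
    (\<forall>a\<in>carrier (li_algebra G P). cnorm (toeplitz_algebra G P) (\<Lambda> a) \<le> cnorm (li_algebra G P) a)"
proof -
  interpret T: diagonal_family G P "toeplitz_algebra G P" "toeplitz_gen G P" by (rule toeplitz_family)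
  have z: "T.W \<alpha> = \<zero>\<^bsub>toeplitz_algebra G P\<^esub>" if "\<alpha> \<in> neutral_words G P" "constr_ideal G P \<alpha> = {}" for \<alpha>
    by (rule toeplitz_relation, unfold toeplitz_relators_def, rule UnI1, rule UnI1, rule UnI2)
      (intro CollectI exI[of _ \<alpha>] conjI refl that)
  have t: "toeplitz_gen G P \<in> P \<rightarrow> carrier (toeplitz_algebra G P)" by (auto simp: toeplitz_gen_closed)
  have rel: "li_relators G P (toeplitz_algebra G P) (toeplitz_gen G P) T.ideal_proj \<subseteq> {\<zero>\<^bsub>toeplitz_algebra G P\<^esub>}"
    by (rule T.li_relators_vanish(1), rule z)
  have e: "T.ideal_proj \<in> constr_ideals G P \<union> {{}} \<rightarrow> carrier (toeplitz_algebra G P)"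
    by (rule T.li_relators_vanish(2), rule z)
  show ?thesis by (rule li_contractive_hom[OF toeplitz_algebra_cstar t e rel])
qed

end


section \<open>Surjectivity\<close>

context submonoid_of_group begin

text \<open>In Li's algebra a Toeplitz relator need not vanish, but it is always a diagonal
  projection. So it is annihilated by its complement, which is how the cut-down seminorm comes to
  vanish on it.\<close>

lemma toeplitz_relators_diagonal:
  assumes "diagonal_family G P A w" and r: "r \<in> toeplitz_relators G P A w"
  shows "r \<in> diagonal_family.diagonal G P A w"
proof -
  interpret diagonal_family G P A w by fact
  from r show ?thesis
    unfolding toeplitz_relators_def
  proof (elim UnE)
    assume "r \<in> {w \<one> \<ominus>\<^bsub>A\<^esub> \<one>\<^bsub>A\<^esub>}"
    thus ?thesis using diagonal.compl[OF one_diagonal] by (simp add: w_one)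
  next
    assume "r \<in> {W \<alpha> | \<alpha>. \<alpha> \<in> neutral_words G P \<and> constr_ideal G P \<alpha> = {}}"
    thus ?thesis using diagonal.word by blast
  next
    assume "r \<in> {W \<alpha> \<ominus>\<^bsub>A\<^esub> W \<beta> | \<alpha> \<beta>. \<alpha> \<in> neutral_words G P \<and>
        \<beta> \<in> neutral_words G P \<and> constr_ideal G P \<alpha> = constr_ideal G P \<beta>}"
    then obtain \<alpha> \<beta> where ab: "r = W \<alpha> \<ominus>\<^bsub>A\<^esub> W \<beta>" "\<alpha> \<in> neutral_words G P"
        "\<beta> \<in> neutral_words G P" "constr_ideal G P \<alpha> = constr_ideal G P \<beta>" by blast
    show ?thesis unfolding ab(1) by (rule diff_diagonal[OF ab(2,3)]) (simp add: ab(4))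
  next
    assume "r \<in> {foldr (\<otimes>\<^bsub>A\<^esub>) (map (\<lambda>\<beta>. W \<alpha> \<ominus>\<^bsub>A\<^esub> W \<beta>) \<beta>s) \<one>\<^bsub>A\<^esub> | \<alpha> \<beta>s.
        \<alpha> \<in> neutral_words G P \<and> \<beta>s \<noteq> [] \<and> distinct \<beta>s \<and> set \<beta>s \<subseteq> neutral_words G P \<and>
        constr_ideal G P \<alpha> = (\<Union>\<beta>\<in>set \<beta>s. constr_ideal G P \<beta>)}"
    then obtain \<alpha> \<beta>s where ab: "r = foldr (\<otimes>\<^bsub>A\<^esub>) (map (\<lambda>\<beta>. W \<alpha> \<ominus>\<^bsub>A\<^esub> W \<beta>) \<beta>s) \<one>\<^bsub>A\<^esub>"
        "\<alpha> \<in> neutral_words G P" "set \<beta>s \<subseteq> neutral_words G P"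
        "constr_ideal G P \<alpha> = (\<Union>\<beta>\<in>set \<beta>s. constr_ideal G P \<beta>)" by blast
    show ?thesis unfolding ab(1) by (rule gap_diagonal[OF ab(2,3)]) (use ab(4) in blast)
  qed
qed

text \<open>Cutting \<open>C\<^sup>*\<^sub>s(P)\<close> down by the diagonal projections that \<open>\<Lambda>\<close> maps to \<open>1\<close> yields a seminorm
  admissible for the Toeplitz presentation, hence dominated by the universal one.  So polynomials
  in the \<open>t\<^sub>p\<close> have almost contractive lifts.\<close>

lemma canonical_hom_surj:
  assumes \<Lambda>: "\<Lambda> \<in> star_hom (li_algebra G P) (toeplitz_algebra G P)"
    and gen: "\<And>p. p \<in> P \<Longrightarrow> \<Lambda> (li_isom G P p) = toeplitz_gen G P p"
    and con: "\<And>a. a \<in> carrier (li_algebra G P) \<Longrightarrow>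
      cnorm (toeplitz_algebra G P) (\<Lambda> a) \<le> cnorm (li_algebra G P) a"
  shows "\<Lambda> ` carrier (li_algebra G P) = carrier (toeplitz_algebra G P)"
proof -
  let ?L = "li_algebra G P" and ?T = "toeplitz_algebra G P"
  interpret L: diagonal_family G P ?L "li_isom G P" by (rule li_family)
  interpret T: diagonal_family G P ?T "toeplitz_gen G P" by (rule toeplitz_family)
  interpret bounded_presentation P "toeplitz_rels G P" by (rule toeplitz_presentation)
  interpret \<Lambda>: star_algebra_hom ?L ?T \<Lambda> by unfold_locales (rule \<Lambda>)
  interpret F: unital_star_algebra FA by (rule free_unital_star_algebra)
  let ?i = "completion_incl FA US"
  define C where "C = {c \<in> L.diagonal. \<Lambda> c = \<one>\<^bsub>?T\<^esub>}"
  have C: "c \<in> L.diagonal" "c \<in> carrier ?L" "\<Lambda> c = \<one>\<^bsub>?T\<^esub>" if "c \<in> C" for c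
    using that by (auto simp: C_def)
  \<comment> \<open>The default value zero off \<open>P\<close> is there because
    \<open>poly_val_hom\<close> asks for values in the carrier at every argument.\<close>
  define g where "g p = (if p \<in> P then li_isom G P p else \<zero>\<^bsub>?L\<^esub>)" for p
  have g: "g p \<in> carrier ?L" for p by (simp add: g_def)
  define \<pi> where "\<pi> = poly_val ?L g"
  note pv = poly_val_hom[where g = g, OF L.A.unital_star_algebra_axioms g, folded \<pi>_def]
  have \<pi>: "\<pi> \<in> star_hom FA ?L" by (rule star_algebra_hom.hom[OF pv(1)])
  note \<pi>s = star_hom_simps[OF \<pi>, simplified]
  have \<pi>_gen: "\<pi> (poly_gen p) = li_isom G P p" if "p \<in> P" for p using that by (simp add: pv(2) g_def)
  have \<pi>_adj: "\<pi> (star_poly_adj (poly_gen p)) = L.ws p" if "p \<in> P" for p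
    using that \<pi>s(6)[OF poly_gen_carrier[OF that]] by (simp add: \<pi>_gen)
  \<comment> \<open>Evaluating a polynomial in Li's algebra gives a lift of its class in the
    Toeplitz algebra, though not yet one of small norm.\<close>
  have lift: "\<Lambda> (\<pi> f) = ?i f" if "f \<in> carrier FA" for f
    using star_hom_free_eqI[OF star_hom_comp[OF \<pi> \<Lambda>], of ?i f] incl_hom that
    by (simp add: \<pi>_gen gen toeplitz_algebra_def toeplitz_gen_def universal_gen_incl)
  have one_minus_zero: "\<one>\<^bsub>?T\<^esub> \<ominus>\<^bsub>?T\<^esub> \<zero>\<^bsub>?T\<^esub> = \<one>\<^bsub>?T\<^esub>" by (simp add: a_minus_def)
  have one_C: "\<one>\<^bsub>?L\<^esub> \<in> C" by (simp add: C_def L.one_diagonal \<Lambda>.h_simps)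
  have meet: "c \<otimes>\<^bsub>?L\<^esub> d \<in> C" if "c \<in> C" "d \<in> C" for c d
    using C[OF that(1)] C[OF that(2)] by (simp add: C_def L.diagonal.meet \<Lambda>.h_simps)
  \<comment> \<open>The quantifier over \<open>c\<close> stays inside the induction, since the
    product case applies the hypothesis for the second factor to the projection obtained from the
    first.\<close>
  have absorb: "\<forall>c\<in>C. \<exists>d\<in>C. \<pi> f \<otimes>\<^bsub>?L\<^esub> d = c \<otimes>\<^bsub>?L\<^esub> (\<pi> f \<otimes>\<^bsub>?L\<^esub> d)" if "f \<in> carrier FA" for f
    using that
  proof (induction f rule: free_star_algebra_induct)
    case one
    show ?case
      by (intro ballI bexI[where P = "\<lambda>d. \<pi> 1 \<otimes>\<^bsub>?L\<^esub> d = c \<otimes>\<^bsub>?L\<^esub> (\<pi> 1 \<otimes>\<^bsub>?L\<^esub> d)" for c])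
        (use C in \<open>auto simp: \<pi>s L.diagonal_idem\<close>)
  next
    case (gen p)
    show ?case
    proof
      fix c assume c: "c \<in> C"
      have "L.ws p \<otimes>\<^bsub>?L\<^esub> (c \<otimes>\<^bsub>?L\<^esub> li_isom G P p) \<in> C"
        using C[OF c] gen L.diagonal_pull[OF C(1)[OF c] gen] T.isometry[OF gen] assms(2)[OF gen]
        by (simp add: C_def \<Lambda>.h_simps)
      thus "\<exists>d\<in>C. \<pi> (poly_gen p) \<otimes>\<^bsub>?L\<^esub> d = c \<otimes>\<^bsub>?L\<^esub> (\<pi> (poly_gen p) \<otimes>\<^bsub>?L\<^esub> d)"
        unfolding \<pi>_gen[OF gen] using L.absorb_isometry[OF C(1)[OF c] gen] by blast
    qed
  next
    case (adj p)
    show ?case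
    proof
      fix c assume c: "c \<in> C"
      let ?d = "\<one>\<^bsub>?L\<^esub> \<ominus>\<^bsub>?L\<^esub> li_isom G P p \<otimes>\<^bsub>?L\<^esub> ((\<one>\<^bsub>?L\<^esub> \<ominus>\<^bsub>?L\<^esub> c) \<otimes>\<^bsub>?L\<^esub> L.ws p)"
      have "\<Lambda> (\<one>\<^bsub>?L\<^esub> \<ominus>\<^bsub>?L\<^esub> c) = \<zero>\<^bsub>?T\<^esub>" using C[OF c] by (simp add: \<Lambda>.h_minus \<Lambda>.h_simps)
      hence "\<Lambda> (li_isom G P p \<otimes>\<^bsub>?L\<^esub> ((\<one>\<^bsub>?L\<^esub> \<ominus>\<^bsub>?L\<^esub> c) \<otimes>\<^bsub>?L\<^esub> L.ws p)) = \<zero>\<^bsub>?T\<^esub>"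
        using C[OF c] adj by (simp add: \<Lambda>.h_simps gen)
      hence "\<Lambda> ?d = \<one>\<^bsub>?T\<^esub>"
        using C[OF c] adj by (simp add: \<Lambda>.h_minus \<Lambda>.h_simps(4) one_minus_zero)
      moreover have "?d \<in> L.diagonal"
        by (intro L.diagonal.compl L.diagonal_push C(1)[OF c] adj)
      ultimately have "?d \<in> C" by (simp add: C_def)
      thus "\<exists>d\<in>C. \<pi> (star_poly_adj (poly_gen p)) \<otimes>\<^bsub>?L\<^esub> d =
          c \<otimes>\<^bsub>?L\<^esub> (\<pi> (star_poly_adj (poly_gen p)) \<otimes>\<^bsub>?L\<^esub> d)"
        unfolding \<pi>_adj[OF adj] using L.absorb_adjoint[OF C(1)[OF c] adj] by blast
    qed
  next
    case (smult k f)
    show ?case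
    proof
      fix c assume c: "c \<in> C"
      then obtain d where d: "d \<in> C" "\<pi> f \<otimes>\<^bsub>?L\<^esub> d = c \<otimes>\<^bsub>?L\<^esub> (\<pi> f \<otimes>\<^bsub>?L\<^esub> d)" using smult by blast
      have "k \<odot>\<^bsub>?L\<^esub> (\<pi> f \<otimes>\<^bsub>?L\<^esub> d) = c \<otimes>\<^bsub>?L\<^esub> (k \<odot>\<^bsub>?L\<^esub> (\<pi> f \<otimes>\<^bsub>?L\<^esub> d))"
        using C(2)[OF c] C(2)[OF d(1)] \<pi>s(1)[OF smult(1)]
        by (simp add: L.A.smult_mult_r d(2)[symmetric])
      hence "\<pi> (Poly_Mapping.single 0 k * f) \<otimes>\<^bsub>?L\<^esub> d =
          c \<otimes>\<^bsub>?L\<^esub> (\<pi> (Poly_Mapping.single 0 k * f) \<otimes>\<^bsub>?L\<^esub> d)"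
        using C(2)[OF d(1)] \<pi>s(1,5)[OF smult(1)] by (simp add: L.A.smult_mult_l)
      thus "\<exists>d\<in>C. \<pi> (Poly_Mapping.single 0 k * f) \<otimes>\<^bsub>?L\<^esub> d =
          c \<otimes>\<^bsub>?L\<^esub> (\<pi> (Poly_Mapping.single 0 k * f) \<otimes>\<^bsub>?L\<^esub> d)" using d(1) by blast
    qed
  next
    case (add f h)
    show ?case
    proof
      fix c assume c: "c \<in> C"
      obtain d where d: "d \<in> C" "\<pi> f \<otimes>\<^bsub>?L\<^esub> d = c \<otimes>\<^bsub>?L\<^esub> (\<pi> f \<otimes>\<^bsub>?L\<^esub> d)" using c add by blast
      obtain e where e: "e \<in> C" "\<pi> h \<otimes>\<^bsub>?L\<^esub> e = c \<otimes>\<^bsub>?L\<^esub> (\<pi> h \<otimes>\<^bsub>?L\<^esub> e)" using c add by blast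
      note car = C(2)[OF c] C(2)[OF d(1)] C(2)[OF e(1)] \<pi>s(1)[OF add(1)] \<pi>s(1)[OF add(2)]
      have 1: "\<pi> f \<otimes>\<^bsub>?L\<^esub> (d \<otimes>\<^bsub>?L\<^esub> e) = c \<otimes>\<^bsub>?L\<^esub> (\<pi> f \<otimes>\<^bsub>?L\<^esub> (d \<otimes>\<^bsub>?L\<^esub> e))"
        using arg_cong[OF d(2), of "\<lambda>x. x \<otimes>\<^bsub>?L\<^esub> e"] car by (simp add: L.A.m_assoc)
      have "\<pi> h \<otimes>\<^bsub>?L\<^esub> (e \<otimes>\<^bsub>?L\<^esub> d) = c \<otimes>\<^bsub>?L\<^esub> (\<pi> h \<otimes>\<^bsub>?L\<^esub> (e \<otimes>\<^bsub>?L\<^esub> d))"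
        using arg_cong[OF e(2), of "\<lambda>x. x \<otimes>\<^bsub>?L\<^esub> d"] car by (simp add: L.A.m_assoc)
      hence 2: "\<pi> h \<otimes>\<^bsub>?L\<^esub> (d \<otimes>\<^bsub>?L\<^esub> e) = c \<otimes>\<^bsub>?L\<^esub> (\<pi> h \<otimes>\<^bsub>?L\<^esub> (d \<otimes>\<^bsub>?L\<^esub> e))"
        unfolding L.diagonal_comm[OF C(1)[OF e(1)] C(1)[OF d(1)]] .
      have "\<pi> (f + h) \<otimes>\<^bsub>?L\<^esub> (d \<otimes>\<^bsub>?L\<^esub> e) = c \<otimes>\<^bsub>?L\<^esub> (\<pi> (f + h) \<otimes>\<^bsub>?L\<^esub> (d \<otimes>\<^bsub>?L\<^esub> e))"
        using car 1[symmetric] 2[symmetric] \<pi>s(3)[OF add(1,2)]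
        by (simp add: L.A.l_distr L.A.r_distr)
      thus "\<exists>d\<in>C. \<pi> (f + h) \<otimes>\<^bsub>?L\<^esub> d = c \<otimes>\<^bsub>?L\<^esub> (\<pi> (f + h) \<otimes>\<^bsub>?L\<^esub> d)"
        using meet[OF d(1) e(1)] by blast
    qed
  next
    case (mult f h)
    show ?case
    proof
      fix c assume c: "c \<in> C"
      obtain d where d: "d \<in> C" "\<pi> f \<otimes>\<^bsub>?L\<^esub> d = c \<otimes>\<^bsub>?L\<^esub> (\<pi> f \<otimes>\<^bsub>?L\<^esub> d)" using c mult by blast
      obtain e where e: "e \<in> C" "\<pi> h \<otimes>\<^bsub>?L\<^esub> e = d \<otimes>\<^bsub>?L\<^esub> (\<pi> h \<otimes>\<^bsub>?L\<^esub> e)" using d mult by blast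
      note car = C(2)[OF c] C(2)[OF d(1)] C(2)[OF e(1)] \<pi>s(1)[OF mult(1)] \<pi>s(1)[OF mult(2)]
      let ?y = "\<pi> h \<otimes>\<^bsub>?L\<^esub> e"
      have "\<pi> f \<otimes>\<^bsub>?L\<^esub> ?y = (\<pi> f \<otimes>\<^bsub>?L\<^esub> d) \<otimes>\<^bsub>?L\<^esub> ?y"
        by (subst e(2)) (use car in \<open>simp add: L.A.m_assoc\<close>)
      also have "\<dots> = c \<otimes>\<^bsub>?L\<^esub> (\<pi> f \<otimes>\<^bsub>?L\<^esub> (d \<otimes>\<^bsub>?L\<^esub> ?y))"
        by (subst d(2)) (use car in \<open>simp add: L.A.m_assoc\<close>)
      also have "\<dots> = c \<otimes>\<^bsub>?L\<^esub> (\<pi> f \<otimes>\<^bsub>?L\<^esub> ?y)" by (simp only: e(2)[symmetric])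
      finally have "\<pi> (f * h) \<otimes>\<^bsub>?L\<^esub> e = c \<otimes>\<^bsub>?L\<^esub> (\<pi> (f * h) \<otimes>\<^bsub>?L\<^esub> e)"
        using car \<pi>s(2)[OF mult(1,2)] by (simp add: L.A.m_assoc)
      thus "\<exists>d\<in>C. \<pi> (f * h) \<otimes>\<^bsub>?L\<^esub> d = c \<otimes>\<^bsub>?L\<^esub> (\<pi> (f * h) \<otimes>\<^bsub>?L\<^esub> d)" using e(1) by blast
    qed
  qed
  define N where "N f = (INF c\<in>C. cnorm ?L (\<pi> f \<otimes>\<^bsub>?L\<^esub> c))" for f
  have seminorm: "cstar_seminorm FA N"
    unfolding N_def
  proof (rule corner_seminorm[OF L.A.unital_cstar_algebra_axioms free_unital_star_algebra \<pi>])
    show "C \<noteq> {}" using one_C by blast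
    show "\<exists>d\<in>C. \<pi> f \<otimes>\<^bsub>?L\<^esub> d = c \<otimes>\<^bsub>?L\<^esub> (\<pi> f \<otimes>\<^bsub>?L\<^esub> d)" if "f \<in> carrier FA" "c \<in> C" for f c
      using absorb that by blast
  qed (use C meet L.diagonal_star L.diagonal_idem L.diagonal_comm in simp_all)
  have null: "N r = 0" if r: "r \<in> toeplitz_rels G P" for r
  proof -
    have rc: "r \<in> carrier FA" using r relators by blast
    have "\<pi> ` toeplitz_rels G P = toeplitz_relators G P ?L (li_isom G P)"
      unfolding toeplitz_rels_def
      by (rule toeplitz_relators_hom(2)[OF pv(1)]) (simp_all add: \<pi>_gen poly_gen_carrier)
    hence d: "\<pi> r \<in> L.diagonal"
      using toeplitz_relators_diagonal[OF li_family] r by blast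
    have "\<Lambda> (\<pi> r) = \<zero>\<^bsub>?T\<^esub>"
      unfolding lift[OF rc] toeplitz_algebra_def by (rule incl_relator[OF r])
    \<comment> \<open>The relator is a projection killed by \<Lambda>, so its complement lies in
      \<open>C\<close> and annihilates it; the infimum is therefore zero.\<close>
    hence c: "\<one>\<^bsub>?L\<^esub> \<ominus>\<^bsub>?L\<^esub> \<pi> r \<in> C"
      using d by (simp add: C_def L.diagonal.compl \<Lambda>.h_minus \<Lambda>.h_simps(4) one_minus_zero)
    have 0: "\<pi> r \<otimes>\<^bsub>?L\<^esub> (\<one>\<^bsub>?L\<^esub> \<ominus>\<^bsub>?L\<^esub> \<pi> r) = \<zero>\<^bsub>?L\<^esub>"
      using d by (simp add: a_minus_def L.A.r_distr L.A.r_minus L.diagonal_idem L.A.r_neg)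
    have nn: "0 \<le> cnorm ?L (\<pi> r \<otimes>\<^bsub>?L\<^esub> c)" if "c \<in> C" for c
      using that d C by (intro L.A.NS.N_nonneg) simp
    have "N r \<le> cnorm ?L (\<pi> r \<otimes>\<^bsub>?L\<^esub> (\<one>\<^bsub>?L\<^esub> \<ominus>\<^bsub>?L\<^esub> \<pi> r))"
      unfolding N_def by (rule cINF_lower[OF _ c], rule bdd_belowI[of _ 0]) (use nn in auto)
    moreover have "0 \<le> N r" unfolding N_def by (rule cINF_greatest) (use one_C nn in auto)
    ultimately show ?thesis by (simp add: 0 L.A.NS.N_zero)
  qed
  have "N \<in> admissible_seminorms P (toeplitz_rels G P)"
    by (simp add: admissible_seminorms_def seminorm null)
  note N_le = le_US[OF this]
  show ?thesis
  proof (rule contractive_hom_surj[OF L.A.unital_cstar_algebra_axioms T.A.unital_cstar_algebra_axioms \<Lambda> con,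
        where D = "?i ` carrier FA"])
    have ic: "?i f \<in> carrier ?T" if "f \<in> carrier FA" for f
      using star_hom_simps(1)[OF incl_hom that] by (simp add: toeplitz_algebra_def)
    show "?i ` carrier FA \<subseteq> carrier ?T" by (rule image_subsetI) (rule ic)
    show "x \<ominus>\<^bsub>?T\<^esub> y \<in> ?i ` carrier FA" if xy: "x \<in> ?i ` carrier FA" "y \<in> ?i ` carrier FA" for x y
    proof -
      obtain f h where fh: "f \<in> carrier FA" "x = ?i f" "h \<in> carrier FA" "y = ?i h" using xy by blast
      have e: "x \<ominus>\<^bsub>?T\<^esub> y = ?i (f \<ominus>\<^bsub>FA\<^esub> h)"
        unfolding fh(2,4) toeplitz_algebra_def
        by (rule star_algebra_hom.h_minus[OF incl_star_hom fh(1,3), symmetric])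
      show ?thesis unfolding e by (intro imageI F.minus_closed fh(1,3))
    qed
    show "\<exists>z\<in>?i ` carrier FA. cnorm ?T (y \<ominus>\<^bsub>?T\<^esub> z) < e" if "y \<in> carrier ?T" "e > 0" for y e
    proof -
      from incl_dense[OF that[unfolded toeplitz_algebra_def]]
      obtain f where f: "f \<in> carrier FA" "cnorm ?T (y \<ominus>\<^bsub>?T\<^esub> ?i f) < e"
        unfolding toeplitz_algebra_def ..
      show ?thesis by (rule bexI[of _ "?i f"]) (rule f(2), rule imageI[OF f(1)])
    qed
    show "\<exists>x\<in>carrier ?L. \<Lambda> x = y \<and> cnorm ?L x < cnorm ?T y + e"
      if y: "y \<in> ?i ` carrier FA" and e: "e > 0" for y e
    proof -
      obtain f where f: "f \<in> carrier FA" "y = ?i f" using y by blast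
      have "\<exists>c\<in>C. cnorm ?L (\<pi> f \<otimes>\<^bsub>?L\<^esub> c) < N f + e"
      proof (rule ccontr)
        assume neg: "\<not> ?thesis"
        have "N f + e \<le> (INF c\<in>C. cnorm ?L (\<pi> f \<otimes>\<^bsub>?L\<^esub> c))"
          by (rule cINF_greatest) (use one_C neg in \<open>auto simp: not_less\<close>)
        thus False using e by (simp add: N_def)
      qed
      then obtain c where c: "c \<in> C" "cnorm ?L (\<pi> f \<otimes>\<^bsub>?L\<^esub> c) < N f + e" by blast
      have "cnorm ?T y = US f" unfolding f(2) toeplitz_algebra_def by (rule norm_incl[OF f(1)])
      hence "cnorm ?L (\<pi> f \<otimes>\<^bsub>?L\<^esub> c) < cnorm ?T y + e" using c(2) N_le[OF f(1)] by linarith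
      \<comment> \<open>Cutting by \<open>c\<close> lowers the norm of the lift without changing its
        image, because \<Lambda> sends \<open>c\<close> to the unit.\<close>
      moreover have "\<Lambda> (\<pi> f \<otimes>\<^bsub>?L\<^esub> c) = y"
        using C[OF c(1)] \<pi>s(1)[OF f(1)] lift[OF f(1)] ic[OF f(1)] by (simp add: \<Lambda>.h_simps f(2))
      moreover have "\<pi> f \<otimes>\<^bsub>?L\<^esub> c \<in> carrier ?L" using C(2)[OF c(1)] \<pi>s(1)[OF f(1)] by simp
      ultimately show ?thesis by blast
    qed
  qed
qed


section \<open>Independence\<close>

text \<open>A left inverse of \<Lambda> suffices, since surjectivity holds without independence.
  Hence only the composite on Li's algebra is compared with the identity.\<close>

lemma independence_imp_injective:
  assumes "independence G P"
    and \<Lambda>: "\<Lambda> \<in> star_hom (li_algebra G P) (toeplitz_algebra G P)"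
    and gen: "\<And>p. p \<in> P \<Longrightarrow> \<Lambda> (li_isom G P p) = toeplitz_gen G P p"
    and con: "\<And>a. a \<in> carrier (li_algebra G P) \<Longrightarrow>
      cnorm (toeplitz_algebra G P) (\<Lambda> a) \<le> cnorm (li_algebra G P) a"
  shows "inj_on \<Lambda> (carrier (li_algebra G P))"
proof -
  let ?L = "li_algebra G P" and ?T = "toeplitz_algebra G P"
  interpret L: diagonal_family G P ?L "li_isom G P" by (rule li_family)
  interpret T: diagonal_family G P ?T "toeplitz_gen G P" by (rule toeplitz_family)
  interpret \<Lambda>: star_algebra_hom ?L ?T \<Lambda> by unfold_locales (rule \<Lambda>)
  interpret bounded_presentation "li_gens G P" "li_rels G P" by (rule li_presentation)
  have foldr_zero: "foldr (\<otimes>\<^bsub>?L\<^esub>) (map f \<beta>s) \<one>\<^bsub>?L\<^esub> = \<zero>\<^bsub>?L\<^esub>"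
    if "\<And>\<beta>. \<beta> \<in> set \<beta>s \<Longrightarrow> f \<beta> \<in> carrier ?L" "\<beta> \<in> set \<beta>s" "f \<beta> = \<zero>\<^bsub>?L\<^esub>" for f \<beta> and \<beta>s :: "'a list list"
  proof -
    have c: "foldr (\<otimes>\<^bsub>?L\<^esub>) (map f \<gamma>s) \<one>\<^bsub>?L\<^esub> \<in> carrier ?L" if "set \<gamma>s \<subseteq> set \<beta>s" for \<gamma>s
      using that \<open>\<And>\<beta>. \<beta> \<in> set \<beta>s \<Longrightarrow> f \<beta> \<in> carrier ?L\<close> by (induction \<gamma>s) auto
    have "\<beta> \<in> set \<gamma>s \<Longrightarrow> set \<gamma>s \<subseteq> set \<beta>s \<Longrightarrow> foldr (\<otimes>\<^bsub>?L\<^esub>) (map f \<gamma>s) \<one>\<^bsub>?L\<^esub> = \<zero>\<^bsub>?L\<^esub>" for \<gamma>s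
      by (induction \<gamma>s) (use that c in auto)
    thus ?thesis using that(2) by blast
  qed
  have rel: "toeplitz_relators G P ?L (li_isom G P) \<subseteq> {\<zero>\<^bsub>?L\<^esub>}"
  proof
    fix r assume "r \<in> toeplitz_relators G P ?L (li_isom G P)"
    thus "r \<in> {\<zero>\<^bsub>?L\<^esub>}"
      unfolding toeplitz_relators_def
    proof (elim UnE)
      assume "r \<in> {li_isom G P \<one> \<ominus>\<^bsub>?L\<^esub> \<one>\<^bsub>?L\<^esub>}"
      thus ?thesis by (simp add: L.w_one)
    next
      assume "r \<in> {L.W \<alpha> | \<alpha>. \<alpha> \<in> neutral_words G P \<and> constr_ideal G P \<alpha> = {}}"
      thus ?thesis using li_word li_proj_empty by force
    next
      assume "r \<in> {L.W \<alpha> \<ominus>\<^bsub>?L\<^esub> L.W \<beta> | \<alpha> \<beta>. \<alpha> \<in> neutral_words G P \<and>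
          \<beta> \<in> neutral_words G P \<and> constr_ideal G P \<alpha> = constr_ideal G P \<beta>}"
      then obtain \<alpha> \<beta> where ab: "r = L.W \<alpha> \<ominus>\<^bsub>?L\<^esub> L.W \<beta>" "\<alpha> \<in> neutral_words G P"
          "\<beta> \<in> neutral_words G P" "constr_ideal G P \<alpha> = constr_ideal G P \<beta>" by blast
      thus ?thesis using L.w_word[OF ab(2-4)] by simp
    next
      assume "r \<in> {foldr (\<otimes>\<^bsub>?L\<^esub>) (map (\<lambda>\<beta>. L.W \<alpha> \<ominus>\<^bsub>?L\<^esub> L.W \<beta>) \<beta>s) \<one>\<^bsub>?L\<^esub> | \<alpha> \<beta>s.
          \<alpha> \<in> neutral_words G P \<and> \<beta>s \<noteq> [] \<and> distinct \<beta>s \<and> set \<beta>s \<subseteq> neutral_words G P \<and>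
          constr_ideal G P \<alpha> = (\<Union>\<beta>\<in>set \<beta>s. constr_ideal G P \<beta>)}"
      then obtain \<alpha> \<beta>s where ab: "r = foldr (\<otimes>\<^bsub>?L\<^esub>) (map (\<lambda>\<beta>. L.W \<alpha> \<ominus>\<^bsub>?L\<^esub> L.W \<beta>) \<beta>s) \<one>\<^bsub>?L\<^esub>"
          "\<alpha> \<in> neutral_words G P" "\<beta>s \<noteq> []" "set \<beta>s \<subseteq> neutral_words G P"
          "constr_ideal G P \<alpha> = (\<Union>\<beta>\<in>set \<beta>s. constr_ideal G P \<beta>)" by blast
      have "finite (set \<beta>s) \<and> set \<beta>s \<noteq> {} \<and> set \<beta>s \<subseteq> words P \<and>
          constr_ideal G P \<alpha> = (\<Union>\<beta>\<in>set \<beta>s. constr_ideal G P \<beta>)"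
        using ab(3-5) by (auto dest!: subsetD[OF ab(4)] intro: neutral_words_words)
      hence "constr_ideal G P \<alpha> \<in> constr_ideal G P ` set \<beta>s"
        using assms(1) neutral_words_words[OF ab(2)] unfolding independence_def by blast
      then obtain \<beta> where \<beta>: "\<beta> \<in> set \<beta>s" "constr_ideal G P \<alpha> = constr_ideal G P \<beta>" by blast
      hence bn: "\<beta> \<in> neutral_words G P" using ab(4) by blast
      have "r = \<zero>\<^bsub>?L\<^esub>" unfolding ab(1)
      proof (rule foldr_zero[OF _ \<beta>(1)])
        show "L.W \<alpha> \<ominus>\<^bsub>?L\<^esub> L.W \<gamma> \<in> carrier ?L" if "\<gamma> \<in> set \<beta>s" for \<gamma>
          using ab that by (intro L.A.minus_closed L.W_neutral_closed) auto
        show "L.W \<alpha> \<ominus>\<^bsub>?L\<^esub> L.W \<beta> = \<zero>\<^bsub>?L\<^esub>"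
          unfolding L.w_word[OF ab(2) bn \<beta>(2)] using bn by simp
      qed
      thus ?thesis by simp
    qed
  qed
  have "li_isom G P \<in> P \<rightarrow> carrier ?L" by (auto simp: li_isom_closed)
  from toeplitz_contractive_hom[OF li_algebra_cstar this rel]
  obtain \<Psi> where \<Psi>: "\<Psi> \<in> star_hom ?T ?L" and \<Psi>_gen: "\<forall>p\<in>P. \<Psi> (toeplitz_gen G P p) = li_isom G P p"
    and \<Psi>_con: "\<forall>a\<in>carrier ?T. cnorm ?L (\<Psi> a) \<le> cnorm ?T a" by blast
  have hom: "(\<lambda>a. \<Psi> (\<Lambda> a)) \<in> star_hom ?L ?L" by (rule star_hom_comp[OF \<Lambda> \<Psi>])
  interpret \<Psi>\<Lambda>: star_algebra_hom ?L ?L "\<lambda>a. \<Psi> (\<Lambda> a)" by unfold_locales (rule hom)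
  have "\<Psi> (\<Lambda> a) = a" if "a \<in> carrier ?L" for a
  proof (rule identity_on_gens[folded li_algebra_def, OF hom _ _ that])
    show "cnorm ?L (\<Psi> (\<Lambda> a)) \<le> cnorm ?L a" if "a \<in> carrier ?L" for a
      using con[OF that] \<Psi>_con \<Lambda>.h_simps(1)[OF that] by force
    have isom: "\<Psi> (\<Lambda> (li_isom G P p)) = li_isom G P p" if "p \<in> P" for p
      using that gen \<Psi>_gen by simp
    \<comment> \<open>The projections are generators too. They are word operators of neutral words,
      so they are fixed once the isometries are; the one of the empty set is zero.\<close>
    have proj: "\<Psi> (\<Lambda> (li_proj G P S)) = li_proj G P S" if S: "S \<in> constr_ideals G P" for S
    proof -
      obtain \<alpha> where \<alpha>: "\<alpha> \<in> neutral_words G P" "S = constr_ideal G P \<alpha>"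
        using S unfolding constr_ideals_neutral by blast
      show ?thesis
        using \<Psi>\<Lambda>.h_word_op[of P "li_isom G P" "li_isom G P", OF li_isom_closed isom neutral_words_words[OF \<alpha>(1)]]
        by (simp add: li_word \<alpha>)
    qed
    have zero: "\<Psi> (\<Lambda> \<zero>\<^bsub>?L\<^esub>) = \<zero>\<^bsub>?L\<^esub>" using \<Psi>\<Lambda>.h_minus[of "\<one>\<^bsub>?L\<^esub>" "\<one>\<^bsub>?L\<^esub>"]
      by (simp add: \<Psi>\<Lambda>.h_simps a_minus_def L.A.r_neg)
    show "\<Psi> (\<Lambda> (universal_gen (li_gens G P) (li_rels G P) x)) = universal_gen (li_gens G P) (li_rels G P) x"
      if "x \<in> li_gens G P" for x
    proof (cases x)
      case (Isom p)
      thus ?thesis using isom[of p] that by (simp add: li_isom_def li_gens_iff)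
    next
      case (Proj S)
      thus ?thesis using proj[of S] zero that
        by (auto simp: li_gens_iff li_proj_def[symmetric] li_proj_empty)
    qed
  qed
  thus ?thesis by (rule inj_on_inverseI)
qed

end


section \<open>Operators on finitely supported functions\<close>

text \<open>The inner product of \<open>\<ell>\<^sup>2\<close>, linear in the first argument, on
  finitely supported functions. No Hilbert space completion is taken, since a C*-seminorm is all
  that the representation has to provide.\<close>

definition fs_inner :: "('x \<Rightarrow>\<^sub>0 complex) \<Rightarrow> ('x \<Rightarrow>\<^sub>0 complex) \<Rightarrow> complex" where
  "fs_inner \<xi> \<eta> = (\<Sum>x\<in>Poly_Mapping.keys \<xi>. Poly_Mapping.lookup \<xi> x * cnj (Poly_Mapping.lookup \<eta> x))"

definition fs_norm :: "('x \<Rightarrow>\<^sub>0 complex) \<Rightarrow> real" where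
  "fs_norm \<xi> = L2_set (\<lambda>x. cmod (Poly_Mapping.lookup \<xi> x)) (Poly_Mapping.keys \<xi>)"

definition fs_scale :: "complex \<Rightarrow> ('x \<Rightarrow>\<^sub>0 complex) \<Rightarrow> ('x \<Rightarrow>\<^sub>0 complex)" where
  "fs_scale c \<xi> = Poly_Mapping.map ((*) c) \<xi>"

lemma lookup_fs_scale [simp]: "Poly_Mapping.lookup (fs_scale c \<xi>) x = c * Poly_Mapping.lookup \<xi> x"
  by (simp add: fs_scale_def map.rep_eq when_def)

lemma keys_fs_scale: "Poly_Mapping.keys (fs_scale c \<xi>) \<subseteq> Poly_Mapping.keys \<xi>"
  by (auto simp: in_keys_iff)

lemma fs_inner_sum:
  assumes "finite K" "\<And>x. x \<notin> K \<Longrightarrow> Poly_Mapping.lookup \<xi> x * cnj (Poly_Mapping.lookup \<eta> x) = 0"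
  shows "fs_inner \<xi> \<eta> = (\<Sum>x\<in>K. Poly_Mapping.lookup \<xi> x * cnj (Poly_Mapping.lookup \<eta> x))"
  unfolding fs_inner_def
  by (rule sum.mono_neutral_cong) (use assms in \<open>auto simp: in_keys_iff\<close>)

lemma fs_norm_superset:
  assumes "finite K" "Poly_Mapping.keys \<xi> \<subseteq> K"
  shows "fs_norm \<xi> = L2_set (\<lambda>x. cmod (Poly_Mapping.lookup \<xi> x)) K"
  unfolding fs_norm_def L2_set_def
  by (intro arg_cong[where f = sqrt] sum.mono_neutral_left) (use assms in \<open>auto simp: in_keys_iff\<close>)

lemma fs_norm_nonneg [simp]: "0 \<le> fs_norm \<xi>"
  by (simp add: fs_norm_def)

lemma fs_inner_self: "fs_inner \<xi> \<xi> = complex_of_real ((fs_norm \<xi>)\<^sup>2)"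
proof -
  have "(fs_norm \<xi>)\<^sup>2 = (\<Sum>x\<in>Poly_Mapping.keys \<xi>. (cmod (Poly_Mapping.lookup \<xi> x))\<^sup>2)"
    by (simp add: fs_norm_def L2_set_def sum_nonneg)
  thus ?thesis
    by (simp only: fs_inner_def of_real_sum complex_norm_square)
qed

lemma fs_inner_cnj: "fs_inner \<eta> \<xi> = cnj (fs_inner \<xi> \<eta>)"
proof -
  let ?K = "Poly_Mapping.keys \<xi> \<union> Poly_Mapping.keys \<eta>"
  have "fs_inner \<eta> \<xi> = (\<Sum>x\<in>?K. Poly_Mapping.lookup \<eta> x * cnj (Poly_Mapping.lookup \<xi> x))"
    "fs_inner \<xi> \<eta> = (\<Sum>x\<in>?K. Poly_Mapping.lookup \<xi> x * cnj (Poly_Mapping.lookup \<eta> x))"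
    by (rule fs_inner_sum; simp add: in_keys_iff)+
  thus ?thesis by (simp add: mult.commute)
qed

lemma fs_inner_add: "fs_inner (\<xi> + \<eta>) \<zeta> = fs_inner \<xi> \<zeta> + fs_inner \<eta> \<zeta>"
proof -
  let ?K = "Poly_Mapping.keys \<zeta>"
  have "fs_inner \<theta> \<zeta> = (\<Sum>x\<in>?K. Poly_Mapping.lookup \<theta> x * cnj (Poly_Mapping.lookup \<zeta> x))" for \<theta>
    by (rule fs_inner_sum) (simp_all add: in_keys_iff)
  thus ?thesis by (simp add: lookup_add distrib_right sum.distrib)
qed

lemma fs_inner_scale: "fs_inner (fs_scale c \<xi>) \<zeta> = c * fs_inner \<xi> \<zeta>"
proof -
  let ?K = "Poly_Mapping.keys \<zeta>"
  have "fs_inner \<theta> \<zeta> = (\<Sum>x\<in>?K. Poly_Mapping.lookup \<theta> x * cnj (Poly_Mapping.lookup \<zeta> x))" for \<theta>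
    by (rule fs_inner_sum) (simp_all add: in_keys_iff)
  thus ?thesis by (simp add: sum_distrib_left mult.assoc)
qed

lemma fs_inner_add_right: "fs_inner \<zeta> (\<xi> + \<eta>) = fs_inner \<zeta> \<xi> + fs_inner \<zeta> \<eta>"
  unfolding fs_inner_cnj[of \<zeta> "\<xi> + \<eta>"] fs_inner_cnj[of \<zeta> \<xi>] fs_inner_cnj[of \<zeta> \<eta>] fs_inner_add by simp

lemma fs_inner_scale_right: "fs_inner \<zeta> (fs_scale c \<xi>) = cnj c * fs_inner \<zeta> \<xi>"
  unfolding fs_inner_cnj[of \<zeta> "fs_scale c \<xi>"] fs_inner_cnj[of \<zeta> \<xi>] fs_inner_scale by simp

lemma fs_inner_eqI:
  assumes "\<And>\<zeta>. fs_inner \<xi> \<zeta> = fs_inner \<eta> \<zeta>"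
  shows "\<xi> = \<eta>"
proof (rule poly_mapping_eqI)
  fix x
  have lookup: "fs_inner \<theta> (Poly_Mapping.single x 1) = Poly_Mapping.lookup \<theta> x" for \<theta> :: "'a \<Rightarrow>\<^sub>0 complex"
    by (subst fs_inner_sum[of "{x}"]) (auto simp: lookup_single when_def)
  show "Poly_Mapping.lookup \<xi> x = Poly_Mapping.lookup \<eta> x" unfolding lookup[symmetric] by (rule assms)
qed

lemma fs_cauchy_schwarz: "cmod (fs_inner \<xi> \<eta>) \<le> fs_norm \<xi> * fs_norm \<eta>"
proof -
  let ?K = "Poly_Mapping.keys \<xi> \<union> Poly_Mapping.keys \<eta>"
  have K: "finite ?K" "Poly_Mapping.keys \<xi> \<subseteq> ?K" "Poly_Mapping.keys \<eta> \<subseteq> ?K" by auto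
  have "fs_inner \<xi> \<eta> = (\<Sum>x\<in>?K. Poly_Mapping.lookup \<xi> x * cnj (Poly_Mapping.lookup \<eta> x))"
    by (rule fs_inner_sum) (simp_all add: in_keys_iff)
  also have "cmod \<dots> \<le> (\<Sum>x\<in>?K. \<bar>cmod (Poly_Mapping.lookup \<xi> x)\<bar> * \<bar>cmod (Poly_Mapping.lookup \<eta> x)\<bar>)"
    by (rule sum_norm_le) (simp add: norm_mult)
  also have "\<dots> \<le> fs_norm \<xi> * fs_norm \<eta>"
    unfolding fs_norm_superset[OF K(1,2)] fs_norm_superset[OF K(1,3)] by (rule L2_set_mult_ineq)
  finally show ?thesis .
qed

lemma fs_norm_triangle: "fs_norm (\<xi> + \<eta>) \<le> fs_norm \<xi> + fs_norm \<eta>"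
proof -
  let ?K = "Poly_Mapping.keys \<xi> \<union> Poly_Mapping.keys \<eta>"
  have K: "finite ?K" "Poly_Mapping.keys \<xi> \<subseteq> ?K" "Poly_Mapping.keys \<eta> \<subseteq> ?K" by auto
  have "fs_norm (\<xi> + \<eta>) = L2_set (\<lambda>x. cmod (Poly_Mapping.lookup (\<xi> + \<eta>) x)) ?K"
    by (rule fs_norm_superset) (simp_all add: keys_add)
  also have "\<dots> \<le> L2_set (\<lambda>x. cmod (Poly_Mapping.lookup \<xi> x) + cmod (Poly_Mapping.lookup \<eta> x)) ?K"
    by (rule L2_set_mono) (simp_all add: lookup_add norm_triangle_ineq)
  also have "\<dots> \<le> fs_norm \<xi> + fs_norm \<eta>"
    unfolding fs_norm_superset[OF K(1,2)] fs_norm_superset[OF K(1,3)] by (rule L2_set_triangle_ineq)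
  finally show ?thesis .
qed

lemma fs_norm_scale: "fs_norm (fs_scale c \<xi>) = cmod c * fs_norm \<xi>"
  by (subst fs_norm_superset[OF _ keys_fs_scale])
    (simp_all add: fs_norm_def norm_mult L2_set_right_distrib)

lemma fs_norm_zero [simp]: "fs_norm 0 = 0"
  by (simp add: fs_norm_def)

section \<open>Adjointable bounded operators and their seminorm\<close>

definition adjoint_pair :: "(('x \<Rightarrow>\<^sub>0 complex) \<Rightarrow> ('x \<Rightarrow>\<^sub>0 complex)) \<Rightarrow> (('x \<Rightarrow>\<^sub>0 complex) \<Rightarrow> ('x \<Rightarrow>\<^sub>0 complex)) \<Rightarrow> bool" where
  "adjoint_pair T T' \<longleftrightarrow> (\<forall>\<xi> \<eta>. fs_inner (T \<xi>) \<eta> = fs_inner \<xi> (T' \<eta>))"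

definition bounded_on :: "'x set \<Rightarrow> (('x \<Rightarrow>\<^sub>0 complex) \<Rightarrow> ('x \<Rightarrow>\<^sub>0 complex)) \<Rightarrow> bool" where
  "bounded_on X T \<longleftrightarrow> (\<forall>\<xi>. Poly_Mapping.keys \<xi> \<subseteq> X \<longrightarrow> Poly_Mapping.keys (T \<xi>) \<subseteq> X) \<and>
    (\<exists>C\<ge>0. \<forall>\<xi>. Poly_Mapping.keys \<xi> \<subseteq> X \<longrightarrow> fs_norm (T \<xi>) \<le> C * fs_norm \<xi>)"

text \<open>Pairing an operator with its adjoint makes the involution a swap.  The operators act on all
  finitely supported functions but are only measured on those supported in \<open>X\<close>.\<close>

definition op_algebra ::
  "'x set \<Rightarrow> ((('x \<Rightarrow>\<^sub>0 complex) \<Rightarrow> ('x \<Rightarrow>\<^sub>0 complex)) \<times> (('x \<Rightarrow>\<^sub>0 complex) \<Rightarrow> ('x \<Rightarrow>\<^sub>0 complex))) star_algebra" where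
  "op_algebra X =
     \<lparr>carrier = {T. adjoint_pair (fst T) (snd T) \<and> bounded_on X (fst T) \<and> bounded_on X (snd T)},
      mult = (\<lambda>S T. (\<lambda>\<xi>. fst S (fst T \<xi>), \<lambda>\<xi>. snd T (snd S \<xi>))),
      one = (\<lambda>\<xi>. \<xi>, \<lambda>\<xi>. \<xi>), zero = (\<lambda>\<xi>. 0, \<lambda>\<xi>. 0),
      add = (\<lambda>S T. (\<lambda>\<xi>. fst S \<xi> + fst T \<xi>, \<lambda>\<xi>. snd S \<xi> + snd T \<xi>)),
      smult = (\<lambda>c T. (\<lambda>\<xi>. fs_scale c (fst T \<xi>), \<lambda>\<xi>. fs_scale (cnj c) (snd T \<xi>))),
      adj = (\<lambda>T. (snd T, fst T))\<rparr>"

lemma op_algebra_simps [simp]: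
  "S \<otimes>\<^bsub>op_algebra X\<^esub> T = (\<lambda>\<xi>. fst S (fst T \<xi>), \<lambda>\<xi>. snd T (snd S \<xi>))"
  "\<one>\<^bsub>op_algebra X\<^esub> = (\<lambda>\<xi>. \<xi>, \<lambda>\<xi>. \<xi>)"
  "\<zero>\<^bsub>op_algebra X\<^esub> = (\<lambda>\<xi>. 0, \<lambda>\<xi>. 0)"
  "S \<oplus>\<^bsub>op_algebra X\<^esub> T = (\<lambda>\<xi>. fst S \<xi> + fst T \<xi>, \<lambda>\<xi>. snd S \<xi> + snd T \<xi>)"
  "c \<odot>\<^bsub>op_algebra X\<^esub> T = (\<lambda>\<xi>. fs_scale c (fst T \<xi>), \<lambda>\<xi>. fs_scale (cnj c) (snd T \<xi>))"
  "star\<^bsub>op_algebra X\<^esub> T = (snd T, fst T)"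
  by (simp_all add: op_algebra_def)

lemma op_carrier: "T \<in> carrier (op_algebra X) \<longleftrightarrow>
    adjoint_pair (fst T) (snd T) \<and> bounded_on X (fst T) \<and> bounded_on X (snd T)"
  by (simp add: op_algebra_def)

lemma adjoint_pair_sym: "adjoint_pair T T' \<Longrightarrow> adjoint_pair T' T"
  unfolding adjoint_pair_def by (metis fs_inner_cnj)

text \<open>The inner product separates points, so an operator with an adjoint is automatically
  linear. This is why the operator algebra carries no linearity condition.\<close>

lemma adjoint_pair_linear:
  assumes "adjoint_pair T T'"
  shows "T (\<xi> + \<eta>) = T \<xi> + T \<eta>" "T (fs_scale c \<xi>) = fs_scale c (T \<xi>)" "T 0 = 0"
proof -
  show a: "T (\<xi> + \<eta>) = T \<xi> + T \<eta>" for \<xi> \<eta>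
    by (rule fs_inner_eqI) (use assms in \<open>simp add: adjoint_pair_def fs_inner_add\<close>)
  show "T (fs_scale c \<xi>) = fs_scale c (T \<xi>)"
    by (rule fs_inner_eqI) (use assms in \<open>simp add: adjoint_pair_def fs_inner_scale\<close>)
  show "T 0 = 0" using a[of 0 0] by simp
qed

lemma bounded_on_keys: "bounded_on X T \<Longrightarrow> Poly_Mapping.keys \<xi> \<subseteq> X \<Longrightarrow> Poly_Mapping.keys (T \<xi>) \<subseteq> X"
  by (simp add: bounded_on_def)

lemma bounded_onI:
  assumes "\<And>\<xi>. Poly_Mapping.keys \<xi> \<subseteq> X \<Longrightarrow> Poly_Mapping.keys (T \<xi>) \<subseteq> X" "C \<ge> 0"
    "\<And>\<xi>. Poly_Mapping.keys \<xi> \<subseteq> X \<Longrightarrow> fs_norm (T \<xi>) \<le> C * fs_norm \<xi>"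
  shows "bounded_on X T"
  using assms by (auto simp: bounded_on_def)

lemma bounded_on_comp:
  assumes "bounded_on X S" "bounded_on X T"
  shows "bounded_on X (\<lambda>\<xi>. S (T \<xi>))"
proof -
  obtain C where C: "C \<ge> 0" "\<And>\<xi>. Poly_Mapping.keys \<xi> \<subseteq> X \<Longrightarrow> fs_norm (S \<xi>) \<le> C * fs_norm \<xi>"
    using assms(1) by (auto simp: bounded_on_def)
  obtain D where D: "D \<ge> 0" "\<And>\<xi>. Poly_Mapping.keys \<xi> \<subseteq> X \<Longrightarrow> fs_norm (T \<xi>) \<le> D * fs_norm \<xi>"
    using assms(2) by (auto simp: bounded_on_def)
  show ?thesis
  proof (rule bounded_onI[of _ _ "C * D"])
    fix \<xi> :: "'a \<Rightarrow>\<^sub>0 complex" assume k: "Poly_Mapping.keys \<xi> \<subseteq> X"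
    note kT = bounded_on_keys[OF assms(2) k]
    show "Poly_Mapping.keys (S (T \<xi>)) \<subseteq> X" by (rule bounded_on_keys[OF assms(1) kT])
    have "fs_norm (S (T \<xi>)) \<le> C * fs_norm (T \<xi>)" by (rule C(2)[OF kT])
    also have "\<dots> \<le> C * (D * fs_norm \<xi>)" by (intro mult_left_mono D(2) k C(1))
    finally show "fs_norm (S (T \<xi>)) \<le> C * D * fs_norm \<xi>" by (simp add: mult.assoc)
  qed (use C D in simp)
qed

lemma bounded_on_add:
  assumes "bounded_on X S" "bounded_on X T"
  shows "bounded_on X (\<lambda>\<xi>. S \<xi> + T \<xi>)"
proof -
  obtain C where C: "C \<ge> 0" "\<And>\<xi>. Poly_Mapping.keys \<xi> \<subseteq> X \<Longrightarrow> fs_norm (S \<xi>) \<le> C * fs_norm \<xi>"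
    using assms(1) by (auto simp: bounded_on_def)
  obtain D where D: "D \<ge> 0" "\<And>\<xi>. Poly_Mapping.keys \<xi> \<subseteq> X \<Longrightarrow> fs_norm (T \<xi>) \<le> D * fs_norm \<xi>"
    using assms(2) by (auto simp: bounded_on_def)
  show ?thesis
  proof (rule bounded_onI[of _ _ "C + D"])
    fix \<xi> :: "'a \<Rightarrow>\<^sub>0 complex" assume k: "Poly_Mapping.keys \<xi> \<subseteq> X"
    show "Poly_Mapping.keys (S \<xi> + T \<xi>) \<subseteq> X"
      using bounded_on_keys[OF assms(1) k] bounded_on_keys[OF assms(2) k] keys_add[of "S \<xi>" "T \<xi>"] by blast
    show "fs_norm (S \<xi> + T \<xi>) \<le> (C + D) * fs_norm \<xi>"
      using fs_norm_triangle[of "S \<xi>" "T \<xi>"] C(2)[OF k] D(2)[OF k] by (simp add: distrib_right)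
  qed (use C D in simp)
qed

lemma bounded_on_scale:
  assumes "bounded_on X T"
  shows "bounded_on X (\<lambda>\<xi>. fs_scale c (T \<xi>))"
proof -
  obtain D where D: "D \<ge> 0" "\<And>\<xi>. Poly_Mapping.keys \<xi> \<subseteq> X \<Longrightarrow> fs_norm (T \<xi>) \<le> D * fs_norm \<xi>"
    using assms by (auto simp: bounded_on_def)
  show ?thesis
  proof (rule bounded_onI[of _ _ "cmod c * D"])
    fix \<xi> :: "'a \<Rightarrow>\<^sub>0 complex" assume k: "Poly_Mapping.keys \<xi> \<subseteq> X"
    show "Poly_Mapping.keys (fs_scale c (T \<xi>)) \<subseteq> X"
      by (rule subset_trans[OF keys_fs_scale bounded_on_keys[OF assms k]])
    show "fs_norm (fs_scale c (T \<xi>)) \<le> cmod c * D * fs_norm \<xi>"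
      using mult_left_mono[OF D(2)[OF k], of "cmod c"] by (simp add: fs_norm_scale mult.assoc)
  qed (use D in simp)
qed

lemma op_closed:
  "S \<in> carrier (op_algebra X) \<Longrightarrow> T \<in> carrier (op_algebra X) \<Longrightarrow> S \<otimes>\<^bsub>op_algebra X\<^esub> T \<in> carrier (op_algebra X)"
  "S \<in> carrier (op_algebra X) \<Longrightarrow> T \<in> carrier (op_algebra X) \<Longrightarrow> S \<oplus>\<^bsub>op_algebra X\<^esub> T \<in> carrier (op_algebra X)"
  "T \<in> carrier (op_algebra X) \<Longrightarrow> c \<odot>\<^bsub>op_algebra X\<^esub> T \<in> carrier (op_algebra X)"
  "T \<in> carrier (op_algebra X) \<Longrightarrow> star\<^bsub>op_algebra X\<^esub> T \<in> carrier (op_algebra X)"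
  "\<one>\<^bsub>op_algebra X\<^esub> \<in> carrier (op_algebra X)"
  "\<zero>\<^bsub>op_algebra X\<^esub> \<in> carrier (op_algebra X)"
proof -
  have one: "bounded_on X (\<lambda>\<xi>. \<xi>)" by (rule bounded_onI[of _ _ 1]) simp_all
  have zero: "bounded_on X (\<lambda>\<xi>. 0)" by (rule bounded_onI[of _ _ 0]) simp_all
  show "\<one>\<^bsub>op_algebra X\<^esub> \<in> carrier (op_algebra X)"
    using one by (simp add: op_carrier adjoint_pair_def)
  show "\<zero>\<^bsub>op_algebra X\<^esub> \<in> carrier (op_algebra X)"
    using zero by (simp add: op_carrier adjoint_pair_def) (simp add: fs_inner_def)
  assume T: "T \<in> carrier (op_algebra X)"
  hence bT: "bounded_on X (fst T)" "bounded_on X (snd T)" and aT: "adjoint_pair (fst T) (snd T)"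
    by (auto simp: op_carrier)
  show "c \<odot>\<^bsub>op_algebra X\<^esub> T \<in> carrier (op_algebra X)"
    using aT by (simp add: op_carrier adjoint_pair_def fs_inner_scale fs_inner_scale_right
        bounded_on_scale[OF bT(1)] bounded_on_scale[OF bT(2)])
  show "star\<^bsub>op_algebra X\<^esub> T \<in> carrier (op_algebra X)"
    using adjoint_pair_sym[OF aT] bT by (simp add: op_carrier)
  assume S: "S \<in> carrier (op_algebra X)"
  hence bS: "bounded_on X (fst S)" "bounded_on X (snd S)" and aS: "adjoint_pair (fst S) (snd S)"
    by (auto simp: op_carrier)
  show "S \<oplus>\<^bsub>op_algebra X\<^esub> T \<in> carrier (op_algebra X)"
    using aS aT by (simp add: op_carrier adjoint_pair_def fs_inner_add fs_inner_add_right
        bounded_on_add[OF bS(1) bT(1)] bounded_on_add[OF bS(2) bT(2)])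
  show "S \<otimes>\<^bsub>op_algebra X\<^esub> T \<in> carrier (op_algebra X)"
    using aS aT by (simp add: op_carrier adjoint_pair_def
        bounded_on_comp[OF bS(1) bT(1)] bounded_on_comp[OF bT(2) bS(2)])
qed

lemma op_linear:
  assumes "T \<in> carrier (op_algebra X)"
  shows "fst T (\<xi> + \<eta>) = fst T \<xi> + fst T \<eta>" "fst T (fs_scale c \<xi>) = fs_scale c (fst T \<xi>)" "fst T 0 = 0"
    "snd T (\<xi> + \<eta>) = snd T \<xi> + snd T \<eta>" "snd T (fs_scale c \<xi>) = fs_scale c (snd T \<xi>)" "snd T 0 = 0"
proof -
  have a: "adjoint_pair (fst T) (snd T)" using assms by (simp add: op_carrier)
  note l = adjoint_pair_linear[OF a] adjoint_pair_linear[OF adjoint_pair_sym[OF a]]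
  show "fst T (\<xi> + \<eta>) = fst T \<xi> + fst T \<eta>" "fst T (fs_scale c \<xi>) = fs_scale c (fst T \<xi>)" "fst T 0 = 0"
    "snd T (\<xi> + \<eta>) = snd T \<xi> + snd T \<eta>" "snd T (fs_scale c \<xi>) = fs_scale c (snd T \<xi>)" "snd T 0 = 0"
    by (rule l)+
qed

lemma fs_scale_simps:
  "fs_scale c (\<xi> + \<eta>) = fs_scale c \<xi> + fs_scale c \<eta>" "fs_scale (c + d) \<xi> = fs_scale c \<xi> + fs_scale d \<xi>"
  "fs_scale (c * d) \<xi> = fs_scale c (fs_scale d \<xi>)" "fs_scale 1 \<xi> = \<xi>" "fs_scale (- 1) \<xi> = - \<xi>"
  by (auto intro!: poly_mapping_eqI simp: lookup_add algebra_simps)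

lemma op_star_algebra: "unital_star_algebra (op_algebra X)"
proof (intro unital_star_algebra.intro ringI abelian_groupI Group.monoidI unital_star_algebra_axioms.intro)
  fix T assume T: "T \<in> carrier (op_algebra X)"
  have "(- 1) \<odot>\<^bsub>op_algebra X\<^esub> T \<oplus>\<^bsub>op_algebra X\<^esub> T = \<zero>\<^bsub>op_algebra X\<^esub>"
    by (simp add: fs_scale_simps)
  thus "\<exists>S\<in>carrier (op_algebra X). S \<oplus>\<^bsub>op_algebra X\<^esub> T = \<zero>\<^bsub>op_algebra X\<^esub>"
    using op_closed(3)[OF T] by blast
qed ((rule op_closed; assumption) | simp add: op_linear[where X = X] fs_scale_simps add_ac)+

lemma op_minus:
  assumes "S \<in> carrier (op_algebra X)" "T \<in> carrier (op_algebra X)"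
  shows "fst (S \<ominus>\<^bsub>op_algebra X\<^esub> T) \<xi> = fst S \<xi> - fst T \<xi>"
proof -
  interpret O: unital_star_algebra "op_algebra X" by (rule op_star_algebra)
  have "(- 1) \<odot>\<^bsub>op_algebra X\<^esub> T \<oplus>\<^bsub>op_algebra X\<^esub> T = \<zero>\<^bsub>op_algebra X\<^esub>"
    by (simp add: fs_scale_simps)
  hence "\<ominus>\<^bsub>op_algebra X\<^esub> T = (- 1) \<odot>\<^bsub>op_algebra X\<^esub> T"
    by (rule O.minus_equality) (use assms op_closed(3) in blast)+
  thus ?thesis by (simp add: a_minus_def fs_scale_simps)
qed

text \<open>An infimum of bounds rather than a supremum of quotients, so that the definition makes
  no exception for the zero function or for an empty \<open>X\<close>.\<close>

definition op_norm :: "'x set \<Rightarrow> (('x \<Rightarrow>\<^sub>0 complex) \<Rightarrow> ('x \<Rightarrow>\<^sub>0 complex)) \<Rightarrow> real" where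
  "op_norm X T = Inf {C. C \<ge> 0 \<and> (\<forall>\<xi>. Poly_Mapping.keys \<xi> \<subseteq> X \<longrightarrow> fs_norm (T \<xi>) \<le> C * fs_norm \<xi>)}"

lemma op_norm_le:
  assumes "C \<ge> 0" "\<And>\<xi>. Poly_Mapping.keys \<xi> \<subseteq> X \<Longrightarrow> fs_norm (T \<xi>) \<le> C * fs_norm \<xi>"
  shows "op_norm X T \<le> C"
  unfolding op_norm_def by (rule cInf_lower) (use assms in \<open>auto intro: bdd_belowI[of _ 0]\<close>)

lemma op_norm_nonneg: "bounded_on X T \<Longrightarrow> 0 \<le> op_norm X T"
  unfolding op_norm_def by (rule cInf_greatest) (auto simp: bounded_on_def)

lemma op_norm_bound:
  assumes T: "bounded_on X T" and k: "Poly_Mapping.keys \<xi> \<subseteq> X"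
  shows "fs_norm (T \<xi>) \<le> op_norm X T * fs_norm \<xi>"
proof (cases "fs_norm \<xi> = 0")
  case True
  obtain C where "C \<ge> 0" "\<And>\<xi>. Poly_Mapping.keys \<xi> \<subseteq> X \<Longrightarrow> fs_norm (T \<xi>) \<le> C * fs_norm \<xi>"
    using T by (auto simp: bounded_on_def)
  from this(2)[OF k] show ?thesis using True by simp
next
  case False
  hence pos: "fs_norm \<xi> > 0" using fs_norm_nonneg[of \<xi>] by linarith
  have "fs_norm (T \<xi>) / fs_norm \<xi> \<le> op_norm X T"
    unfolding op_norm_def
  proof (rule cInf_greatest)
    show "{C. C \<ge> 0 \<and> (\<forall>\<xi>. Poly_Mapping.keys \<xi> \<subseteq> X \<longrightarrow> fs_norm (T \<xi>) \<le> C * fs_norm \<xi>)} \<noteq> {}"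
      using T by (auto simp: bounded_on_def)
  qed (use k pos in \<open>simp add: pos_divide_le_eq\<close>)
  thus ?thesis using pos by (simp add: pos_divide_le_eq)
qed

lemma op_norm_adjoint_le:
  assumes T: "bounded_on X T" "bounded_on X T'" and adj: "adjoint_pair T T'"
  shows "op_norm X T' \<le> op_norm X T"
proof (rule op_norm_le[OF op_norm_nonneg[OF T(1)]])
  fix \<xi> :: "'a \<Rightarrow>\<^sub>0 complex" assume k: "Poly_Mapping.keys \<xi> \<subseteq> X"
  note kT = bounded_on_keys[OF T(2) k]
  have "(fs_norm (T' \<xi>))\<^sup>2 = cmod (fs_inner (T' \<xi>) (T' \<xi>))"
    unfolding fs_inner_self by (simp add: norm_power)
  also have "\<dots> = cmod (fs_inner (T (T' \<xi>)) \<xi>)" using adj by (simp add: adjoint_pair_def)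
  also have "\<dots> \<le> fs_norm (T (T' \<xi>)) * fs_norm \<xi>" by (rule fs_cauchy_schwarz)
  also have "\<dots> \<le> op_norm X T * fs_norm (T' \<xi>) * fs_norm \<xi>"
    by (intro mult_right_mono op_norm_bound T kT fs_norm_nonneg)
  finally have le: "fs_norm (T' \<xi>) * fs_norm (T' \<xi>) \<le> (op_norm X T * fs_norm \<xi>) * fs_norm (T' \<xi>)"
    by (simp add: power2_eq_square mult_ac)
  show "fs_norm (T' \<xi>) \<le> op_norm X T * fs_norm \<xi>"
  proof (cases "fs_norm (T' \<xi>) = 0")
    case True
    thus ?thesis using op_norm_nonneg[OF T(1)] by simp
  next
    case False
    hence "0 < fs_norm (T' \<xi>)" using fs_norm_nonneg[of "T' \<xi>"] by linarith
    thus ?thesis using le by simp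
  qed
qed

text \<open>In general only a seminorm, because operators are measured on \<open>X\<close> alone.
  Cauchy-Schwarz gives the lower half of the C*-identity, and the norm bound for adjoints gives the
  upper half.\<close>

lemma op_seminorm: "cstar_seminorm (op_algebra X) (\<lambda>T. op_norm X (fst T))"
  unfolding cstar_seminorm_def
proof (intro conjI ballI allI)
  fix T assume T: "T \<in> carrier (op_algebra X)"
  hence b: "bounded_on X (fst T)" "bounded_on X (snd T)" and adj: "adjoint_pair (fst T) (snd T)"
    by (auto simp: op_carrier)
  note nn = op_norm_nonneg[OF b(1)]
  show "0 \<le> op_norm X (fst T)" by (rule nn)
  show "op_norm X (fst (c \<odot>\<^bsub>op_algebra X\<^esub> T)) = cmod c * op_norm X (fst T)" for c
  proof (rule antisym)
    show "op_norm X (fst (c \<odot>\<^bsub>op_algebra X\<^esub> T)) \<le> cmod c * op_norm X (fst T)"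
      by (rule op_norm_le)
        (use nn in \<open>simp_all add: fs_norm_scale mult.assoc mult_left_mono op_norm_bound[OF b(1)]\<close>)
    show "cmod c * op_norm X (fst T) \<le> op_norm X (fst (c \<odot>\<^bsub>op_algebra X\<^esub> T))"
    proof (cases "c = 0")
      case True
      thus ?thesis using op_norm_nonneg[OF bounded_on_scale[OF b(1)]] by simp
    next
      case False
      have "op_norm X (fst T) \<le> op_norm X (\<lambda>\<xi>. fs_scale c (fst T \<xi>)) / cmod c"
      proof (rule op_norm_le)
        fix \<xi> :: "'a \<Rightarrow>\<^sub>0 complex" assume k: "Poly_Mapping.keys \<xi> \<subseteq> X"
        show "fs_norm (fst T \<xi>) \<le> op_norm X (\<lambda>\<xi>. fs_scale c (fst T \<xi>)) / cmod c * fs_norm \<xi>"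
          using op_norm_bound[OF bounded_on_scale[OF b(1)] k, of c] False
          by (simp add: fs_norm_scale pos_le_divide_eq mult.commute)
      qed (simp add: op_norm_nonneg[OF bounded_on_scale[OF b(1)]])
      thus ?thesis using False by (simp add: pos_le_divide_eq mult.commute)
    qed
  qed
  show "op_norm X (fst (star\<^bsub>op_algebra X\<^esub> T \<otimes>\<^bsub>op_algebra X\<^esub> T)) = (op_norm X (fst T))\<^sup>2"
  proof (rule antisym)
    let ?N = "op_norm X (\<lambda>\<xi>. snd T (fst T \<xi>))"
    have bN: "bounded_on X (\<lambda>\<xi>. snd T (fst T \<xi>))" by (rule bounded_on_comp[OF b(2,1)])
    have "op_norm X (fst T) \<le> sqrt ?N"
    proof (rule op_norm_le)
      fix \<xi> :: "'a \<Rightarrow>\<^sub>0 complex" assume k: "Poly_Mapping.keys \<xi> \<subseteq> X"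
      have "(fs_norm (fst T \<xi>))\<^sup>2 = cmod (fs_inner (fst T \<xi>) (fst T \<xi>))"
        unfolding fs_inner_self by (simp add: norm_power)
      also have "\<dots> = cmod (fs_inner \<xi> (snd T (fst T \<xi>)))" using adj by (simp add: adjoint_pair_def)
      also have "\<dots> \<le> fs_norm \<xi> * fs_norm (snd T (fst T \<xi>))" by (rule fs_cauchy_schwarz)
      also have "\<dots> \<le> fs_norm \<xi> * (?N * fs_norm \<xi>)"
        by (intro mult_left_mono op_norm_bound[OF bN k] fs_norm_nonneg)
      also have "\<dots> = (sqrt ?N * fs_norm \<xi>)\<^sup>2"
        using op_norm_nonneg[OF bN] by (simp add: power_mult_distrib power2_eq_square)
      finally show "fs_norm (fst T \<xi>) \<le> sqrt ?N * fs_norm \<xi>"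
        by (rule power2_le_imp_le) (simp add: op_norm_nonneg[OF bN])
    qed (simp add: op_norm_nonneg[OF bN])
    hence "(op_norm X (fst T))\<^sup>2 \<le> ?N"
      using power_mono[OF _ nn, of "sqrt ?N" 2] op_norm_nonneg[OF bN] by simp
    thus "(op_norm X (fst T))\<^sup>2 \<le> op_norm X (fst (star\<^bsub>op_algebra X\<^esub> T \<otimes>\<^bsub>op_algebra X\<^esub> T))" by simp
    have "?N \<le> (op_norm X (fst T))\<^sup>2"
    proof (rule op_norm_le)
      fix \<xi> :: "'a \<Rightarrow>\<^sub>0 complex" assume k: "Poly_Mapping.keys \<xi> \<subseteq> X"
      have "fs_norm (snd T (fst T \<xi>)) \<le> op_norm X (snd T) * fs_norm (fst T \<xi>)"
        by (rule op_norm_bound[OF b(2) bounded_on_keys[OF b(1) k]])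
      also have "\<dots> \<le> op_norm X (fst T) * (op_norm X (fst T) * fs_norm \<xi>)"
        by (intro mult_mono op_norm_adjoint_le[OF b adj] op_norm_bound[OF b(1) k] nn fs_norm_nonneg)
      finally show "fs_norm (snd T (fst T \<xi>)) \<le> (op_norm X (fst T))\<^sup>2 * fs_norm \<xi>"
        by (simp add: power2_eq_square mult.assoc)
    qed simp
    thus "op_norm X (fst (star\<^bsub>op_algebra X\<^esub> T \<otimes>\<^bsub>op_algebra X\<^esub> T)) \<le> (op_norm X (fst T))\<^sup>2" by simp
  qed
  fix S assume "S \<in> carrier (op_algebra X)"
  hence bS: "bounded_on X (fst S)" by (auto simp: op_carrier)
  show "op_norm X (fst (T \<oplus>\<^bsub>op_algebra X\<^esub> S)) \<le> op_norm X (fst T) + op_norm X (fst S)"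
  proof (rule op_norm_le)
    fix \<xi> :: "'a \<Rightarrow>\<^sub>0 complex" assume k: "Poly_Mapping.keys \<xi> \<subseteq> X"
    show "fs_norm (fst (T \<oplus>\<^bsub>op_algebra X\<^esub> S) \<xi>) \<le> (op_norm X (fst T) + op_norm X (fst S)) * fs_norm \<xi>"
      using fs_norm_triangle[of "fst T \<xi>" "fst S \<xi>"] op_norm_bound[OF b(1) k] op_norm_bound[OF bS k]
      by (simp add: distrib_right)
  qed (use nn op_norm_nonneg[OF bS] in simp)
  show "op_norm X (fst (T \<otimes>\<^bsub>op_algebra X\<^esub> S)) \<le> op_norm X (fst T) * op_norm X (fst S)"
  proof (rule op_norm_le)
    fix \<xi> :: "'a \<Rightarrow>\<^sub>0 complex" assume k: "Poly_Mapping.keys \<xi> \<subseteq> X"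
    have "fs_norm (fst T (fst S \<xi>)) \<le> op_norm X (fst T) * fs_norm (fst S \<xi>)"
      by (rule op_norm_bound[OF b(1) bounded_on_keys[OF bS k]])
    also have "\<dots> \<le> op_norm X (fst T) * (op_norm X (fst S) * fs_norm \<xi>)"
      by (intro mult_left_mono op_norm_bound[OF bS k] nn)
    finally show "fs_norm (fst (T \<otimes>\<^bsub>op_algebra X\<^esub> S) \<xi>) \<le> op_norm X (fst T) * op_norm X (fst S) * fs_norm \<xi>"
      by (simp add: mult.assoc)
  qed (use nn op_norm_nonneg[OF bS] in simp)
qed


section \<open>Partial translations\<close>

text \<open>\<open>Abs_poly_mapping\<close> is meaningful only for finite supports. In
  \<open>partial_bijection\<close> this is ensured by the injectivity of \<open>f\<close> on
  \<open>D\<close>.\<close>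

definition pull :: "'x set \<Rightarrow> ('x \<Rightarrow> 'x) \<Rightarrow> ('x \<Rightarrow>\<^sub>0 complex) \<Rightarrow> ('x \<Rightarrow>\<^sub>0 complex)" where
  "pull D f \<xi> = Poly_Mapping.Abs_poly_mapping (\<lambda>x. if x \<in> D then Poly_Mapping.lookup \<xi> (f x) else 0)"

locale partial_bijection =
  fixes D E :: "'x set" and f f' :: "'x \<Rightarrow> 'x"
  assumes f: "x \<in> D \<Longrightarrow> f x \<in> E" "x \<in> D \<Longrightarrow> f' (f x) = x"
    and f': "y \<in> E \<Longrightarrow> f' y \<in> D" "y \<in> E \<Longrightarrow> f (f' y) = y"
begin

lemma inj: "inj_on f D"
  by (rule inj_on_inverseI[of _ f']) (rule f(2))

lemma finite_pull: "finite {x \<in> D. f x \<in> Poly_Mapping.keys \<xi>}"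
proof -
  have "finite (f -` Poly_Mapping.keys \<xi> \<inter> D)" by (rule finite_vimage_IntI[OF _ inj]) simp
  moreover have "{x \<in> D. f x \<in> Poly_Mapping.keys \<xi>} = f -` Poly_Mapping.keys \<xi> \<inter> D" by auto
  ultimately show ?thesis by simp
qed

lemma lookup_pull:
  "Poly_Mapping.lookup (pull D f \<xi>) x = (if x \<in> D then Poly_Mapping.lookup \<xi> (f x) else 0)"
proof -
  have "{x. (if x \<in> D then Poly_Mapping.lookup \<xi> (f x) else 0) \<noteq> 0} = {x \<in> D. f x \<in> Poly_Mapping.keys \<xi>}"
    by (auto simp: in_keys_iff split: if_splits)
  hence "finite {x. (if x \<in> D then Poly_Mapping.lookup \<xi> (f x) else 0) \<noteq> 0}"
    using finite_pull by simp
  thus ?thesis unfolding pull_def by (simp add: Abs_poly_mapping_inverse)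
qed

lemma keys_pull: "Poly_Mapping.keys (pull D f \<xi>) = {x \<in> D. f x \<in> Poly_Mapping.keys \<xi>}"
  by (auto simp: in_keys_iff lookup_pull split: if_splits)

lemma pull_norm: "fs_norm (pull D f \<xi>) \<le> fs_norm \<xi>"
proof -
  let ?K = "{x \<in> D. f x \<in> Poly_Mapping.keys \<xi>}"
  have inj: "inj_on f ?K" using inj by (rule inj_on_subset) auto
  have "(\<Sum>x\<in>?K. (cmod (Poly_Mapping.lookup (pull D f \<xi>) x))\<^sup>2) =
      (\<Sum>y\<in>f ` ?K. (cmod (Poly_Mapping.lookup \<xi> y))\<^sup>2)"
    by (subst sum.reindex[OF inj]) (auto intro!: sum.cong simp: lookup_pull)
  also have "\<dots> \<le> (\<Sum>y\<in>Poly_Mapping.keys \<xi>. (cmod (Poly_Mapping.lookup \<xi> y))\<^sup>2)"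
    by (rule sum_mono2) auto
  finally show ?thesis unfolding fs_norm_def L2_set_def keys_pull by (rule real_sqrt_le_mono)
qed

lemma pull_bounded: "D \<subseteq> X \<Longrightarrow> bounded_on X (pull D f)"
  by (rule bounded_onI[of _ _ 1]) (auto simp: keys_pull pull_norm)

text \<open>Reindexing the sum along the bijection moves the translation to the other argument as
  its inverse.\<close>

lemma pull_adjoint: "adjoint_pair (pull D f) (pull E f')"
  unfolding adjoint_pair_def
proof (intro allI)
  fix \<xi> \<eta> :: "'x \<Rightarrow>\<^sub>0 complex"
  interpret inv: partial_bijection E D f' f
    by unfold_locales (simp_all add: f f')
  have "fs_inner (pull D f \<xi>) \<eta> =
      (\<Sum>x\<in>{x \<in> D. f x \<in> Poly_Mapping.keys \<xi>}. Poly_Mapping.lookup \<xi> (f x) * cnj (Poly_Mapping.lookup \<eta> x))"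
    unfolding fs_inner_def keys_pull by (rule sum.cong) (auto simp: lookup_pull)
  also have "\<dots> = (\<Sum>y\<in>E \<inter> Poly_Mapping.keys \<xi>. Poly_Mapping.lookup \<xi> y * cnj (Poly_Mapping.lookup \<eta> (f' y)))"
    by (rule sum.reindex_bij_witness[of _ f' f]) (auto simp: f f')
  also have "\<dots> = (\<Sum>y\<in>E \<inter> Poly_Mapping.keys \<xi>. Poly_Mapping.lookup \<xi> y * cnj (Poly_Mapping.lookup (pull E f' \<eta>) y))"
    by (rule sum.cong) (auto simp: inv.lookup_pull)
  also have "\<dots> = fs_inner \<xi> (pull E f' \<eta>)"
    by (rule fs_inner_sum[symmetric]) (auto simp: inv.lookup_pull in_keys_iff)
  finally show "fs_inner (pull D f \<xi>) \<eta> = fs_inner \<xi> (pull E f' \<eta>)" .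
qed

lemma pull_single: "pull D f (Poly_Mapping.single y c) = (if y \<in> E then Poly_Mapping.single (f' y) c else 0)"
  by (rule poly_mapping_eqI) (auto simp: lookup_pull lookup_single when_def f f')

lemma pull_carrier: "D \<subseteq> X \<Longrightarrow> E \<subseteq> X \<Longrightarrow> (pull D f, pull E f') \<in> carrier (op_algebra X)"
proof -
  interpret inv: partial_bijection E D f' f
    by unfold_locales (simp_all add: f f')
  show "D \<subseteq> X \<Longrightarrow> E \<subseteq> X \<Longrightarrow> ?thesis"
    by (simp add: op_carrier pull_adjoint pull_bounded inv.pull_bounded)
qed

end

text \<open>By linearity, each relator reduces to a computation with basis vectors, and only those
  in \<open>X\<close> matter.\<close>

lemma op_zero_on_singles:
  assumes T: "T \<in> carrier (op_algebra X)"
    and z: "\<And>x c. x \<in> X \<Longrightarrow> fst T (Poly_Mapping.single x c) = 0"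
  shows "op_norm X (fst T) = 0"
proof (rule antisym)
  have zero: "fst T \<xi> = 0" if "Poly_Mapping.keys \<xi> \<subseteq> X" for \<xi>
    using that
  proof (induction \<xi> rule: update_induct)
    case const
    show ?case by (rule op_linear(3)[OF T])
  next
    case (update \<xi> x c)
    have eq: "Poly_Mapping.update x c \<xi> = Poly_Mapping.single x c + \<xi>"
      using update.hyps
      by (intro poly_mapping_eqI) (auto simp: lookup_update lookup_add lookup_single when_def in_keys_iff)
    have "x \<in> X" "Poly_Mapping.keys \<xi> \<subseteq> X"
      using update.prems update.hyps by (auto simp: keys_update)
    thus ?case unfolding eq by (simp add: op_linear(1)[OF T] z update.IH)
  qed
  show "op_norm X (fst T) \<le> 0" by (rule op_norm_le) (simp_all add: zero)
  show "0 \<le> op_norm X (fst T)" by (rule op_norm_nonneg) (use T in \<open>simp add: op_carrier\<close>)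
qed

text \<open>The translations act on \<open>X = {g. g B \<subseteq> P}\<close>.  For \<open>B = P\<close> this is the left regular
  representation; for other \<open>B\<close> the projection \<open>e\<^sub>S\<close> becomes the indicator of \<open>{g. g B \<subseteq> S}\<close>, a set
  that does not commute with unions in \<open>S\<close>.  This separates an ideal from unions of smaller ones.\<close>

locale translation_rep = submonoid_of_group +
  fixes B :: "'a set"
  assumes B: "B \<subseteq> P" "B \<noteq> {}"
begin

definition into where "into S = {g \<in> carrier G. \<forall>b\<in>B. g \<otimes> b \<in> S}"

abbreviation X where "X \<equiv> into P"
abbreviation OA where "OA \<equiv> op_algebra X"

lemma B_carrier [simp]: "b \<in> B \<Longrightarrow> b \<in> carrier G"
  using B P_carrier by blast

lemma into_carrier: "g \<in> into S \<Longrightarrow> g \<in> carrier G"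
  by (simp add: into_def)

lemma into_mono: "S \<subseteq> T \<Longrightarrow> into S \<subseteq> into T"
  by (auto simp: into_def)

text \<open>Pulling back along the inverse translation moves the basis vector at \<open>y\<close> to
  the one at \<open>g \<otimes> y\<close>, or to zero if this point lies outside
  \<open>X\<close>.\<close>

definition trans where
  "trans g = pull {x \<in> X. inv g \<otimes> x \<in> X} (\<lambda>x. inv g \<otimes> x)"

lemma trans_bij:
  assumes "g \<in> carrier G"
  shows "partial_bijection {x \<in> X. inv g \<otimes> x \<in> X} {x \<in> X. g \<otimes> x \<in> X} (\<lambda>x. inv g \<otimes> x) (\<lambda>x. g \<otimes> x)"
  by unfold_locales (use assms into_carrier in \<open>auto simp: m_assoc[symmetric]\<close>)

lemma trans_single:
  assumes "g \<in> carrier G" "y \<in> X"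
  shows "trans g (Poly_Mapping.single y c) = (if g \<otimes> y \<in> X then Poly_Mapping.single (g \<otimes> y) c else 0)"
  unfolding trans_def using partial_bijection.pull_single[OF trans_bij[OF assms(1)]] assms(2) by simp

lemma trans_carrier:
  assumes "g \<in> carrier G"
  shows "(trans g, trans (inv g)) \<in> carrier OA"
  unfolding trans_def using partial_bijection.pull_carrier[OF trans_bij[OF assms], of X] assms by auto

definition V where "V p = (trans p, trans (inv p))"
definition Q where "Q S = (pull (into S) (\<lambda>x. x), pull (into S) (\<lambda>x. x))"

lemma V_carrier [simp]: "p \<in> P \<Longrightarrow> V p \<in> carrier OA"
  by (simp add: V_def trans_carrier)

lemma Q_bij: "partial_bijection (into S) (into S) (\<lambda>x. x) (\<lambda>x. x)"
  by unfold_locales simp_all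

lemma Q_single: "fst (Q S) (Poly_Mapping.single y c) = (if y \<in> into S then Poly_Mapping.single y c else 0)"
  unfolding Q_def using partial_bijection.pull_single[OF Q_bij] by simp

lemma Q_carrier: "S \<subseteq> P \<Longrightarrow> Q S \<in> carrier OA"
  unfolding Q_def by (intro partial_bijection.pull_carrier[OF Q_bij] into_mono)

lemma mult_X: "p \<in> P \<Longrightarrow> x \<in> X \<Longrightarrow> p \<otimes> x \<in> X"
  using m_closed by (auto simp: into_def m_assoc)

lemma word_V_closed [simp]: "\<alpha> \<in> words P \<Longrightarrow> word_op OA V \<alpha> \<in> carrier OA"
proof -
  interpret O: unital_star_algebra OA by (rule op_star_algebra)
  show "\<alpha> \<in> words P \<Longrightarrow> ?thesis" by (rule O.word_op_closed) auto
qed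

text \<open>A basis vector survives exactly if all intermediate points stay in \<open>X\<close>.
  Tested on every element of \<open>B\<close>, these conditions are the recursion for the ideal of
  the word.\<close>

lemma word_V_single:
  assumes "\<alpha> \<in> words P" "y \<in> X"
  shows "fst (word_op OA V \<alpha>) (Poly_Mapping.single y c) =
    (if y \<in> into (constr_ideal G P \<alpha>) then Poly_Mapping.single (word_eval G \<alpha> \<otimes> y) c else 0)"
  using assms(1)
proof (induction rule: words_induct)
  case Nil
  show ?case using assms(2) into_carrier[OF assms(2)] by (simp add: constr_ideal_Nil)
next
  case (Cons2 p q \<alpha>)
  let ?z = "word_eval G \<alpha> \<otimes> y"
  have y: "y \<in> carrier G" using assms(2) by (rule into_carrier)
  have op: "fst (word_op OA V (p # q # \<alpha>)) \<xi> = trans (inv p) (trans q (fst (word_op OA V \<alpha>) \<xi>))" for \<xi>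
    by (simp add: V_def)
  show ?case
  proof (cases "y \<in> into (constr_ideal G P \<alpha>)")
    case False
    hence "y \<notin> into (constr_ideal G P (p # q # \<alpha>))"
      using Cons2 y by (auto simp: into_def constr_ideal_Cons2)
    moreover have "trans g 0 = 0" if "g \<in> carrier G" for g
      using op_linear(3)[OF trans_carrier[OF that]] by simp
    ultimately show ?thesis unfolding op using Cons2 False by simp
  next
    case True
    have z: "?z \<in> X"
      using True y Cons2 word_eval_constr_ideal[OF Cons2(3)] by (auto simp: into_def m_assoc)
    have qz: "q \<otimes> ?z \<in> X" by (rule mult_X[OF Cons2(2) z])
    have e: "inv p \<otimes> (q \<otimes> ?z) = word_eval G (p # q # \<alpha>) \<otimes> y"
      using Cons2 y by (simp add: m_assoc)
    \<comment> \<open>Multiplication by \<open>q\<close> never leaves \<open>X\<close>, so only the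
      step by \<open>inv p\<close> can; staying in \<open>X\<close> is the condition that
      \<open>constr_ideal_Cons2\<close> adds, imposed at each \<open>y \<otimes> b\<close>.\<close>
    have iff: "inv p \<otimes> (q \<otimes> ?z) \<in> X \<longleftrightarrow> y \<in> into (constr_ideal G P (p # q # \<alpha>))"
      using Cons2 y True by (auto simp: into_def constr_ideal_Cons2 m_assoc)
    show ?thesis
      unfolding op using True Cons2 qz iff e
      by (simp add: trans_single[OF _ z] trans_single[OF _ qz] del: word_eval.simps)
  qed
qed

text \<open>The relations hold only on functions supported in \<open>X\<close>, so the relators have
  seminorm zero without having to be the zero operator. This is enough for an admissible
  seminorm.\<close>

lemma li_relators_op_zero:
  assumes r: "r \<in> li_relators G P OA V Q"
  shows "op_norm X (fst r) = 0"
proof -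
  interpret O: unital_star_algebra OA by (rule op_star_algebra)
  have sub: "S \<subseteq> P" if "S \<in> constr_ideals G P \<union> {{}}" for S
    using that constr_ideal_subset by (auto simp: constr_ideals_def)
  have close: "op_norm X (fst (S \<ominus>\<^bsub>OA\<^esub> T)) = 0"
    if "S \<in> carrier OA" "T \<in> carrier OA"
      "\<And>x c. x \<in> X \<Longrightarrow> fst S (Poly_Mapping.single x c) = fst T (Poly_Mapping.single x c)" for S T
    by (rule op_zero_on_singles) (use that in \<open>simp_all add: op_minus del: op_algebra_simps\<close>)
  from r show ?thesis
    unfolding li_relators_def
  proof (elim UnE)
    assume "r \<in> {star\<^bsub>OA\<^esub> (V p) \<otimes>\<^bsub>OA\<^esub> V p \<ominus>\<^bsub>OA\<^esub> \<one>\<^bsub>OA\<^esub> | p. p \<in> P}"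
    then obtain p where p: "p \<in> P" "r = star\<^bsub>OA\<^esub> (V p) \<otimes>\<^bsub>OA\<^esub> V p \<ominus>\<^bsub>OA\<^esub> \<one>\<^bsub>OA\<^esub>" by blast
    show ?thesis
      unfolding p(2)
    proof (rule close)
      fix x c assume x: "x \<in> X"
      show "fst (star\<^bsub>OA\<^esub> (V p) \<otimes>\<^bsub>OA\<^esub> V p) (Poly_Mapping.single x c) = fst \<one>\<^bsub>OA\<^esub> (Poly_Mapping.single x c)"
        using p(1) x into_carrier[OF x] mult_X[OF p(1) x]
        by (simp add: V_def trans_single m_assoc[symmetric])
    qed (use p(1) in \<open>auto intro!: O.m_closed O.star_closed simp del: op_algebra_simps\<close>)
  next
    assume "r \<in> {star\<^bsub>OA\<^esub> (Q S) \<ominus>\<^bsub>OA\<^esub> Q S | S. S \<in> constr_ideals G P \<union> {{}}}"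
    then obtain S where S: "S \<in> constr_ideals G P \<union> {{}}" "r = star\<^bsub>OA\<^esub> (Q S) \<ominus>\<^bsub>OA\<^esub> Q S" by blast
    have "star\<^bsub>OA\<^esub> (Q S) = Q S" by (simp add: Q_def)
    thus ?thesis unfolding S(2) using Q_carrier[OF sub[OF S(1)]] by (intro close) simp_all
  next
    assume "r \<in> {Q S \<otimes>\<^bsub>OA\<^esub> Q S \<ominus>\<^bsub>OA\<^esub> Q S | S. S \<in> constr_ideals G P \<union> {{}}}"
    then obtain S where S: "S \<in> constr_ideals G P \<union> {{}}" "r = Q S \<otimes>\<^bsub>OA\<^esub> Q S \<ominus>\<^bsub>OA\<^esub> Q S" by blast
    note c = Q_carrier[OF sub[OF S(1)]]
    show ?thesis
      unfolding S(2)
    proof (rule close[OF O.m_closed[OF c c] c])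
      fix x c
      show "fst (Q S \<otimes>\<^bsub>OA\<^esub> Q S) (Poly_Mapping.single x c) = fst (Q S) (Poly_Mapping.single x c)"
        using op_linear(3)[OF Q_carrier[OF sub[OF S(1)]]] by (simp add: Q_single)
    qed
  next
    assume "r \<in> {V p \<otimes>\<^bsub>OA\<^esub> V q \<ominus>\<^bsub>OA\<^esub> V (p \<otimes> q) | p q. p \<in> P \<and> q \<in> P}"
    then obtain p q where pq: "p \<in> P" "q \<in> P" "r = V p \<otimes>\<^bsub>OA\<^esub> V q \<ominus>\<^bsub>OA\<^esub> V (p \<otimes> q)" by blast
    show ?thesis
      unfolding pq(3)
    proof (rule close)
      fix x c assume x: "x \<in> X"
      show "fst (V p \<otimes>\<^bsub>OA\<^esub> V q) (Poly_Mapping.single x c) = fst (V (p \<otimes> q)) (Poly_Mapping.single x c)"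
        using pq x into_carrier[OF x] mult_X[OF pq(2) x] mult_X[OF pq(1) mult_X[OF pq(2) x]]
        by (simp add: V_def trans_single m_assoc)
    qed (use pq in \<open>auto intro!: O.m_closed simp del: op_algebra_simps\<close>)
  next
    assume "r \<in> {Q {}}"
    hence "r = Q {}" by simp
    \<comment> \<open>Nonemptiness of \<open>B\<close> enters here: otherwise \<open>into {}\<close>
      would be the whole group.\<close>
    moreover have "into {} = {}" using B by (auto simp: into_def)
    ultimately show ?thesis
      using Q_carrier[of "{}"] by (intro op_zero_on_singles) (simp_all add: Q_single)
  next
    assume "r \<in> {word_op OA V \<alpha> \<ominus>\<^bsub>OA\<^esub> Q S | \<alpha> S.
        S \<in> constr_ideals G P \<and> \<alpha> \<in> neutral_words G P \<and> constr_ideal G P \<alpha> = S}"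
    then obtain \<alpha> where \<alpha>: "\<alpha> \<in> neutral_words G P" "r = word_op OA V \<alpha> \<ominus>\<^bsub>OA\<^esub> Q (constr_ideal G P \<alpha>)"
      by blast
    have w: "\<alpha> \<in> words P" "word_eval G \<alpha> = \<one>" using \<alpha>(1) by (auto simp: neutral_words_def)
    show ?thesis
      unfolding \<alpha>(2)
    proof (rule close)
      fix x c assume x: "x \<in> X"
      show "fst (word_op OA V \<alpha>) (Poly_Mapping.single x c) =
          fst (Q (constr_ideal G P \<alpha>)) (Poly_Mapping.single x c)"
        using word_V_single[OF w(1) x] into_carrier[OF x] by (simp add: Q_single w(2))
    qed (use w constr_ideal_subset in \<open>auto intro: Q_carrier\<close>)
  qed
qed

text \<open>The identity of the group lies in \<open>into S\<close> exactly if \<open>B\<close> is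
  contained in \<open>S\<close>. This holds for the ideal of \<alpha>, which is \<open>B\<close>,
  and fails for each \<beta>, so every factor fixes the basis vector there.\<close>

lemma gap_op_norm:
  assumes \<alpha>: "\<alpha> \<in> neutral_words G P" "B = constr_ideal G P \<alpha>"
    and \<beta>s: "set \<beta>s \<subseteq> neutral_words G P" "\<And>\<beta>. \<beta> \<in> set \<beta>s \<Longrightarrow> \<not> B \<subseteq> constr_ideal G P \<beta>"
  shows "op_norm X (fst (foldr (\<otimes>\<^bsub>OA\<^esub>) (map (\<lambda>\<beta>. word_op OA V \<alpha> \<ominus>\<^bsub>OA\<^esub> word_op OA V \<beta>) \<beta>s) \<one>\<^bsub>OA\<^esub>)) \<noteq> 0"
    (is "op_norm X (fst ?d) \<noteq> 0")
proof
  interpret O: unital_star_algebra OA by (rule op_star_algebra)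
  let ?\<delta> = "Poly_Mapping.single \<one> (1::complex)"
  have oneX: "\<one> \<in> X" using B by (auto simp: into_def)
  have w: "\<gamma> \<in> words P" "word_eval G \<gamma> = \<one>" if "\<gamma> \<in> neutral_words G P" for \<gamma>
    using that by (auto simp: neutral_words_def)
  have "\<one> \<in> into B" by (auto simp: into_def)
  hence a: "fst (word_op OA V \<alpha>) ?\<delta> = ?\<delta>"
    using word_V_single[OF w(1)[OF \<alpha>(1)] oneX] w(2)[OF \<alpha>(1)] by (simp add: \<alpha>(2)[symmetric])
  have b: "fst (word_op OA V \<beta>) ?\<delta> = 0" if "\<beta> \<in> set \<beta>s" for \<beta>
  proof -
    have n: "\<beta> \<in> neutral_words G P" using that \<beta>s(1) by blast
    have "\<one> \<notin> into (constr_ideal G P \<beta>)" using \<beta>s(2)[OF that] by (auto simp: into_def)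
    thus ?thesis using word_V_single[OF w(1)[OF n] oneX] by simp
  qed
  have "?d \<in> carrier OA \<and> fst ?d ?\<delta> = ?\<delta>"
    using \<beta>s(1) b
  proof (induction \<beta>s)
    case Nil
    show ?case using O.one_closed by simp
  next
    case (Cons \<beta> \<beta>s)
    define e where "e = foldr (\<otimes>\<^bsub>OA\<^esub>) (map (\<lambda>\<beta>. word_op OA V \<alpha> \<ominus>\<^bsub>OA\<^esub> word_op OA V \<beta>) \<beta>s) \<one>\<^bsub>OA\<^esub>"
    have e: "e \<in> carrier OA \<and> fst e ?\<delta> = ?\<delta>"
      unfolding e_def by (rule Cons.IH) (use Cons.prems in auto)
    have c: "word_op OA V \<alpha> \<in> carrier OA" "word_op OA V \<beta> \<in> carrier OA"
      using w(1) \<alpha>(1) Cons.prems(1) by auto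
    have "fst (word_op OA V \<alpha> \<ominus>\<^bsub>OA\<^esub> word_op OA V \<beta>) ?\<delta> = ?\<delta>"
      unfolding op_minus[OF c] using a Cons.prems(2)[of \<beta>] by simp
    hence "fst ((word_op OA V \<alpha> \<ominus>\<^bsub>OA\<^esub> word_op OA V \<beta>) \<otimes>\<^bsub>OA\<^esub> e) ?\<delta> = ?\<delta>"
      using e by simp
    moreover have "(word_op OA V \<alpha> \<ominus>\<^bsub>OA\<^esub> word_op OA V \<beta>) \<otimes>\<^bsub>OA\<^esub> e \<in> carrier OA"
      using e by (intro O.m_closed O.minus_closed c) simp
    ultimately show ?case unfolding list.map foldr_Cons comp_apply e_def by (rule conjI[rotated])
  qed
  hence d: "bounded_on X (fst ?d)" "fst ?d ?\<delta> = ?\<delta>" by (simp_all add: op_carrier)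
  have n: "fs_norm ?\<delta> = 1" by (simp add: fs_norm_def)
  assume "op_norm X (fst ?d) = 0"
  thus False using op_norm_bound[OF d(1), of ?\<delta>] oneX unfolding d(2) n by simp
qed

end

context submonoid_of_group begin

text \<open>The operator seminorm pulled back to polynomials is admissible for Li's presentation.
  The universal norm of the product is thus at least its operator norm, which is positive.\<close>

lemma li_gap_nonzero:
  assumes \<alpha>: "\<alpha> \<in> neutral_words G P" "constr_ideal G P \<alpha> \<noteq> {}"
    and \<beta>s: "set \<beta>s \<subseteq> neutral_words G P"
      "\<And>\<beta>. \<beta> \<in> set \<beta>s \<Longrightarrow> \<not> constr_ideal G P \<alpha> \<subseteq> constr_ideal G P \<beta>"
  shows "foldr (\<otimes>\<^bsub>li_algebra G P\<^esub>)
    (map (\<lambda>\<beta>. word_op (li_algebra G P) (li_isom G P) \<alpha> \<ominus>\<^bsub>li_algebra G P\<^esub>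
      word_op (li_algebra G P) (li_isom G P) \<beta>) \<beta>s) \<one>\<^bsub>li_algebra G P\<^esub> \<noteq> \<zero>\<^bsub>li_algebra G P\<^esub>"
proof -
  interpret bounded_presentation "li_gens G P" "li_rels G P" by (rule li_presentation)
  interpret rep: translation_rep G P "constr_ideal G P \<alpha>"
    by unfold_locales (use \<alpha> constr_ideal_subset neutral_words_words in blast)+
  interpret O: unital_star_algebra rep.OA by (rule op_star_algebra)
  interpret L: unital_cstar_algebra "li_algebra G P" by (rule li_algebra_cstar)
  have Q: "rep.Q S \<in> carrier rep.OA" if "S \<in> constr_ideals G P \<union> {{}}" for S
    using that constr_ideal_subset by (intro rep.Q_carrier) (auto simp: constr_ideals_def)
  define g where "g x = (if x \<in> li_gens G P then case x of Isom p \<Rightarrow> rep.V p | Proj S \<Rightarrow> rep.Q S else \<zero>\<^bsub>rep.OA\<^esub>)" for x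
  have g: "g x \<in> carrier rep.OA" for x
    using Q op_closed(6) by (cases x) (auto simp: g_def li_gens_iff simp del: op_algebra_simps)
  have gi: "g (Isom p) = rep.V p" if "p \<in> P" for p using that by (simp add: g_def li_gens_iff)
  have gp: "g (Proj S) = rep.Q S" if "S \<in> constr_ideals G P \<union> {{}}" for S
    using that unfolding g_def li_gens_iff by simp
  note h = poly_val_hom[where g = g, OF op_star_algebra g]
  define \<pi> where "\<pi> = poly_val rep.OA g"
  interpret \<pi>: star_algebra_hom FA rep.OA \<pi> unfolding \<pi>_def by (rule h(1))
  define N where "N f = op_norm rep.X (fst (\<pi> f))" for f
  have "cstar_seminorm FA N"
    unfolding N_def by (rule cstar_seminorm_comp[OF free_unital_star_algebra \<pi>.hom op_seminorm])
  moreover have "N r = 0" if r: "r \<in> li_rels G P" for r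
  proof -
    have "\<pi> ` li_rels G P = li_relators G P rep.OA rep.V rep.Q"
      unfolding li_rels_def \<pi>_def
      by (rule li_relators_hom(2)[OF h(1)]) (auto simp: li_gens_iff h(2) gi gp intro!: poly_gen_carrier)
    hence "\<pi> r \<in> li_relators G P rep.OA rep.V rep.Q" using r by blast
    thus ?thesis unfolding N_def by (rule rep.li_relators_op_zero)
  qed
  ultimately have N: "N \<in> admissible_seminorms (li_gens G P) (li_rels G P)"
    by (simp add: admissible_seminorms_def)
  let ?v = "\<lambda>p. poly_gen (Isom p)"
  have v: "?v p \<in> carrier FA" if "p \<in> P" for p
    using that by (intro poly_gen_carrier) (simp add: li_gens_iff)
  have wc: "word_op FA ?v \<gamma> \<in> carrier FA" if "\<gamma> \<in> neutral_words G P" for \<gamma>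
    by (rule \<pi>.A.word_op_closed[OF v neutral_words_words[OF that]])
  let ?d = "foldr (\<otimes>\<^bsub>FA\<^esub>) (map (\<lambda>\<beta>. word_op FA ?v \<alpha> \<ominus>\<^bsub>FA\<^esub> word_op FA ?v \<beta>) \<beta>s) \<one>\<^bsub>FA\<^esub>"
  have d: "?d \<in> carrier FA" by (rule \<pi>.foldr_diff_closed) (use wc \<alpha> \<beta>s in auto)
  have "\<pi> ?d = foldr (\<otimes>\<^bsub>rep.OA\<^esub>)
      (map (\<lambda>\<beta>. word_op rep.OA rep.V \<alpha> \<ominus>\<^bsub>rep.OA\<^esub> word_op rep.OA rep.V \<beta>) \<beta>s) \<one>\<^bsub>rep.OA\<^esub>"
  proof (rule \<pi>.h_foldr)
    have "\<pi> (word_op FA ?v \<gamma>) = word_op rep.OA rep.V \<gamma>" if "\<gamma> \<in> neutral_words G P" for \<gamma>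
      by (rule \<pi>.h_word_op[OF v _ neutral_words_words[OF that]]) (simp_all add: \<pi>_def h(2) gi)
    thus "\<pi> (word_op FA ?v \<alpha>) = word_op rep.OA rep.V \<alpha>"
      "\<And>\<beta>. \<beta> \<in> set \<beta>s \<Longrightarrow> \<pi> (word_op FA ?v \<beta>) = word_op rep.OA rep.V \<beta>"
      using \<alpha> \<beta>s by auto
  qed (use wc \<alpha> \<beta>s in auto)
  hence "N ?d \<noteq> 0" unfolding N_def using rep.gap_op_norm[OF \<alpha>(1) refl \<beta>s] by simp
  hence "US ?d \<noteq> 0"
    using le_US[OF N d] op_norm_nonneg \<pi>.h_simps(1)[OF d] unfolding N_def op_carrier by force
  hence nz: "completion_incl FA US ?d \<noteq> \<zero>\<^bsub>li_algebra G P\<^esub>"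
    using norm_incl[OF d] L.NS.N_zero unfolding li_algebra_def by metis
  interpret i: star_algebra_hom FA "li_algebra G P" "completion_incl FA US"
    unfolding li_algebra_def by (rule incl_star_hom)
  have "completion_incl FA US ?d = foldr (\<otimes>\<^bsub>li_algebra G P\<^esub>)
    (map (\<lambda>\<beta>. word_op (li_algebra G P) (li_isom G P) \<alpha> \<ominus>\<^bsub>li_algebra G P\<^esub>
      word_op (li_algebra G P) (li_isom G P) \<beta>) \<beta>s) \<one>\<^bsub>li_algebra G P\<^esub>"
  proof (rule i.h_foldr)
    have "completion_incl FA US (word_op FA ?v \<gamma>) = word_op (li_algebra G P) (li_isom G P) \<gamma>"
      if "\<gamma> \<in> neutral_words G P" for \<gamma>
      by (rule i.h_word_op[OF v _ neutral_words_words[OF that]])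
        (simp_all add: li_isom_def universal_gen_def)
    thus "completion_incl FA US (word_op FA ?v \<alpha>) = word_op (li_algebra G P) (li_isom G P) \<alpha>"
      "\<And>\<beta>. \<beta> \<in> set \<beta>s \<Longrightarrow>
        completion_incl FA US (word_op FA ?v \<beta>) = word_op (li_algebra G P) (li_isom G P) \<beta>"
      using \<alpha> \<beta>s by auto
  qed (use wc \<alpha> \<beta>s in auto)
  thus ?thesis using nz by simp
qed

lemma injective_imp_independence:
  assumes \<Lambda>: "\<Lambda> \<in> star_hom (li_algebra G P) (toeplitz_algebra G P)"
    and gen: "\<And>p. p \<in> P \<Longrightarrow> \<Lambda> (li_isom G P p) = toeplitz_gen G P p"
    and inj: "inj_on \<Lambda> (carrier (li_algebra G P))"
  shows "independence G P"
  unfolding independence_def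
proof (intro ballI allI impI, elim conjE, rule ccontr)
  let ?L = "li_algebra G P" and ?T = "toeplitz_algebra G P"
  interpret L: diagonal_family G P ?L "li_isom G P" by (rule li_family)
  interpret T: diagonal_family G P ?T "toeplitz_gen G P" by (rule toeplitz_family)
  interpret \<Lambda>: star_algebra_hom ?L ?T \<Lambda> by unfold_locales (rule \<Lambda>)
  fix \<alpha>' F
  assume \<alpha>': "\<alpha>' \<in> words P" and F: "finite F" "F \<noteq> {}" "F \<subseteq> words P"
    and un: "constr_ideal G P \<alpha>' = (\<Union>\<beta>\<in>F. constr_ideal G P \<beta>)"
    and no: "constr_ideal G P \<alpha>' \<notin> constr_ideal G P ` F"
  \<comment> \<open>Independence speaks of arbitrary words and (T4) of neutral ones; squaring passes
    from the former to the latter and keeps all ideals.\<close>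
  define \<alpha> where "\<alpha> = rev \<alpha>' @ \<alpha>'"
  have \<alpha>: "\<alpha> \<in> neutral_words G P" "constr_ideal G P \<alpha> = constr_ideal G P \<alpha>'"
    unfolding \<alpha>_def by (rule neutral_square[OF \<alpha>'])+
  have "finite ((\<lambda>\<beta>. rev \<beta> @ \<beta>) ` F)" using F by simp
  then obtain \<beta>s where \<beta>s: "set \<beta>s = (\<lambda>\<beta>. rev \<beta> @ \<beta>) ` F" "distinct \<beta>s"
    using finite_distinct_list by blast
  have sq: "rev \<beta> @ \<beta> \<in> neutral_words G P" "constr_ideal G P (rev \<beta> @ \<beta>) = constr_ideal G P \<beta>"
    if "\<beta> \<in> F" for \<beta>
    using that F neutral_square by blast+
  have \<beta>n: "set \<beta>s \<subseteq> neutral_words G P" using \<beta>s(1) sq(1) by auto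
  have un': "constr_ideal G P \<alpha> = (\<Union>\<beta>\<in>set \<beta>s. constr_ideal G P \<beta>)"
    using sq(2) by (simp add: \<alpha>(2) un \<beta>s(1))
  have ne: "\<beta>s \<noteq> []" using \<beta>s(1) F(2) by auto
  let ?dL = "foldr (\<otimes>\<^bsub>?L\<^esub>) (map (\<lambda>\<beta>. L.W \<alpha> \<ominus>\<^bsub>?L\<^esub> L.W \<beta>) \<beta>s) \<one>\<^bsub>?L\<^esub>"
  let ?dT = "foldr (\<otimes>\<^bsub>?T\<^esub>) (map (\<lambda>\<beta>. T.W \<alpha> \<ominus>\<^bsub>?T\<^esub> T.W \<beta>) \<beta>s) \<one>\<^bsub>?T\<^esub>"
  have W: "\<Lambda> (L.W \<gamma>) = T.W \<gamma>" if "\<gamma> \<in> neutral_words G P" for \<gamma>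
    by (rule \<Lambda>.h_word_op[OF li_isom_closed gen neutral_words_words[OF that]])
  have "?dT \<in> toeplitz_relators G P ?T (toeplitz_gen G P)"
    unfolding toeplitz_relators_def
    by (rule UnI2) (intro CollectI exI[of _ \<alpha>] exI[of _ \<beta>s] conjI refl \<alpha>(1) ne \<beta>s(2) \<beta>n un')
  hence "?dT = \<zero>\<^bsub>?T\<^esub>" by (rule toeplitz_relation)
  moreover have "\<Lambda> ?dL = ?dT"
    by (rule \<Lambda>.h_foldr) (use W \<alpha>(1) \<beta>n in auto)
  moreover have "\<Lambda> \<zero>\<^bsub>?L\<^esub> = \<zero>\<^bsub>?T\<^esub>"
    using \<Lambda>.h_minus[of "\<one>\<^bsub>?L\<^esub>" "\<one>\<^bsub>?L\<^esub>"] by (simp add: \<Lambda>.h_simps a_minus_def L.A.r_neg T.A.r_neg)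
  ultimately have eq: "\<Lambda> ?dL = \<Lambda> \<zero>\<^bsub>?L\<^esub>" by simp
  have "?dL \<in> carrier ?L" by (rule \<Lambda>.foldr_diff_closed) (use \<alpha>(1) \<beta>n in auto)
  hence "?dL = \<zero>\<^bsub>?L\<^esub>" using inj_onD[OF inj eq] by simp
  moreover have "?dL \<noteq> \<zero>\<^bsub>?L\<^esub>"
  proof (rule li_gap_nonzero[OF \<alpha>(1) _ \<beta>n])
    \<comment> \<open>The representation needs a nonempty ideal. If the union were empty, so would
      be its members, and as \<open>F\<close> is nonempty the ideal would equal one of them.\<close>
    show "constr_ideal G P \<alpha> \<noteq> {}"
    proof
      assume e: "constr_ideal G P \<alpha> = {}"
      obtain \<beta> where \<beta>: "\<beta> \<in> F" using F(2) by blast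
      have "constr_ideal G P \<beta> = {}" using e un \<beta> \<alpha>(2) by blast
      hence "constr_ideal G P \<alpha>' = constr_ideal G P \<beta>" using e \<alpha>(2) by simp
      thus False using no \<beta> by blast
    qed
    show "\<not> constr_ideal G P \<alpha> \<subseteq> constr_ideal G P \<gamma>" if \<gamma>: "\<gamma> \<in> set \<beta>s" for \<gamma>
    proof
      assume sub: "constr_ideal G P \<alpha> \<subseteq> constr_ideal G P \<gamma>"
      obtain \<beta> where \<beta>: "\<beta> \<in> F" "\<gamma> = rev \<beta> @ \<beta>" using \<gamma> \<beta>s(1) by blast
      have "constr_ideal G P \<gamma> \<subseteq> constr_ideal G P \<alpha>" unfolding un' using \<gamma> by blast
      hence "constr_ideal G P \<alpha>' = constr_ideal G P \<beta>" using sub sq(2)[OF \<beta>(1)] \<beta>(2) \<alpha>(2) by simp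
      thus False using no \<beta>(1) by blast
    qed
  qed
  ultimately show False by simp
qed

end

theorem corollary3p23:
  fixes G :: "('g, 'm) monoid_scheme" and P :: "'g set"
  assumes "group G" and "submonoid P G"
  shows "\<exists>\<Lambda>. \<Lambda> \<in> star_hom (li_algebra G P) (toeplitz_algebra G P) \<and>
    (\<forall>p\<in>P. \<Lambda> (li_isom G P p) = toeplitz_gen G P p) \<and>
    \<Lambda> ` carrier (li_algebra G P) = carrier (toeplitz_algebra G P) \<and>
    (\<Lambda> \<in> star_iso (li_algebra G P) (toeplitz_algebra G P) \<longleftrightarrow> independence G P)"
proof -
  interpret submonoid_of_group G P using assms by (rule submonoid_of_group.intro)
  from canonical_hom obtain \<Lambda> where \<Lambda>: "\<Lambda> \<in> star_hom (li_algebra G P) (toeplitz_algebra G P)"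
    and gen: "\<And>p. p \<in> P \<Longrightarrow> \<Lambda> (li_isom G P p) = toeplitz_gen G P p"
    and con: "\<And>a. a \<in> carrier (li_algebra G P) \<Longrightarrow>
      cnorm (toeplitz_algebra G P) (\<Lambda> a) \<le> cnorm (li_algebra G P) a"
    by blast
  have surj: "\<Lambda> ` carrier (li_algebra G P) = carrier (toeplitz_algebra G P)"
    by (rule canonical_hom_surj[OF \<Lambda> gen con])
  \<comment> \<open>Surjectivity being unconditional, independence only has to decide
    injectivity.\<close>
  have "\<Lambda> \<in> star_iso (li_algebra G P) (toeplitz_algebra G P) \<longleftrightarrow> inj_on \<Lambda> (carrier (li_algebra G P))"
    using \<Lambda> surj by (simp add: star_iso_def bij_betw_def)
  also have "\<dots> \<longleftrightarrow> independence G P"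
    using injective_imp_independence[OF \<Lambda> gen] independence_imp_injective[OF _ \<Lambda> gen con] by blast
  finally show ?thesis using \<Lambda> gen surj by blast
qed

end
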